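(* Let $X=(X_n)_{n\ge 0}$ be a nearest-neighbour self-interacting random walk on $\mathbb{Z}$ and let $\mathcal{F}_n=\sigma(X_k, k\le n)$. Suppose that there exist $M\in\mathbb{N}$ and $(\eta_k)_{k\le M}\in[0,1)^M$ such that (1) $\mathbb{P}(X_{n+1}=X_n+1\mid\mathcal{F}_n)\,I_{\{\ell(n)=k\}}\le\eta_k$ for all $1\le k\le M$ and all $n\ge 0$, almost surely, and (2) $\mathbb{P}(X_{n+1}=X_n+1\mid\mathcal{F}_n)\,I_{\{\ell(n)=k\}}\le\tfrac12$ for all $k>M$ and all $n\ge 0$, almost surely. Let $\alpha=\sum_{k=1}^M(2\eta_k-1)$. Then: (a) if $\alpha\le 1$ then $X$ is not transient to the right, almost surely; (b) if $\alpha\le 2$ then $\limsup_{n\to\infty} n^{-1}X_n\le 0$ almost surely; (c) if $\alpha<-1$ then $X$ is transient to the left, almost surely; (d) if $\alpha<-2$ then $\liminf_{n\to\infty} n^{-1}X_n<0$ almost surely.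
   Context: A nearest-neighbour self-interacting random walk is a sequence $(X_n)_{n\ge 0}$ of $\mathbb{Z}$-valued random variables with $X_{n+1}-X_n\in\{-1,1\}$ almost surely for every $n$ (the transition probabilities may depend arbitrarily on the history). $\ell(n)=\sum_{m=0}^n 1_{\{X_m=X_n\}}$ is the number of visits, up to and including time $n$, to the current site $X_n$. $\mathbb{N}=\{1,2,\dots\}$. A sequence is transient to the right if $\liminf_{n\to\infty}X_n=+\infty$, and transient to the left if $\limsup_{n\to\infty}X_n=-\infty$. *)

theory Defs
  imports "HOL-Probability.Probability"
begin

definition nn_walk :: "'a measure \<Rightarrow> (nat \<Rightarrow> 'a \<Rightarrow> int) \<Rightarrow> bool" where
  "nn_walk P X \<longleftrightarrow>
     (\<forall>n. X n \<in> measurable P (count_space UNIV)) \<and>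
     (\<forall>n. AE \<omega> in P. X (Suc n) \<omega> - X n \<omega> \<in> {-1, 1})"

definition hist_algebra :: "'a measure \<Rightarrow> (nat \<Rightarrow> 'a \<Rightarrow> int) \<Rightarrow> nat \<Rightarrow> 'a measure" where
  "hist_algebra P X n = sigma (space P) {X k -` A \<inter> space P | k A. k \<le> n}"

text \<open>\<^const>\<open>real_cond_exp\<close> is the conditional expectation only with respect to a subalgebra;
  otherwise it is a dummy value.\<close>

lemma subalgebra_hist_algebra:
  assumes "nn_walk P X"
  shows "subalgebra P (hist_algebra P X n)"
proof -
  have "{X k -` A \<inter> space P | k A. k \<le> n} \<subseteq> sets P"
    proof clarify
    fix k and A :: "int set"
    have "X k \<in> measurable P (count_space UNIV)"
      using assms by (simp add: nn_walk_def)
    then show "X k -` A \<inter> space P \<in> sets P"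
      by (rule measurable_sets) simp
  qed
  then have "sigma_sets (space P) {X k -` A \<inter> space P | k A. k \<le> n} \<subseteq> sets P"
    by (rule sets.sigma_sets_subset)
  moreover have "{X k -` A \<inter> space P | k A. k \<le> n} \<subseteq> Pow (space P)"
    by blast
  ultimately show ?thesis
    by (simp add: subalgebra_def hist_algebra_def space_measure_of sets_measure_of)
qed

definition prob_up :: "'a measure \<Rightarrow> (nat \<Rightarrow> 'a \<Rightarrow> int) \<Rightarrow> nat \<Rightarrow> 'a \<Rightarrow> real" where
  "prob_up P X n =
     real_cond_exp P (hist_algebra P X n)
       (indicator {\<omega> \<in> space P. X (Suc n) \<omega> = X n \<omega> + 1})"

definition visits :: "(nat \<Rightarrow> int) \<Rightarrow> nat \<Rightarrow> nat" where
  "visits x n = (\<Sum>m\<le>n. of_bool (x m = x n))"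

definition transient_right :: "(nat \<Rightarrow> int) \<Rightarrow> bool" where
  "transient_right x \<longleftrightarrow> liminf (\<lambda>n. ereal (real_of_int (x n))) = \<infinity>"

definition transient_left :: "(nat \<Rightarrow> int) \<Rightarrow> bool" where
  "transient_left x \<longleftrightarrow> limsup (\<lambda>n. ereal (real_of_int (x n))) = -\<infinity>"

end

(* The walk is described by the arrows (directions) it takes at the successive visits of each site.
   If the walk goes from a site b down to a site a, the numbers of left and right steps on adjacent
   edges determine each other, so these numbers form a branching-type process in the space variable:
   the state at the next site is the number of arrows of one kind before the j-th arrow of the other
   kind.  For arrows distributed like a cookie environment (eta_1, ..., eta_M, 1/2, 1/2, ...) this is
   a Markov chain, and all its relevant functionals are monotone in the arrows.  The conditional
   expectation of such a functional given the arrows seen so far is therefore a supermartingale along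
   every walk satisfying the hypotheses, which bounds probabilities for the walk by probabilities for
   the chain without a coupling or an extension of the probability space.

   The chain is tractable because the generating function of the geometric distribution with
   parameter 1/2 maps 1 - 1/t to 1 - 1/(t+1): a chain that has used all cookies sends (1 - 1/t)^j to
   c(t) (1 - 1/(t+1))^j with c(t) a product of factors 1 +- (2 eta_k - 1)/t, so c(t) = 1 +- alpha/t + O(1/t^2).
   Weighted sums of the powers (1 - 1/t)^j telescope and provide all the Lyapunov functions except
   for (d), where second moments suffice.  For (a) and (b) one may add cookies to reach the critical
   values alpha = 1 and alpha = 2. *)

theory Submission
  imports Defs
begin

section \<open>Counting arrows at one site\<close>

text \<open>The thresholds come from the weights. Telescoping forces the weight of (1 - 1/t)^j to
  grow like t to the power \<open>drift\<close>, which is - \<alpha> for right arrows and \<alpha>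
  for left arrows. The sum of the weights diverges at \<open>drift = -1\<close> and converges below
  it, which separates (a) from (c). Waiting for one further arrow, as the chain does before a
  hitting time, lowers the exponent by one; at \<open>drift = 2\<close>, the value needed for (b),
  the coefficient of j^2 is then comparable to a harmonic sum and diverges only logarithmically. The
  obstacle throughout is that the generating function identity holds only at states j large enough
  to use up all cookies, so no Lyapunov function has the right drift at small states. These are
  handled by a positive chance of dying at once in (a), by a trivial bound in (c), by a jump to a
  high level in (b), and by monotonicity in j in (d). The strict inequalities \<eta>_k < 1 supply
  the positive chances.\<close>

definition nb :: "(nat \<Rightarrow> real) \<Rightarrow> nat \<Rightarrow> real" where
  "nb F j = measure_pmf.expectation (neg_binomial_pmf j (1/2)) F"

text \<open>\<open>stopped ps F j\<close> is the expectation of \<open>F\<close> at the number of \<open>True\<close> arrows before the \<open>j\<close>-th \<open>False\<close> arrow,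
  where the arrows are independent, the first ones are \<open>True\<close> with the probabilities listed in \<open>ps\<close> and the
  others are fair.  \<open>resumed a ps F j\<close>, defined below, is the conditional expectation given that the
  arrows start with \<open>a\<close>.\<close>

fun stopped :: "real list \<Rightarrow> (nat \<Rightarrow> real) \<Rightarrow> nat \<Rightarrow> real" where
  "stopped [] F j = nb F j"
| "stopped (p # ps) F 0 = F 0"
| "stopped (p # ps) F (Suc j) = p * stopped ps (\<lambda>z. F (Suc z)) (Suc j) + (1 - p) * stopped ps F j"

lemma integrable_pmf_bounded:
  fixes F :: "'a \<Rightarrow> real"
  assumes "bounded (range F)"
  shows "integrable (measure_pmf \<mu>) F"
proof -
  obtain B where "\<And>x. norm (F x) \<le> B"
    using assms by (auto simp: bounded_iff)
  then show ?thesis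
    by (intro measure_pmf.integrable_const_bound[where B = B]) auto
qed

lemma bounded_range_compose:
  "bounded (range F) \<Longrightarrow> bounded (range (\<lambda>z. F (g z)))"
  by (erule bounded_subset) auto

lemma nb_0 [simp]: "nb F 0 = F 0"
  by (simp add: nb_def)

text \<open>Conditioning on the first fair arrow. The state \<open>Suc j\<close> occurs again on the
  right-hand side, so this identity could not serve as a recursive definition; for this reason
  \<open>nb\<close> is built on the negative binomial distribution.\<close>

lemma nb_Suc:
  assumes "bounded (range F)"
  shows "nb F (Suc j) = (nb (\<lambda>z. F (Suc z)) (Suc j) + nb F j) / 2"
proof -
  obtain B where B: "\<And>x. norm (F x) \<le> B"
    using assms by (auto simp: bounded_iff)
  define N where "N = (\<lambda>b. if b then neg_binomial_pmf j (1/2)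
      else map_pmf Suc (neg_binomial_pmf (Suc j) (1/2)))"
  have "neg_binomial_pmf (Suc j) (1/2) = bernoulli_pmf (1/2) \<bind> N"
    unfolding N_def by (subst neg_binomial_pmf_unfold) auto
  then have "nb F (Suc j) = measure_pmf.expectation (bernoulli_pmf (1/2) \<bind> N) F"
    by (simp only: nb_def)
  also have "\<dots> = measure_pmf.expectation (bernoulli_pmf (1/2)) (\<lambda>b. measure_pmf.expectation (N b) F)"
    unfolding measure_pmf_bind
    by (rule integral_bind[where K = "count_space UNIV" and B = B and B' = 1])
      (use B in \<open>auto simp: measure_pmf.emeasure_space_1 measure_pmf_in_subprob_algebra\<close>)
  also have "\<dots> = (nb (\<lambda>z. F (Suc z)) (Suc j) + nb F j) / 2"
    by (simp add: nb_def N_def)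
  finally show ?thesis .
qed

lemma nb_mono:
  assumes "bounded (range F)" "bounded (range G)" "\<And>z. F z \<le> G z"
  shows "nb F j \<le> nb G j"
  unfolding nb_def by (intro integral_mono integrable_pmf_bounded assms)

lemma nb_add:
  assumes "bounded (range F)" "bounded (range G)"
  shows "nb (\<lambda>z. F z + G z) j = nb F j + nb G j"
  unfolding nb_def by (intro Bochner_Integration.integral_add integrable_pmf_bounded assms)

lemma nb_scale: "nb (\<lambda>z. c * F z) j = c * nb F j"
  unfolding nb_def by simp

lemma nb_const [simp]: "nb (\<lambda>z. c) j = c"
  unfolding nb_def by simp

lemma nb_tendsto:
  assumes "\<And>n z. \<bar>F n z\<bar> \<le> B" "\<And>z. (\<lambda>n. F n z) \<longlonglongrightarrow> G z"
  shows "(\<lambda>n. nb (F n) j) \<longlonglongrightarrow> nb G j"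
  unfolding nb_def
  by (rule integral_dominated_convergence[where w = "\<lambda>_. B"]) (use assms in auto)

lemma nb_antimono:
  assumes F: "bounded (range F)" "antimono F"
  shows "nb F (Suc j) \<le> nb F j"
proof -
  have "nb (\<lambda>z. F (Suc z)) (Suc j) \<le> nb F (Suc j)"
    by (rule nb_mono[OF bounded_range_compose[OF F(1), of Suc] F(1)]) (rule antimonoD[OF F(2)], simp)
  then show ?thesis using nb_Suc[OF F(1), of j] by simp
qed

lemma stopped_0 [simp]: "stopped ps F 0 = F 0"
  by (cases ps) auto

lemma stopped_mono:
  assumes "set ps \<subseteq> {0..1}" "bounded (range F)" "bounded (range G)" "\<And>z. F z \<le> G z"
  shows "stopped ps F j \<le> stopped ps G j"
  using assms
proof (induction ps F j arbitrary: G rule: stopped.induct)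
  case (1 F j)
  then show ?case by (simp add: nb_mono)
next
  case (3 p ps F j)
  have "stopped ps (\<lambda>z. F (Suc z)) (Suc j) \<le> stopped ps (\<lambda>z. G (Suc z)) (Suc j)"
    by (rule "3.IH"(1)) (use "3.prems" bounded_range_compose[OF "3.prems"(2), of Suc]
        bounded_range_compose[OF "3.prems"(3), of Suc] in auto)
  moreover have "stopped ps F j \<le> stopped ps G j"
    by (rule "3.IH"(2)) (use "3.prems" in auto)
  ultimately show ?case
    using "3.prems"(1) by (auto intro!: add_mono mult_left_mono)
qed auto

lemma stopped_add:
  assumes "bounded (range F)" "bounded (range G)"
  shows "stopped ps (\<lambda>z. F z + G z) j = stopped ps F j + stopped ps G j"
  using assms
proof (induction ps F j arbitrary: G rule: stopped.induct)
  case (3 p ps F j)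
  have "stopped ps (\<lambda>z. F (Suc z) + G (Suc z)) (Suc j)
      = stopped ps (\<lambda>z. F (Suc z)) (Suc j) + stopped ps (\<lambda>z. G (Suc z)) (Suc j)"
    by (rule "3.IH"(1)) (use "3.prems" bounded_range_compose[OF "3.prems"(1), of Suc]
        bounded_range_compose[OF "3.prems"(2), of Suc] in auto)
  moreover have "stopped ps (\<lambda>z. F z + G z) j = stopped ps F j + stopped ps G j"
    by (rule "3.IH"(2)) (use "3.prems" in auto)
  ultimately show ?case
    by (simp add: algebra_simps)
qed (auto simp: nb_add)

lemma stopped_scale: "stopped ps (\<lambda>z. c * F z) j = c * stopped ps F j"
  by (induction ps F j rule: stopped.induct) (auto simp: nb_scale algebra_simps)

lemma stopped_const [simp]: "stopped ps (\<lambda>z. c) j = c"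
  by (induction ps "\<lambda>z::nat. c" j rule: stopped.induct) (auto simp: algebra_simps)

lemma stopped_diff:
  assumes "bounded (range F)" "bounded (range G)"
  shows "stopped ps (\<lambda>z. F z - G z) j = stopped ps F j - stopped ps G j"
proof -
  have "bounded (range (\<lambda>z. - 1 * G z))"
    using assms(2) by (auto simp: bounded_iff)
  from stopped_add[OF assms(1) this, of ps j] show ?thesis
    by (simp only: stopped_scale) simp
qed

lemma stopped_sum:
  assumes "finite A" "\<And>t. t \<in> A \<Longrightarrow> bounded (range (F t))"
  shows "stopped ps (\<lambda>z. \<Sum>t\<in>A. F t z) j = (\<Sum>t\<in>A. stopped ps (F t) j)"
  using assms
proof (induction A rule: finite_induct)
  case (insert t A)
  have "bounded (range (\<lambda>z. \<Sum>t\<in>A. F t z))"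
  proof -
    have "\<forall>t\<in>A. \<exists>B. \<forall>z. \<bar>F t z\<bar> \<le> B"
      using insert.prems by (auto simp: bounded_iff)
    then obtain B where B: "\<And>t z. t \<in> A \<Longrightarrow> \<bar>F t z\<bar> \<le> B t"
      by metis
    have "\<bar>\<Sum>t\<in>A. F t z\<bar> \<le> (\<Sum>t\<in>A. B t)" for z
      by (rule order_trans[OF sum_abs]) (auto intro: sum_mono B)
    then show ?thesis by (auto simp: bounded_iff)
  qed
  then show ?case
    using insert by (simp add: stopped_add)
qed simp

lemma stopped_tendsto:
  assumes "\<And>n z. \<bar>F n z\<bar> \<le> B" "\<And>z. (\<lambda>n. F n z) \<longlonglongrightarrow> G z"
  shows "(\<lambda>n. stopped ps (F n) j) \<longlonglongrightarrow> stopped ps G j"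
  using assms
proof (induction ps arbitrary: F G j)
  case Nil
  then show ?case by (simp add: nb_tendsto[OF Nil.prems])
next
  case (Cons p ps)
  show ?case
  proof (cases j)
    case 0
    then show ?thesis using Cons.prems by simp
  next
    case (Suc i)
    then show ?thesis using Cons.prems
      by (auto intro!: tendsto_intros Cons.IH)
  qed
qed

lemma stopped_bounds:
  assumes "set ps \<subseteq> {0..1}" "\<And>z. a \<le> F z" "\<And>z. F z \<le> b"
  shows "a \<le> stopped ps F j" "stopped ps F j \<le> b"
proof -
  have b: "bounded (range F)"
  proof (rule boundedI)
    fix x assume "x \<in> range F"
    then obtain z where "x = F z" by blast
    then show "norm x \<le> max \<bar>a\<bar> \<bar>b\<bar>"
      using assms(2)[of z] assms(3)[of z] by (auto simp: abs_le_iff)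
  qed
  have "stopped ps (\<lambda>_. a) j \<le> stopped ps F j"
    by (rule stopped_mono[OF assms(1) _ b assms(2)]) simp
  then show "a \<le> stopped ps F j" by simp
  have "stopped ps F j \<le> stopped ps (\<lambda>_. b) j"
    by (rule stopped_mono[OF assms(1) b _ assms(3)]) simp
  then show "stopped ps F j \<le> b" by simp
qed

lemma bounded_unit: "(\<And>z. F z \<in> {0..1::real}) \<Longrightarrow> bounded (range F)"
  by (rule boundedI[where B = 1]) force

lemma antimono_shift: "antimono F \<Longrightarrow> antimono (\<lambda>z. F (Suc z))" for F :: "nat \<Rightarrow> real"
  by (rule antimonoI) (auto elim: antimonoD)

lemma stopped_le_start:
  assumes "set ps \<subseteq> {0..1}" "bounded (range F)" "antimono F"
  shows "stopped ps F j \<le> F 0"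
proof -
  have "stopped ps F j \<le> stopped ps (\<lambda>_. F 0) j"
    by (rule stopped_mono[OF assms(1,2)]) (simp_all add: antimonoD[OF assms(3)])
  then show ?thesis by simp
qed

text \<open>Waiting for one more \<open>False\<close> arrow can only increase the number of
  \<open>True\<close> arrows.\<close>

lemma stopped_antimono_Suc:
  assumes "set ps \<subseteq> {0..1}" "bounded (range F)" "antimono F"
  shows "stopped ps F (Suc j) \<le> stopped ps F j"
  using assms
proof (induction ps F j rule: stopped.induct)
  case (1 F j)
  then show ?case by (simp add: nb_antimono)
next
  case (2 p ps F)
  then show ?case using stopped_le_start[of "p # ps" F "Suc 0"] by simp
next
  case (3 p ps F j)
  have "stopped ps (\<lambda>z. F (Suc z)) (Suc (Suc j)) \<le> stopped ps (\<lambda>z. F (Suc z)) (Suc j)"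
    by (rule "3.IH"(1)) (use "3.prems" bounded_range_compose[OF "3.prems"(2), of Suc] antimono_shift[OF "3.prems"(3)] in auto)
  moreover have "stopped ps F (Suc j) \<le> stopped ps F j"
    by (rule "3.IH"(2)) (use "3.prems" in auto)
  ultimately show ?case
    using "3.prems"(1) by (auto intro!: add_mono mult_left_mono)
qed

lemma stopped_antimono:
  assumes "set ps \<subseteq> {0..1}" "bounded (range F)" "antimono F"
  shows "antimono (stopped ps F)"
  unfolding antimono_iff_le_Suc using stopped_antimono_Suc[OF assms] by blast

section \<open>Conditioning on the arrows seen so far\<close>

definition arrow_prob :: "real list \<Rightarrow> nat \<Rightarrow> real" where
  "arrow_prob ps n = (if n < length ps then ps ! n else 1/2)"

lemma stopped_Suc:
  assumes "bounded (range F)"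
  shows "stopped ps F (Suc j)
    = arrow_prob ps 0 * stopped (tl ps) (\<lambda>z. F (Suc z)) (Suc j)
      + (1 - arrow_prob ps 0) * stopped (tl ps) F j"
  by (cases ps) (auto simp: arrow_prob_def nb_Suc[OF assms])

fun resumed :: "bool list \<Rightarrow> real list \<Rightarrow> (nat \<Rightarrow> real) \<Rightarrow> nat \<Rightarrow> real" where
  "resumed [] ps F j = stopped ps F j"
| "resumed (s # a) ps F 0 = F 0"
| "resumed (True # a) ps F (Suc j) = resumed a (tl ps) (\<lambda>z. F (Suc z)) (Suc j)"
| "resumed (False # a) ps F (Suc j) = resumed a (tl ps) F j"

lemma resumed_0 [simp]: "resumed a ps F 0 = F 0"
  by (cases a) auto

lemma set_tl_subset: "set (tl ps) \<subseteq> set ps"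
  by (cases ps) auto

text \<open>The martingale property in the arrows. Once the \<open>j\<close>-th \<open>False\<close>
  is among \<open>a\<close>, both continuations have the same value and the next arrow is
  irrelevant.\<close>

lemma resumed_step:
  assumes "bounded (range F)"
  shows "resumed a ps F j = arrow_prob ps (length a) * resumed (a @ [True]) ps F j
           + (1 - arrow_prob ps (length a)) * resumed (a @ [False]) ps F j"
  using assms
proof (induction a ps F j rule: resumed.induct)
  case (1 ps F j)
  then show ?case
    by (cases j) (auto simp: stopped_Suc algebra_simps)
next
  case (3 a ps F j)
  have "arrow_prob (tl ps) (length a) = arrow_prob ps (Suc (length a))"
    by (cases ps) (auto simp: arrow_prob_def)
  with "3.IH" "3.prems" show ?case by (simp add: bounded_range_compose)
next
  case (4 a ps F j)
  have "arrow_prob (tl ps) (length a) = arrow_prob ps (Suc (length a))"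
    by (cases ps) (auto simp: arrow_prob_def)
  with 4 show ?case by simp
qed (auto simp: algebra_simps)

lemma resumed_mono:
  assumes "set ps \<subseteq> {0..1}" "bounded (range F)" "bounded (range G)" "\<And>z. F z \<le> G z"
  shows "resumed a ps F j \<le> resumed a ps G j"
  using assms
proof (induction a ps F j arbitrary: G rule: resumed.induct)
  case (1 ps F j)
  then show ?case by (simp add: stopped_mono)
next
  case (3 a ps F j)
  show ?case
    by (simp, rule "3.IH")
      (use "3.prems" set_tl_subset[of ps] bounded_range_compose[OF "3.prems"(2), of Suc]
        bounded_range_compose[OF "3.prems"(3), of Suc] in auto)
next
  case (4 a ps F j)
  show ?case
    by (simp, rule "4.IH")
      (use "4.prems" set_tl_subset[of ps] in \<open>auto\<close>)
qed auto

lemma resumed_add: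
  assumes "bounded (range F)" "bounded (range G)"
  shows "resumed a ps (\<lambda>z. F z + G z) j = resumed a ps F j + resumed a ps G j"
  using assms
  by (induction a ps F j arbitrary: G rule: resumed.induct)
    (auto simp: stopped_add bounded_range_compose)

lemma resumed_scale: "resumed a ps (\<lambda>z. c * F z) j = c * resumed a ps F j"
  by (induction a ps F j rule: resumed.induct) (auto simp: stopped_scale)

lemma resumed_const [simp]: "resumed a ps (\<lambda>z. c) j = c"
  by (induction a ps "\<lambda>z::nat. c" j rule: resumed.induct) auto

lemma resumed_unit:
  assumes "set ps \<subseteq> {0..1}" "\<And>z. F z \<in> {0..1}"
  shows "resumed a ps F j \<in> {0..1}"
proof -
  note b = bounded_unit[OF assms(2)]
  have "resumed a ps (\<lambda>_. 0) j \<le> resumed a ps F j"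
    by (rule resumed_mono[OF assms(1) _ b]) (use assms(2) in auto)
  moreover have "resumed a ps F j \<le> resumed a ps (\<lambda>_. 1) j"
    by (rule resumed_mono[OF assms(1) b]) (use assms(2) in auto)
  ultimately show ?thesis by simp
qed

lemma resumed_antimono_Suc:
  assumes "set ps \<subseteq> {0..1}" "bounded (range F)" "antimono F"
  shows "resumed a ps F (Suc j) \<le> resumed a ps F j"
  using assms
proof (induction a ps F j rule: resumed.induct)
  case (1 ps F j)
  then show ?case by (simp add: stopped_antimono_Suc)
next
  case (2 s a ps F)
  have "resumed (s # a) ps F (Suc 0) \<le> resumed (s # a) ps (\<lambda>_. F 0) (Suc 0)"
    by (rule resumed_mono[OF "2.prems"(1,2)]) (simp_all add: antimonoD[OF "2.prems"(3)])
  then show ?case by simp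
next
  case (3 a ps F j)
  show ?case
    by (simp, rule "3.IH")
      (use "3.prems" set_tl_subset[of ps] bounded_range_compose[OF "3.prems"(2), of Suc]
        antimono_shift[OF "3.prems"(3)] in auto)
next
  case (4 a ps F j)
  show ?case
    by (simp, rule "4.IH")
      (use "4.prems" set_tl_subset[of ps] in \<open>auto\<close>)
qed

lemma resumed_antimono:
  assumes "set ps \<subseteq> {0..1}" "bounded (range F)" "antimono F"
  shows "antimono (resumed a ps F)"
  unfolding antimono_iff_le_Suc using resumed_antimono_Suc[OF assms] by blast

lemma set_tl_unit: "set ps \<subseteq> {0..1} \<Longrightarrow> set (tl ps) \<subseteq> {0..1::real}"
  by (cases ps) auto

text \<open>A \<open>True\<close> arrow raises the count by one, while a \<open>False\<close> arrow
  brings the end of the count closer; for antitone \<open>F\<close> both effects point the same way.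
  This is what turns a one-sided bound on step probabilities into a supermartingale
  inequality.\<close>

lemma resumed_True_le_False:
  assumes "set ps \<subseteq> {0..1}" "bounded (range F)" "antimono F"
  shows "resumed (a @ [True]) ps F j \<le> resumed (a @ [False]) ps F j"
  using assms
proof (induction a ps F j rule: resumed.induct)
  case (1 ps F j)
  note tl = set_tl_unit[OF 1(1)]
  show ?case
  proof (cases j)
    case (Suc i)
    have "stopped (tl ps) (\<lambda>z. F (Suc z)) (Suc i) \<le> stopped (tl ps) F (Suc i)"
      by (rule stopped_mono[OF tl bounded_range_compose[OF 1(2), of Suc] 1(2)]) (rule antimonoD[OF 1(3)], simp)
    also have "\<dots> \<le> stopped (tl ps) F i"
      by (rule stopped_antimono_Suc[OF tl 1(2,3)])
    finally show ?thesis using Suc by simp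
  qed simp
next
  case (2 s a ps F)
  show ?case by simp
next
  case (3 a ps F j)
  show ?case
    using "3.IH"[OF set_tl_unit[OF "3.prems"(1)] bounded_range_compose[OF "3.prems"(2)] antimono_shift[OF "3.prems"(3)]]
    by simp
next
  case (4 a ps F j)
  show ?case
    using "4.IH"[OF set_tl_unit[OF "4.prems"(1)] "4.prems"(2,3)] by simp
qed

text \<open>If the \<open>j\<close>-th \<open>False\<close> is already in \<open>a\<close>, the
  count is settled, and it is at most the number of all \<open>True\<close> arrows in
  \<open>a\<close>.\<close>

lemma resumed_ge:
  assumes "set ps \<subseteq> {0..1}" "antimono F" "j \<le> count_list a False"
  shows "F (count_list a True) \<le> resumed a ps F j"
  using assms
proof (induction a ps F j rule: resumed.induct)
  case (1 ps F j)
  then show ?case by simp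
next
  case (2 s a ps F)
  show ?case by (simp only: resumed.simps) (rule antimonoD[OF "2.prems"(2)], simp)
next
  case (3 a ps F j)
  show ?case
    using "3.IH"[OF set_tl_unit[OF "3.prems"(1)] antimono_shift[OF "3.prems"(2)]] "3.prems"(3)
    by simp
next
  case (4 a ps F j)
  show ?case
    using "4.IH"[OF set_tl_unit[OF "4.prems"(1)] "4.prems"(2)] "4.prems"(3) by simp
qed

text \<open>If no arrow of \<open>a\<close> comes after the \<open>j\<close>-th
  \<open>False\<close>, every \<open>True\<close> in \<open>a\<close> is counted, so the final count
  is at least their number.\<close>

lemma resumed_le:
  assumes "set ps \<subseteq> {0..1}" "bounded (range F)" "antimono F"
    and "count_list a False < j \<or> count_list a False = j \<and> a \<noteq> [] \<and> \<not> last a"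
  shows "resumed a ps F j \<le> F (count_list a True)"
  using assms
proof (induction a ps F j rule: resumed.induct)
  case (1 ps F j)
  then show ?case by (simp add: stopped_le_start)
next
  case (2 s a ps F)
  then have *: "count_list (s # a) False = 0" "\<not> last (s # a)"
    by (metis not_less_zero)+
  moreover have "last (s # a) \<in> set (s # a)"
    by (rule last_in_set) simp
  ultimately show ?case by (metis (full_types) count_list_0_iff)
next
  case (3 a ps F j)
  have "count_list a False < Suc j \<or> count_list a False = Suc j \<and> a \<noteq> [] \<and> \<not> last a"
    using "3.prems"(4) by (auto split: if_splits)
  from "3.IH"[OF set_tl_unit[OF "3.prems"(1)] bounded_range_compose[OF "3.prems"(2), of Suc]
      antimono_shift[OF "3.prems"(3)] this]
  show ?case by simp
next
  case (4 a ps F j)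
  show ?case
  proof (cases "a = []")
    case True
    then show ?thesis using stopped_le_start[OF set_tl_unit[OF "4.prems"(1)] "4.prems"(2,3)] by simp
  next
    case False
    then have "count_list a False < j \<or> count_list a False = j \<and> a \<noteq> [] \<and> \<not> last a"
      using "4.prems"(4) by (auto split: if_splits)
    from "4.IH"[OF set_tl_unit[OF "4.prems"(1)] "4.prems"(2,3) this] show ?thesis by simp
  qed
qed

section \<open>Domination of the walk by the cookie environment\<close>

primrec arrows :: "(nat \<Rightarrow> int) \<Rightarrow> nat \<Rightarrow> int \<Rightarrow> bool list" where
  "arrows x 0 = (\<lambda>y. [])"
| "arrows x (Suc n) = (arrows x n)(x n := arrows x n (x n) @ [x (Suc n) = x n + 1])"

lemma arrows_cong:
  "(\<And>m. m \<le> n \<Longrightarrow> x m = x' m) \<Longrightarrow> arrows x n = arrows x' n"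
  by (induction n) auto

text \<open>\<open>visits\<close> includes the current visit, whose arrow is recorded only at the
  next time; hence the \<open>Suc\<close>.\<close>

lemma visits_eq_length: "visits x n = Suc (length (arrows x n (x n)))"
proof -
  have "length (arrows x n y) = (\<Sum>m<n. of_bool (x m = y))" for y
    by (induction n) auto
  then show ?thesis
    unfolding visits_def by (simp flip: lessThan_Suc_atMost)
qed

text \<open>\<open>p\<close> plays the role of the conditional probability of a step to the right, of which only the
  upper bound \<open>\<rho>\<close> is known.\<close>

definition excessive :: "(nat \<Rightarrow> real) \<Rightarrow> ((int \<Rightarrow> bool list) \<Rightarrow> real) \<Rightarrow> bool" where
  "excessive \<rho> h \<longleftrightarrow> (\<forall>c y p. 0 \<le> p \<longrightarrow> p \<le> \<rho> (length (c y)) \<longrightarrow>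
     p * h (c(y := c y @ [True])) + (1 - p) * h (c(y := c y @ [False])) \<le> h c)"

locale dominated_walk = prob_space P for P :: "'a measure" +
  fixes X :: "nat \<Rightarrow> 'a \<Rightarrow> int" and \<rho> :: "nat \<Rightarrow> real"
  assumes nn: "nn_walk P X"
    and up: "AE \<omega> in P. \<forall>n. prob_up P X n \<omega> \<le> \<rho> (length (arrows (\<lambda>m. X m \<omega>) n (X n \<omega>)))"
begin

section \<open>Measurability with respect to the history\<close>

lemma X_measurable [measurable]: "X n \<in> measurable P (count_space UNIV)"
  using nn by (simp add: nn_walk_def)

lemma subalg: "subalgebra P (hist_algebra P X n)"
  by (rule subalgebra_hist_algebra[OF nn])

lemma X_hist_measurable: "k \<le> n \<Longrightarrow> X k \<in> measurable (hist_algebra P X n) (count_space UNIV)"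
proof (rule measurableI)
  fix A :: "int set" assume "k \<le> n"
  have *: "{X k -` A \<inter> space P | k A. k \<le> n} \<subseteq> Pow (space P)"
    by blast
  have "X k -` A \<inter> space P \<in> {X k -` A \<inter> space P | k A. k \<le> n}"
    using \<open>k \<le> n\<close> by blast
  then show "X k -` A \<inter> space (hist_algebra P X n) \<in> sets (hist_algebra P X n)"
    unfolding hist_algebra_def space_measure_of[OF *] sets_measure_of[OF *]
    by (rule sigma_sets.Basic)
qed simp

lemma prefix_measurable:
  assumes "\<And>k. k < n \<Longrightarrow> X k \<in> measurable N (count_space UNIV)"
  shows "(\<lambda>\<omega>. map (\<lambda>k. X k \<omega>) [0..<n]) \<in> measurable N (count_space UNIV)"
  using assms
proof (induction n)
  case (Suc n)
  have [measurable]: "(\<lambda>\<omega>. map (\<lambda>k. X k \<omega>) [0..<n]) \<in> measurable N (count_space UNIV)"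
    by (rule Suc.IH) (use Suc.prems in simp)
  have [measurable]: "X n \<in> measurable N (count_space UNIV)"
    using Suc.prems by simp
  have "(\<lambda>\<omega>. (\<lambda>l. l @ [X n \<omega>]) (map (\<lambda>k. X k \<omega>) [0..<n])) \<in> measurable N (count_space UNIV)"
    by (rule measurable_compose_countable[where f = "\<lambda>l \<omega>. l @ [X n \<omega>]"]) measurable
  then show ?case by simp
qed simp

text \<open>A history is a finite list of integers. Such lists form a countable type, so any
  function of the history is measurable, whatever its target.\<close>

lemma path_functional_measurable:
  fixes f :: "(nat \<Rightarrow> int) \<Rightarrow> 'b"
  assumes "\<And>x x'. (\<And>m. m \<le> n \<Longrightarrow> x m = x' m) \<Longrightarrow> f x = f x'"
  shows "(\<lambda>\<omega>. f (\<lambda>m. X m \<omega>)) \<in> measurable (hist_algebra P X n) (count_space UNIV)"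
proof -
  have "(\<lambda>\<omega>. map (\<lambda>k. X k \<omega>) [0..<Suc n]) \<in> measurable (hist_algebra P X n) (count_space UNIV)"
    by (rule prefix_measurable) (simp add: X_hist_measurable)
  then have "(\<lambda>\<omega>. f (\<lambda>m. map (\<lambda>k. X k \<omega>) [0..<Suc n] ! m)) \<in> measurable (hist_algebra P X n) (count_space UNIV)"
    by (rule measurable_compose) simp
  moreover have "f (\<lambda>m. map (\<lambda>k. X k \<omega>) [0..<Suc n] ! m) = f (\<lambda>m. X m \<omega>)" for \<omega>
    by (rule assms) (simp del: upt_Suc)
  ultimately show ?thesis by simp
qed

lemma hist_measurable_P: "f \<in> measurable (hist_algebra P X n) N \<Longrightarrow> f \<in> measurable P N"
  by (rule measurable_from_subalg[OF subalg])

lemma prob_up_bounds: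
  "AE \<omega> in P. 0 \<le> prob_up P X n \<omega> \<and> prob_up P X n \<omega> \<le> \<rho> (length (arrows (\<lambda>m. X m \<omega>) n (X n \<omega>)))"
proof -
  interpret finite_measure_subalgebra P "hist_algebra P X n"
    by standard (rule subalg)
  have "AE \<omega> in P. 0 \<le> prob_up P X n \<omega>"
    unfolding prob_up_def by (rule real_cond_exp_pos) auto
  with up show ?thesis by eventually_elim auto
qed

section \<open>Supermartingale inequalities for excessive functions\<close>

abbreviation "traj \<omega> \<equiv> (\<lambda>m. X m \<omega>)"

text \<open>Given the history, the next arrow at the current site is \<open>True\<close> with
  probability \<open>prob_up\<close>, which lies in the range allowed by \<open>excessive\<close>.
  The factor \<open>g\<close> is later the indicator that a stopping event has not occurred
  yet.\<close>

lemma excessive_step: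
  fixes g :: "(nat \<Rightarrow> int) \<Rightarrow> real"
  assumes h: "excessive \<rho> h" "\<And>c. 0 \<le> h c" "\<And>c. h c \<le> B"
    and g: "\<And>x x'. (\<And>m. m \<le> n \<Longrightarrow> x m = x' m) \<Longrightarrow> g x = g x'" "\<And>x. 0 \<le> g x" "\<And>x. g x \<le> 1"
  shows "expectation (\<lambda>\<omega>. g (traj \<omega>) * h (arrows (traj \<omega>) (Suc n)))
    \<le> expectation (\<lambda>\<omega>. g (traj \<omega>) * h (arrows (traj \<omega>) n))"
proof -
  let ?F = "hist_algebra P X n"
  interpret F: finite_measure_subalgebra P ?F
    by standard (rule subalg)
  define U where "U = {\<omega> \<in> space P. X (Suc n) \<omega> = X n \<omega> + 1}"
  have [measurable]: "U \<in> sets P"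
    unfolding U_def by measurable
  have B: "0 \<le> B" using h(2,3) order_trans by blast
  define a where "a = (\<lambda>b x. g x * h ((arrows x n)(x n := arrows x n (x n) @ [b])))"
  define k where "k = (\<lambda>x. g x * h (arrows x n))"
  have m: "(\<lambda>\<omega>. a b (traj \<omega>)) \<in> borel_measurable ?F" "(\<lambda>\<omega>. k (traj \<omega>)) \<in> borel_measurable ?F" for b
  proof -
    have "(\<lambda>\<omega>. a b (traj \<omega>)) \<in> measurable ?F (count_space UNIV)"
    proof (rule path_functional_measurable)
      fix x x' :: "nat \<Rightarrow> int" assume eq: "\<And>m. m \<le> n \<Longrightarrow> x m = x' m"
      have "arrows x n = arrows x' n" "x n = x' n" "g x = g x'"
        by (rule arrows_cong[OF eq], assumption, rule eq[OF order.refl], rule g(1)[OF eq])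
      then show "a b x = a b x'" by (simp add: a_def)
    qed
    then show "(\<lambda>\<omega>. a b (traj \<omega>)) \<in> borel_measurable ?F"
      by (rule measurable_compose) simp
    have "(\<lambda>\<omega>. k (traj \<omega>)) \<in> measurable ?F (count_space UNIV)"
    proof (rule path_functional_measurable)
      fix x x' :: "nat \<Rightarrow> int" assume eq: "\<And>m. m \<le> n \<Longrightarrow> x m = x' m"
      have "arrows x n = arrows x' n" "x n = x' n" "g x = g x'"
        by (rule arrows_cong[OF eq], assumption, rule eq[OF order.refl], rule g(1)[OF eq])
      then show "k x = k x'" by (simp add: k_def)
    qed
    then show "(\<lambda>\<omega>. k (traj \<omega>)) \<in> borel_measurable ?F"
      by (rule measurable_compose) simp
  qed
  have [measurable]: "(\<lambda>\<omega>. a b (traj \<omega>)) \<in> borel_measurable P" "(\<lambda>\<omega>. k (traj \<omega>)) \<in> borel_measurable P" for b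
    using m by (auto intro: hist_measurable_P)
  have unit: "0 \<le> u * v" "u * v \<le> B" if "0 \<le> u" "u \<le> 1" "0 \<le> v" "v \<le> B" for u v :: real
    using that mult_mono[of u 1 v B] by auto
  have ab: "\<bar>a b x\<bar> \<le> B" "0 \<le> a b x" "\<bar>k x\<bar> \<le> B" for b x
    unfolding a_def k_def using unit[OF g(2,3) h(2,3)] by (simp_all add: abs_of_nonneg)
  have ia: "integrable P (\<lambda>\<omega>. a b (traj \<omega>))" "integrable P (\<lambda>\<omega>. k (traj \<omega>))" for b
    using ab by (auto intro!: integrable_const_bound[where B = B] AE_I2)
  have iau: "integrable P (\<lambda>\<omega>. (a True (traj \<omega>) - a False (traj \<omega>)) * indicator U \<omega>)"
    by (intro integrable_real_mult_indicator Bochner_Integration.integrable_diff ia) simp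
  \<comment> \<open>Both possible continuations are known at time \<open>n\<close>; only the
    indicator of \<open>U\<close> is not. Once the integrand is affine in this indicator, the
    conditional probability can replace it.\<close>
  have "expectation (\<lambda>\<omega>. g (traj \<omega>) * h (arrows (traj \<omega>) (Suc n)))
      = expectation (\<lambda>\<omega>. (a True (traj \<omega>) - a False (traj \<omega>)) * indicator U \<omega> + a False (traj \<omega>))"
    by (rule Bochner_Integration.integral_cong) (auto simp: a_def U_def indicator_def)
  also have "\<dots> = expectation (\<lambda>\<omega>. (a True (traj \<omega>) - a False (traj \<omega>)) * indicator U \<omega>)
      + expectation (\<lambda>\<omega>. a False (traj \<omega>))"
    by (intro Bochner_Integration.integral_add iau ia)
  also have "expectation (\<lambda>\<omega>. (a True (traj \<omega>) - a False (traj \<omega>)) * indicator U \<omega>)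
     = expectation (\<lambda>\<omega>. (a True (traj \<omega>) - a False (traj \<omega>)) * prob_up P X n \<omega>)"
    unfolding prob_up_def U_def[symmetric]
    by (rule F.real_cond_exp_intg(2)[symmetric]) (use iau m in auto)
  also have "\<dots> + expectation (\<lambda>\<omega>. a False (traj \<omega>))
     = expectation (\<lambda>\<omega>. (a True (traj \<omega>) - a False (traj \<omega>)) * prob_up P X n \<omega> + a False (traj \<omega>))"
    unfolding prob_up_def U_def[symmetric]
    by (intro Bochner_Integration.integral_add[symmetric] ia F.real_cond_exp_intg(1)) (use iau m in auto)
  also have "\<dots> \<le> expectation (\<lambda>\<omega>. k (traj \<omega>))"
  proof (rule integral_mono_AE)
    show "integrable P (\<lambda>\<omega>. (a True (traj \<omega>) - a False (traj \<omega>)) * prob_up P X n \<omega> + a False (traj \<omega>))"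
      unfolding prob_up_def U_def[symmetric]
      by (intro Bochner_Integration.integrable_add ia F.real_cond_exp_intg(1)) (use iau m in auto)
    show "AE \<omega> in P. (a True (traj \<omega>) - a False (traj \<omega>)) * prob_up P X n \<omega> + a False (traj \<omega>) \<le> k (traj \<omega>)"
      using prob_up_bounds[of n]
    proof eventually_elim
      case (elim \<omega>)
      let ?p = "prob_up P X n \<omega>" and ?c = "arrows (traj \<omega>) n" and ?y = "X n \<omega>"
      have "?p * h (?c(?y := ?c ?y @ [True])) + (1 - ?p) * h (?c(?y := ?c ?y @ [False])) \<le> h ?c"
        using h(1) elim unfolding excessive_def by blast
      from mult_left_mono[OF this g(2)[of "traj \<omega>"]] show ?case
        by (simp add: a_def k_def algebra_simps)
    qed
  qed (rule ia)
  finally show ?thesis unfolding k_def .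
qed

text \<open>Doob's maximal inequality for the nonnegative supermartingale
  \<open>h (arrows x n)\<close>. Its initial value belongs to the empty configuration, so the bound
  is a number that concerns the chain alone.\<close>

theorem excessive_maximal:
  assumes h: "excessive \<rho> h" "\<And>c. 0 \<le> h c" "\<And>c. h c \<le> B"
  shows "{\<omega> \<in> space P. \<exists>n. 1 \<le> h (arrows (traj \<omega>) n)} \<in> events"
    and "prob {\<omega> \<in> space P. \<exists>n. 1 \<le> h (arrows (traj \<omega>) n)} \<le> h (\<lambda>_. [])"
proof -
  have m: "(\<lambda>\<omega>. f (traj \<omega>)) \<in> measurable P (count_space UNIV)"
    if "\<And>x x'. (\<And>m. m \<le> n \<Longrightarrow> x m = x' m) \<Longrightarrow> f x = f x'" for n and f :: "(nat \<Rightarrow> int) \<Rightarrow> 'b"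
    by (rule hist_measurable_P[OF path_functional_measurable[OF that]])
  define E where "E = (\<lambda>n x. \<exists>m\<le>n. 1 \<le> h (arrows x m))"
  have E_cong: "E n x = E n x'" if "\<And>m. m \<le> n \<Longrightarrow> x m = x' m" for n x x'
  proof -
    have "arrows x m = arrows x' m" if "m \<le> n" for m
      by (rule arrows_cong) (meson \<open>\<And>m. m \<le> n \<Longrightarrow> x m = x' m\<close> order_trans that)
    then show ?thesis unfolding E_def by metis
  qed
  have E_meas: "{\<omega> \<in> space P. E n (traj \<omega>)} \<in> events" for n
  proof -
    have "Measurable.pred P (\<lambda>\<omega>. E n (traj \<omega>))"
      by (rule m[of n]) (rule E_cong)
    then show ?thesis by measurable
  qed
  have B: "0 \<le> B" using h(2,3) order_trans by blast
  \<comment> \<open>The process is set to 1 for good from the first time at which \<open>h\<close>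
    reaches 1; its expectation still does not increase.\<close>
  define Y where "Y = (\<lambda>n x. if E n x then 1 else h (arrows x n))"
  have Y_cong: "Y n x = Y n x'" if "\<And>m. m \<le> n \<Longrightarrow> x m = x' m" for n x x'
  proof -
    have "E n x = E n x'" by (rule E_cong) (rule that)
    moreover have "arrows x n = arrows x' n" by (rule arrows_cong) (rule that)
    ultimately show ?thesis by (simp add: Y_def)
  qed
  have Ym: "(\<lambda>\<omega>. Y n (traj \<omega>)) \<in> borel_measurable P" for n
    by (rule measurable_compose[OF m[of n]]) (rule Y_cong, simp_all)
  have Yi: "integrable P (\<lambda>\<omega>. Y n (traj \<omega>))" for n
  proof (rule integrable_const_bound[where B = "B + 1"])
    have "norm (Y n x) \<le> B + 1" for x
      using h(2)[of "arrows x n"] h(3)[of "arrows x n"] B by (simp add: Y_def)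
    then show "AE \<omega> in P. norm (Y n (traj \<omega>)) \<le> B + 1" by simp
  qed (rule Ym)
  have dec: "expectation (\<lambda>\<omega>. Y (Suc n) (traj \<omega>)) \<le> expectation (\<lambda>\<omega>. Y n (traj \<omega>))" for n
  proof -
    let ?g = "\<lambda>x. of_bool (\<not> E n x) :: real"
    have gi: "integrable P (\<lambda>\<omega>. ?g (traj \<omega>) * h (arrows (traj \<omega>) k))"
      "integrable P (\<lambda>\<omega>. of_bool (E n (traj \<omega>)) :: real)" if "k \<in> {n, Suc n}" for k
    proof -
      have "(\<lambda>\<omega>. ?g (traj \<omega>) * h (arrows (traj \<omega>) k)) \<in> borel_measurable P"
      proof (rule measurable_compose[OF m[of "Suc n"]])
        fix x x' :: "nat \<Rightarrow> int" assume eq: "\<And>m. m \<le> Suc n \<Longrightarrow> x m = x' m"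
        have "E n x = E n x'" by (rule E_cong) (simp add: eq)
        moreover have "arrows x k = arrows x' k" by (rule arrows_cong) (use eq that in auto)
        ultimately show "?g x * h (arrows x k) = ?g x' * h (arrows x' k)" by simp
      qed simp
      then show "integrable P (\<lambda>\<omega>. ?g (traj \<omega>) * h (arrows (traj \<omega>) k))"
        by (rule integrable_const_bound[where B = B, rotated])
            (use h(2,3) B in \<open>simp add: abs_of_nonneg del: arrows.simps\<close>)
      have "(\<lambda>\<omega>. of_bool (E n (traj \<omega>)) :: real) \<in> borel_measurable P"
        by (rule measurable_compose[OF m[of n]]) (rule arg_cong[where f = of_bool], rule E_cong, simp_all)
      then show "integrable P (\<lambda>\<omega>. of_bool (E n (traj \<omega>)) :: real)"
        by (rule integrable_const_bound[where B = 1, rotated]) auto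
    qed
    have "expectation (\<lambda>\<omega>. Y (Suc n) (traj \<omega>))
      \<le> expectation (\<lambda>\<omega>. ?g (traj \<omega>) * h (arrows (traj \<omega>) (Suc n)) + of_bool (E n (traj \<omega>)))"
    proof (rule integral_mono[OF Yi])
      show "integrable P (\<lambda>\<omega>. ?g (traj \<omega>) * h (arrows (traj \<omega>) (Suc n)) + of_bool (E n (traj \<omega>)))"
        by (intro Bochner_Integration.integrable_add gi(1) gi(2)[of n]) auto
      show "Y (Suc n) (traj \<omega>) \<le> ?g (traj \<omega>) * h (arrows (traj \<omega>) (Suc n)) + of_bool (E n (traj \<omega>))" for \<omega>
        unfolding Y_def E_def by (auto simp del: arrows.simps simp: le_Suc_eq)
    qed
    also have "\<dots> = expectation (\<lambda>\<omega>. ?g (traj \<omega>) * h (arrows (traj \<omega>) (Suc n)))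
        + expectation (\<lambda>\<omega>. of_bool (E n (traj \<omega>)))"
      by (intro Bochner_Integration.integral_add gi(1) gi(2)[of n]) auto
    also have "expectation (\<lambda>\<omega>. ?g (traj \<omega>) * h (arrows (traj \<omega>) (Suc n)))
      \<le> expectation (\<lambda>\<omega>. ?g (traj \<omega>) * h (arrows (traj \<omega>) n))"
      by (rule excessive_step[OF h]) (simp_all, metis E_cong)
    also have "expectation (\<lambda>\<omega>. ?g (traj \<omega>) * h (arrows (traj \<omega>) n))
        + expectation (\<lambda>\<omega>. of_bool (E n (traj \<omega>)))
      = expectation (\<lambda>\<omega>. ?g (traj \<omega>) * h (arrows (traj \<omega>) n) + of_bool (E n (traj \<omega>)))"
      by (intro Bochner_Integration.integral_add[symmetric] gi(1) gi(2)[of n]) auto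
    also have "\<dots> = expectation (\<lambda>\<omega>. Y n (traj \<omega>))"
      by (rule Bochner_Integration.integral_cong) (auto simp: Y_def)
    finally show ?thesis by simp
  qed
  have bound: "expectation (\<lambda>\<omega>. Y n (traj \<omega>)) \<le> h (\<lambda>_. [])" for n
  proof (induction n)
    case 0
    have "expectation (\<lambda>\<omega>. Y 0 (traj \<omega>)) \<le> expectation (\<lambda>\<omega>. h (\<lambda>_. []))"
      by (rule integral_mono[OF Yi]) (auto simp: Y_def E_def)
    then show ?case by (simp add: prob_space)
  next
    case (Suc n)
    then show ?case using dec[of n] by simp
  qed
  have pE: "prob {\<omega> \<in> space P. E n (traj \<omega>)} \<le> h (\<lambda>_. [])" for n
  proof -
    have "prob {\<omega> \<in> space P. E n (traj \<omega>)} = expectation (indicator {\<omega> \<in> space P. E n (traj \<omega>)})"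
      using E_meas[of n] by simp
    also have "\<dots> \<le> expectation (\<lambda>\<omega>. Y n (traj \<omega>))"
    proof (rule integral_mono[OF _ Yi])
      show "integrable P (indicator {\<omega> \<in> space P. E n (traj \<omega>)} :: _ \<Rightarrow> real)"
        by (rule integrable_real_indicator) (simp_all add: E_meas emeasure_eq_measure)
      show "indicator {\<omega> \<in> space P. E n (traj \<omega>)} \<omega> \<le> Y n (traj \<omega>)" for \<omega>
        using h(2) by (simp add: Y_def indicator_def)
    qed
    also note bound
    finally show ?thesis .
  qed
  have eq: "{\<omega> \<in> space P. \<exists>n. 1 \<le> h (arrows (traj \<omega>) n)} = (\<Union>n. {\<omega> \<in> space P. E n (traj \<omega>)})"
    unfolding E_def by blast
  show "{\<omega> \<in> space P. \<exists>n. 1 \<le> h (arrows (traj \<omega>) n)} \<in> events"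
    unfolding eq using E_meas by blast
  have "(\<lambda>n. prob {\<omega> \<in> space P. E n (traj \<omega>)}) \<longlonglongrightarrow> prob (\<Union>n. {\<omega> \<in> space P. E n (traj \<omega>)})"
    
  proof (rule finite_Lim_measure_incseq)
    show "range (\<lambda>n. {\<omega> \<in> space P. E n (traj \<omega>)}) \<subseteq> events" using E_meas by blast
    show "incseq (\<lambda>n. {\<omega> \<in> space P. E n (traj \<omega>)})"
      unfolding incseq_def E_def using order_trans by blast
  qed
  then show "prob {\<omega> \<in> space P. \<exists>n. 1 \<le> h (arrows (traj \<omega>) n)} \<le> h (\<lambda>_. [])"
    unfolding eq by (rule LIMSEQ_le_const2) (use pE in auto)
qed

lemma AE_nn: "AE \<omega> in P. \<forall>n. \<bar>X (Suc n) \<omega> - X n \<omega>\<bar> = 1"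
proof -
  have "AE \<omega> in P. \<forall>n. X (Suc n) \<omega> - X n \<omega> \<in> {-1, 1}"
    using nn by (simp add: nn_walk_def AE_all_countable)
  then show ?thesis by eventually_elim (metis abs_1 abs_minus insert_iff singletonD)
qed

text \<open>A family of excessive functions is allowed because the depth needed to detect the event
  may depend on the path.\<close>

lemma AE_not_if_excessive:
  assumes "\<And>\<epsilon>. 0 < \<epsilon> \<Longrightarrow> \<exists>h B. (\<forall>N::nat. excessive \<rho> (h N) \<and> (\<forall>c. 0 \<le> h N c \<and> h N c \<le> B N) \<and> h N (\<lambda>_. []) \<le> \<epsilon>)
      \<and> (\<forall>x. (\<forall>n. \<bar>x (Suc n) - x n\<bar> = 1) \<longrightarrow> Q x \<longrightarrow>
          eventually (\<lambda>N. \<exists>n. 1 \<le> h N (arrows x n)) sequentially)"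
  shows "AE \<omega> in P. \<not> Q (traj \<omega>)"
proof -
  have ex: "\<exists>E \<in> events. prob E \<le> \<epsilon> \<and>
      (\<forall>\<omega>\<in>space P. (\<forall>n. \<bar>X (Suc n) \<omega> - X n \<omega>\<bar> = 1) \<longrightarrow> Q (traj \<omega>) \<longrightarrow> \<omega> \<in> E)" if "0 < \<epsilon>" for \<epsilon> :: real
  proof -
    obtain h B where hB: "\<And>N::nat. excessive \<rho> (h N)" "\<And>N c. 0 \<le> h N c" "\<And>N c. h N c \<le> B N" "\<And>N. h N (\<lambda>_. []) \<le> \<epsilon>"
      and Q: "\<And>x. (\<forall>n. \<bar>x (Suc n) - x n\<bar> = 1) \<Longrightarrow> Q x \<Longrightarrow>
          eventually (\<lambda>N. \<exists>n. 1 \<le> h N (arrows x n)) sequentially"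
      using assms[OF \<open>0 < \<epsilon>\<close>] by blast
    define A where "A = (\<lambda>N. {\<omega> \<in> space P. \<exists>n. 1 \<le> h N (arrows (traj \<omega>) n)})"
    have A: "A N \<in> events" "prob (A N) \<le> \<epsilon>" for N
      using excessive_maximal[OF hB(1,2,3), of N] hB(4)[of N] unfolding A_def by auto
    \<comment> \<open>A bad path lies in \<open>A N\<close> for all large \<open>N\<close>, hence in
      the increasing union of the sets \<open>D K\<close>. Each \<open>D K\<close> is contained in
      \<open>A K\<close>, so its probability is at most \<open>\<epsilon>\<close>, and the union
      inherits this bound.\<close>
    define D where "D = (\<lambda>K. \<Inter>N\<in>{K..}. A N)"
    have D: "D K \<in> events" for K
      unfolding D_def by (rule sets.countable_INT') (use A in auto)
    have "prob (D K) \<le> \<epsilon>" for K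
      by (rule order_trans[OF finite_measure_mono A(2)[of K]]) (use A in \<open>auto simp: D_def\<close>)
    moreover have "(\<lambda>K. prob (D K)) \<longlonglongrightarrow> prob (\<Union>K. D K)"
      by (rule finite_Lim_measure_incseq) (use D in \<open>auto simp: incseq_def D_def\<close>)
    ultimately have "prob (\<Union>K. D K) \<le> \<epsilon>"
      by (intro LIMSEQ_le_const2) auto
    moreover have "\<omega> \<in> (\<Union>K. D K)" if "\<omega> \<in> space P" "\<forall>n. \<bar>X (Suc n) \<omega> - X n \<omega>\<bar> = 1" "Q (traj \<omega>)" for \<omega>
      using Q[of "traj \<omega>"] that unfolding eventually_sequentially D_def A_def by auto
    ultimately show ?thesis using D by blast
  qed
  have "\<forall>k::nat. \<exists>E \<in> events. prob E \<le> 1 / Suc k \<and>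
      (\<forall>\<omega>\<in>space P. (\<forall>n. \<bar>X (Suc n) \<omega> - X n \<omega>\<bar> = 1) \<longrightarrow> Q (traj \<omega>) \<longrightarrow> \<omega> \<in> E)"
    by (intro allI ex) simp
  then obtain E where E: "\<And>k::nat. E k \<in> events" "\<And>k. prob (E k) \<le> 1 / Suc k"
    "\<And>k \<omega>. \<omega> \<in> space P \<Longrightarrow> (\<forall>n. \<bar>X (Suc n) \<omega> - X n \<omega>\<bar> = 1) \<Longrightarrow> Q (traj \<omega>) \<Longrightarrow> \<omega> \<in> E k"
    by metis
  have m: "(\<Inter>k. E k) \<in> events" using E(1) by blast
  have "prob (\<Inter>k. E k) \<le> 0"
  proof (rule LIMSEQ_le_const[OF LIMSEQ_Suc[OF lim_1_over_n]])
    have "prob (\<Inter>k. E k) \<le> 1 / Suc k" for k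
      by (rule order_trans[OF finite_measure_mono E(2)[of k]]) (use E(1) in auto)
    then show "\<exists>N. \<forall>n\<ge>N. prob (\<Inter>k. E k) \<le> 1 / real (Suc n)" by blast
  qed
  then have "prob (\<Inter>k. E k) = 0"
    by (intro antisym measure_nonneg)
  then have "(\<Inter>k. E k) \<in> null_sets P"
    using m by (auto simp: null_sets_def emeasure_eq_measure)
  then have "AE \<omega> in P. \<omega> \<notin> (\<Inter>k. E k)" by (rule AE_not_in)
  moreover have "AE \<omega> in P. \<omega> \<in> space P" by (rule AE_space)
  ultimately show ?thesis using AE_nn by eventually_elim (use E(3) in blast)
qed

end

section \<open>The branching process along the sites\<close>

text \<open>\<open>chain\<close> runs through the sites \<open>y, y + 1, \<dots>\<close>: the state \<open>j\<close> becomes the number \<open>z\<close> of \<open>True\<close> arrows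
  before the \<open>(j + e)\<close>-th \<open>False\<close> arrow, and each step contributes the factor \<open>\<phi> z\<close>.  With \<open>e = 0\<close> it counts
  the steps during excursions from a site, with \<open>e = 1\<close> those before a hitting time.\<close>

context
  fixes ps :: "real list" and \<phi> :: "nat \<Rightarrow> real" and e :: nat
begin

fun chain :: "(nat \<Rightarrow> real) \<Rightarrow> nat \<Rightarrow> (int \<Rightarrow> bool list) \<Rightarrow> int \<Rightarrow> nat \<Rightarrow> real" where
  "chain F 0 c y j = F j"
| "chain F (Suc N) c y j = resumed (c y) ps (\<lambda>z. \<phi> z * chain F N c (y + 1) z) (j + e)"

end

lemma chain_fun_upd_other:
  assumes "y < x \<or> x + int N \<le> y"
  shows "chain ps \<phi> e F N (c(y := a)) x = chain ps \<phi> e F N c x"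
  using assms
proof (induction N arbitrary: x)
  case (Suc N)
  have "chain ps \<phi> e F N (c(y := a)) (x + 1) = chain ps \<phi> e F N c (x + 1)"
    by (rule Suc.IH) (use Suc.prems in auto)
  moreover have "y \<noteq> x" using Suc.prems by auto
  ultimately show ?case by (simp add: fun_upd_other del: fun_upd_apply)
qed (simp add: fun_eq_iff)

text \<open>Reflecting the line and reversing every arrow lets the same upward-running chain
  describe excursions to the left.\<close>

definition flip :: "(int \<Rightarrow> bool list) \<Rightarrow> int \<Rightarrow> bool list" where
  "flip c y = map Not (c (- y))"

lemma flip_upd: "flip (c(x := a)) = (flip c)(- x := map Not a)"
  by (auto simp: flip_def fun_eq_iff)

text \<open>Antitone weights make the chain monotone in the arrows. Two instances occur:
  \<open>\<phi> = 1\<close> with \<open>F\<close> the indicator of state 0 gives extinction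
  probabilities, and \<open>\<phi> z = exp (- \<theta> * z)\<close> with \<open>F = 1\<close> gives
  the Laplace transform of the total progeny.\<close>

locale chain_weights =
  fixes ps :: "real list" and \<phi> :: "nat \<Rightarrow> real" and e :: nat and F :: "nat \<Rightarrow> real"
  assumes ps: "set ps \<subseteq> {0..1}"
    and \<phi>: "\<And>z. \<phi> z \<in> {0..1}" "antimono \<phi>"
    and F: "\<And>z. F z \<in> {0..1}" "antimono F"
begin

abbreviation "G \<equiv> chain ps \<phi> e F"

lemma weighted_antimono:
  assumes "antimono H" "\<And>z. H z \<in> {0..1::real}"
  shows "antimono (\<lambda>z. \<phi> z * H z)" "\<And>z. \<phi> z * H z \<in> {0..1}" "bounded (range (\<lambda>z. \<phi> z * H z))"
proof -
  show "antimono (\<lambda>z. \<phi> z * H z)"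
  proof (rule antimonoI)
    fix u v :: nat assume "u \<le> v"
    then show "\<phi> v * H v \<le> \<phi> u * H u"
      using antimonoD[OF \<phi>(2), of u v] antimonoD[OF assms(1), of u v] \<phi>(1)[of u] assms(2)[of v]
      by (intro mult_mono) auto
  qed
  show *: "\<phi> z * H z \<in> {0..1}" for z
    using \<phi>(1)[of z] assms(2)[of z] by (auto intro: mult_le_one)
  show "bounded (range (\<lambda>z. \<phi> z * H z))"
    by (rule bounded_unit) (rule *)
qed

lemma chain_unit_antimono: "(\<forall>j. G N c y j \<in> {0..1}) \<and> antimono (G N c y)"
proof (induction N arbitrary: y)
  case 0
  then show ?case using F by (simp add: antimono_def)
next
  case (Suc N)
  let ?H = "G N c (y + 1)"
  have H: "antimono ?H" "\<And>z. ?H z \<in> {0..1}" using Suc by auto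
  note w = weighted_antimono[OF H]
  have "G (Suc N) c y j \<in> {0..1}" for j
    unfolding chain.simps by (rule resumed_unit[OF ps w(2)])
  moreover have "antimono (G (Suc N) c y)"
  proof (rule antimonoI)
    fix u v :: nat assume "u \<le> v"
    then show "G (Suc N) c y v \<le> G (Suc N) c y u"
      unfolding chain.simps by (intro antimonoD[OF resumed_antimono[OF ps w(3,1)]]) simp
  qed
  ultimately show ?case by blast
qed

lemma chain_unit: "G N c y j \<in> {0..1}" and chain_antimono: "antimono (G N c y)"
  using chain_unit_antimono by auto

lemmas weighted_chain = weighted_antimono[OF chain_antimono chain_unit]

text \<open>Only the factor at site \<open>x\<close> sees the new arrow, and there
  \<open>resumed_step\<close> applies; the sites before it act on the result linearly.\<close>

lemma chain_step:
  "G N c y j = arrow_prob ps (length (c x)) * G N (c(x := c x @ [True])) y j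
     + (1 - arrow_prob ps (length (c x))) * G N (c(x := c x @ [False])) y j"
proof (induction N arbitrary: y j)
  case (Suc N)
  let ?p = "arrow_prob ps (length (c x))"
  show ?case
  proof (cases "x = y")
    case True
    have "G N (c(x := a)) (y + 1) = G N c (y + 1)" for a
      by (rule ext, rule fun_cong[OF chain_fun_upd_other]) (simp add: True)
    then show ?thesis
      using resumed_step[OF weighted_chain(3), of "c y" ps N c "y + 1" "j + e"] True
      by (simp del: fun_upd_apply add: fun_upd_same)
  next
    case False
    let ?T = "\<lambda>z. \<phi> z * G N (c(x := c x @ [True])) (y + 1) z"
    let ?F = "\<lambda>z. \<phi> z * G N (c(x := c x @ [False])) (y + 1) z"
    have "(\<lambda>z. \<phi> z * G N c (y + 1) z) = (\<lambda>z. ?p * ?T z + (1 - ?p) * ?F z)"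
      by (rule ext, subst Suc.IH) (simp add: algebra_simps)
    then have "G (Suc N) c y j = resumed (c y) ps (\<lambda>z. ?p * ?T z + (1 - ?p) * ?F z) (j + e)"
      by simp
    also have "\<dots> = ?p * resumed (c y) ps ?T (j + e) + (1 - ?p) * resumed (c y) ps ?F (j + e)"
    proof -
      have b: "bounded (range (\<lambda>z. q * H z))" if "bounded (range H)" for q and H :: "nat \<Rightarrow> real"
        using bounded_scaling[OF that, of q] by (simp add: image_image)
      show ?thesis
        by (subst resumed_add[OF b[OF weighted_chain(3)] b[OF weighted_chain(3)]]) (simp only: resumed_scale)
    qed
    finally show ?thesis using False by (simp del: fun_upd_apply add: fun_upd_other)
  qed
qed (simp add: algebra_simps)

lemma chain_True_le_False:
  "G N (c(x := c x @ [True])) y j \<le> G N (c(x := c x @ [False])) y j"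
proof (induction N arbitrary: y j)
  case (Suc N)
  show ?case
  proof (cases "x = y")
    case True
    have "G N (c(x := a)) (y + 1) = G N c (y + 1)" for a
      by (rule ext, rule fun_cong[OF chain_fun_upd_other]) (simp add: True)
    then show ?thesis
      using resumed_True_le_False[OF ps weighted_chain(3,1)] True
      by (simp del: fun_upd_apply add: fun_upd_same)
  next
    case False
    have "resumed (c y) ps (\<lambda>z. \<phi> z * G N (c(x := c x @ [True])) (y + 1) z) (j + e)
       \<le> resumed (c y) ps (\<lambda>z. \<phi> z * G N (c(x := c x @ [False])) (y + 1) z) (j + e)"
      by (rule resumed_mono[OF ps weighted_chain(3) weighted_chain(3)])
        (rule mult_left_mono[OF Suc.IH], use \<phi>(1) in auto)
    then show ?thesis using False by (simp del: fun_upd_apply add: fun_upd_other)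
  qed
qed simp

text \<open>With step probability exactly \<open>arrow_prob\<close> the chain is a martingale by
  \<open>chain_step\<close>. A smaller probability shifts mass to the \<open>False\<close> arrow,
  where the chain is larger, so the complement of the chain is a supermartingale.\<close>

lemma excessive_right_chain: "excessive (arrow_prob ps) (\<lambda>c. 1 - G N c y j)"
  unfolding excessive_def
proof (intro allI impI)
  fix c :: "int \<Rightarrow> bool list" and x and p :: real assume p: "0 \<le> p" "p \<le> arrow_prob ps (length (c x))"
  let ?T = "G N (c(x := c x @ [True])) y j" and ?F = "G N (c(x := c x @ [False])) y j"
  have "G N c y j \<le> p * ?T + (1 - p) * ?F"
    using mult_right_mono[OF p(2), of "?F - ?T"] chain_True_le_False[of N c x y j]
    by (subst chain_step[of N c y j x]) (simp add: algebra_simps)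
  then show "p * (1 - ?T) + (1 - p) * (1 - ?F) \<le> 1 - G N c y j"
    by (simp add: algebra_simps)
qed

text \<open>After reflection \<open>True\<close> means a step to the left, whose probability is at
  least \<open>arrow_prob ps\<close>. The inequality is reversed, and the chain itself is the
  supermartingale.\<close>

lemma excessive_left_chain:
  "excessive (\<lambda>n. 1 - arrow_prob ps n) (\<lambda>c. G N (flip c) y j)"
  unfolding excessive_def
proof (intro allI impI)
  fix c :: "int \<Rightarrow> bool list" and x and p :: real assume p: "0 \<le> p" "p \<le> 1 - arrow_prob ps (length (c x))"
  have l: "length (flip c (- x)) = length (c x)" by (simp add: flip_def)
  let ?T = "G N ((flip c)(- x := flip c (- x) @ [True])) y j"
  let ?F = "G N ((flip c)(- x := flip c (- x) @ [False])) y j"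
  have eq: "flip (c(x := c x @ [True])) = (flip c)(- x := flip c (- x) @ [False])"
    "flip (c(x := c x @ [False])) = (flip c)(- x := flip c (- x) @ [True])"
    by (simp_all add: flip_upd) (simp_all add: flip_def)
  have "p * ?F + (1 - p) * ?T \<le> G N (flip c) y j"
    using mult_right_mono[OF p(2), of "?F - ?T"] chain_True_le_False[of N "flip c" "- x" y j]
    by (subst chain_step[of N "flip c" y j "- x"]) (simp add: algebra_simps l)
  then show "p * G N (flip (c(x := c x @ [True]))) y j + (1 - p) * G N (flip (c(x := c x @ [False]))) y j
      \<le> G N (flip c) y j"
    unfolding eq .
qed

lemma chain_empty_shift: "G N (\<lambda>_. []) y j = G N (\<lambda>_. []) y' j"
proof (induction N arbitrary: y y' j)
  case (Suc N)
  have "G N (\<lambda>_. []) (y + 1) = G N (\<lambda>_. []) (y' + 1)" by (rule ext) (rule Suc.IH)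
  then show ?case by simp
qed simp

lemma chain_empty_Suc:
  "G (Suc N) (\<lambda>_. []) y j = stopped ps (\<lambda>z. \<phi> z * G N (\<lambda>_. []) y z) (j + e)"
  using chain_empty_shift[of N "y + 1" _ y] by simp

text \<open>Ensures that no arrow of \<open>a\<close> lies beyond the \<open>j\<close>-th
  \<open>False\<close>, which is the condition of \<open>resumed_le\<close>: the awaited arrow is
  either still missing or the most recent one.\<close>

definition passed :: "bool list \<Rightarrow> nat \<Rightarrow> bool" where
  "passed a j \<longleftrightarrow> count_list a False < j \<or> count_list a False = j \<and> a \<noteq> [] \<and> \<not> last a"

text \<open>All recorded right steps count at every site, so each state is at least the number of
  right steps recorded there, and the weights are antitone.\<close>

lemma chain_upper:
  assumes "passed (c y) (j + e)"
    and "\<And>i. Suc i < N \<Longrightarrow> passed (c (y + int i + 1)) (count_list (c (y + int i)) True + e)"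
    and "0 < N"
  shows "G N c y j \<le> (\<Prod>i<N. \<phi> (count_list (c (y + int i)) True)) * F (count_list (c (y + int N - 1)) True)"
  using assms
proof (induction N arbitrary: y j)
  case (Suc N)
  let ?r = "count_list (c y) True"
  have *: "G (Suc N) c y j \<le> \<phi> ?r * G N c (y + 1) ?r"
    using resumed_le[OF ps weighted_chain(3,1)] Suc.prems(1) by (simp add: passed_def)
  show ?case
  proof (cases "N = 0")
    case True
    then show ?thesis using * by simp
  next
    case False
    have "G N c (y + 1) ?r \<le> (\<Prod>i<N. \<phi> (count_list (c (y + 1 + int i)) True)) * F (count_list (c (y + 1 + int N - 1)) True)"
    proof (rule Suc.IH)
      show "passed (c (y + 1)) (?r + e)"
        using Suc.prems(2)[of 0] False by simp
      show "passed (c (y + 1 + int i + 1)) (count_list (c (y + 1 + int i)) True + e)" if "Suc i < N" for i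
        using Suc.prems(2)[of "Suc i"] that by (simp add: algebra_simps)
    qed (use False in simp)
    from order_trans[OF * mult_left_mono[OF this]] show ?thesis
      using \<phi>(1)[of ?r] by (simp add: prod.lessThan_Suc_shift algebra_simps del: prod.lessThan_Suc chain.simps)
  qed
qed simp

text \<open>The opposite situation: the awaited \<open>False\<close> is already recorded at every
  site, so no state exceeds the number of right steps recorded there.\<close>

lemma chain_lower:
  assumes "j + e \<le> count_list (c y) False"
    and "\<And>i. Suc i < N \<Longrightarrow> count_list (c (y + int i)) True + e \<le> count_list (c (y + int i + 1)) False"
    and "0 < N"
  shows "(\<Prod>i<N. \<phi> (count_list (c (y + int i)) True)) * F (count_list (c (y + int N - 1)) True) \<le> G N c y j"
  using assms
proof (induction N arbitrary: y j)
  case (Suc N)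
  let ?r = "count_list (c y) True"
  have *: "\<phi> ?r * G N c (y + 1) ?r \<le> G (Suc N) c y j"
    using resumed_ge[OF ps weighted_chain(1) Suc.prems(1)] by simp
  show ?case
  proof (cases "N = 0")
    case True
    then show ?thesis using * by simp
  next
    case False
    have "(\<Prod>i<N. \<phi> (count_list (c (y + 1 + int i)) True)) * F (count_list (c (y + 1 + int N - 1)) True) \<le> G N c (y + 1) ?r"
    proof (rule Suc.IH)
      show "?r + e \<le> count_list (c (y + 1)) False"
        using Suc.prems(2)[of 0] False by simp
      show "count_list (c (y + 1 + int i)) True + e \<le> count_list (c (y + 1 + int i + 1)) False" if "Suc i < N" for i
        using Suc.prems(2)[of "Suc i"] that by (simp add: algebra_simps)
    qed (use False in simp)
    from order_trans[OF mult_left_mono[OF this] *] show ?thesis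
      using \<phi>(1)[of ?r] by (simp add: prod.lessThan_Suc_shift algebra_simps del: prod.lessThan_Suc chain.simps)
  qed
qed simp

end

section \<open>Step counts and edge crossings of a single path\<close>

lemma flip_arrows:
  assumes "\<And>n. \<bar>x (Suc n) - x n\<bar> = 1"
  shows "flip (arrows x n) = arrows (\<lambda>m. - x m) n"
proof (induction n)
  case (Suc n)
  have "(x (Suc n) \<noteq> x n + 1) = (- x (Suc n) = - x n + 1)"
    using assms[of n] by auto
  then show ?case
    by (simp add: flip_upd Suc[symmetric] del: fun_upd_apply) (simp add: flip_def fun_eq_iff)
qed (simp add: flip_def fun_eq_iff)

definition rights :: "(nat \<Rightarrow> int) \<Rightarrow> nat \<Rightarrow> int \<Rightarrow> nat" where
  "rights x n y = count_list (arrows x n y) True"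

definition lefts :: "(nat \<Rightarrow> int) \<Rightarrow> nat \<Rightarrow> int \<Rightarrow> nat" where
  "lefts x n y = count_list (arrows x n y) False"

lemma rights_Suc: "rights x (Suc n) y = rights x n y + of_bool (x n = y \<and> x (Suc n) = x n + 1)"
  by (auto simp: rights_def count_list_append)

lemma lefts_Suc: "lefts x (Suc n) y = lefts x n y + of_bool (x n = y \<and> x (Suc n) \<noteq> x n + 1)"
  by (auto simp: lefts_def count_list_append)

lemma rights_mono: "n \<le> m \<Longrightarrow> rights x n y \<le> rights x m y"
  by (rule lift_Suc_mono_le[of "\<lambda>n. rights x n y"]) (simp add: rights_Suc)

lemma lefts_mono: "n \<le> m \<Longrightarrow> lefts x n y \<le> lefts x m y"
  by (rule lift_Suc_mono_le[of "\<lambda>n. lefts x n y"]) (simp add: lefts_Suc)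

lemma rights_plus_lefts: "rights x n y + lefts x n y = card {m. m < n \<and> x m = y}"
proof (induction n)
  case (Suc n)
  have "{m. m < Suc n \<and> x m = y} = {m. m < n \<and> x m = y} \<union> (if x n = y then {n} else {})"
    by (auto simp: less_Suc_eq)
  then show ?case using Suc by (auto simp: rights_Suc lefts_Suc)
qed (simp add: rights_def lefts_def)

lemma rights_eq_0:
  assumes "\<And>m. m < n \<Longrightarrow> x m \<noteq> y"
  shows "rights x n y = 0"
proof -
  have *: "{m. m < n \<and> x m = y} = {}" using assms by auto
  show ?thesis using rights_plus_lefts[of x n y] unfolding * by simp
qed

text \<open>Up- and down-crossings of an edge alternate, so their numbers differ only through the
  sides on which the path starts and currently stands. This links the counts at neighbouring sites
  and makes the path follow the chain.\<close>

lemma crossing_balance: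
  assumes "\<And>n. \<bar>x (Suc n) - x n\<bar> = 1"
  shows "int (rights x n y) - int (lefts x n (y + 1)) = of_bool (x n > y) - of_bool (x 0 > y)"
proof (induction n)
  case 0
  then show ?case by (simp add: rights_def lefts_def)
next
  case (Suc n)
  have "x (Suc n) = x n + 1 \<or> x (Suc n) = x n - 1" using assms[of n] by linarith
  then show ?case using Suc by (auto simp: rights_Suc lefts_Suc)
qed

lemma last_arrow_False:
  assumes "\<And>n. \<bar>x (Suc n) - x n\<bar> = 1" "x n < y" "arrows x n y \<noteq> []"
  shows "\<not> last (arrows x n y)"
  using assms(2,3)
proof (induction n)
  case (Suc n)
  have "x (Suc n) = x n + 1 \<or> x (Suc n) = x n - 1" using assms(1)[of n] by linarith
  then show ?case using Suc by (auto split: if_splits)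
qed simp

section \<open>Generating functions\<close>

text \<open>The factor c(t): each cookie of strength \<open>p\<close> in place of a fair arrow
  contributes one factor, which is 1 for \<open>p = 1/2\<close>.\<close>

definition cof :: "real list \<Rightarrow> nat \<Rightarrow> real" where
  "cof ps t = (\<Prod>p\<leftarrow>ps. 1 + (1 - 2 * p) / real t)"

definition sg :: "nat \<Rightarrow> real" where
  "sg t = 1 - 1 / real t"

lemma sg_unit: "1 \<le> t \<Longrightarrow> 0 \<le> sg t" "sg t \<le> 1"
  by (auto simp: sg_def)

lemma sg_pow_unit: "1 \<le> t \<Longrightarrow> sg t ^ z \<in> {0..1}"
  using sg_unit[of t] by (auto intro: power_le_one)

lemma sg_1 [simp]: "sg (Suc 0) = 0"
  by (simp add: sg_def)

lemma bounded_sg_pow: "1 \<le> t \<Longrightarrow> bounded (range (\<lambda>z. sg t ^ z))"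
  by (rule bounded_unit) (rule sg_pow_unit)

lemma bounded_scale: "bounded (range H) \<Longrightarrow> bounded (range (\<lambda>z. (c::real) * H z))"
  using bounded_scaling[of "range H" c] by (simp add: image_image)

lemma nb_gen:
  assumes "1 \<le> t"
  shows "nb (\<lambda>z. sg t ^ z) j = sg (Suc t) ^ j"
proof (induction j)
  case (Suc j)
  have "nb (\<lambda>z. sg t ^ z) (Suc j) = (sg t * nb (\<lambda>z. sg t ^ z) (Suc j) + nb (\<lambda>z. sg t ^ z) j) / 2"
    by (subst nb_Suc[OF bounded_sg_pow[OF assms]]) (simp add: nb_scale)
  then have "nb (\<lambda>z. sg t ^ z) (Suc j) * (2 - sg t) = sg (Suc t) ^ j"
    using Suc by (simp add: algebra_simps)
  moreover have "(2 - sg t) * sg (Suc t) = 1"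
  proof -
    have "2 - sg t = real (Suc t) / real t" "sg (Suc t) = real t / real (Suc t)"
      using assms by (simp_all add: sg_def field_simps)
    then show ?thesis using assms by simp
  qed
  ultimately have "nb (\<lambda>z. sg t ^ z) (Suc j) * 1 = sg (Suc t) ^ j * sg (Suc t)"
    by (metis mult.assoc)
  then show ?case by simp
qed simp

text \<open>With \<open>length ps \<le> j\<close> the \<open>j\<close>-th \<open>False\<close>
  cannot come before all cookies are used, so each cookie contributes in full. Its factor is
  \<open>p * sg t + (1 - p) / sg (Suc t)\<close>, where
  \<open>1 / sg (Suc t) = 1 + 1 / t\<close>.\<close>

lemma stopped_gen:
  assumes "1 \<le> t" "length ps \<le> j"
  shows "stopped ps (\<lambda>z. sg t ^ z) j = cof ps t * sg (Suc t) ^ j"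
  using assms(2)
proof (induction ps arbitrary: j)
  case Nil
  then show ?case using assms(1) by (simp add: nb_gen cof_def)
next
  case (Cons p ps)
  then obtain i where j: "j = Suc i" by (cases j) auto
  have i: "length ps \<le> i" using Cons.prems j by simp
  have "sg (Suc t) * (1 + 1 / real t) = 1"
  proof -
    have "1 + 1 / real t = real (Suc t) / real t" "sg (Suc t) = real t / real (Suc t)"
      using assms(1) by (simp_all add: sg_def field_simps)
    then show ?thesis using assms(1) by simp
  qed
  then have s': "sg (Suc t) ^ i = sg (Suc t) ^ Suc i * (1 + 1 / real t)"
    by (simp add: mult.commute mult.left_commute)
  have "stopped (p # ps) (\<lambda>z. sg t ^ z) j
      = p * (sg t * (cof ps t * sg (Suc t) ^ Suc i)) + (1 - p) * (cof ps t * sg (Suc t) ^ i)"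
    using Cons.IH[of "Suc i"] Cons.IH[of i] i by (simp add: j stopped_scale)
  also have "\<dots> = cof ps t * sg (Suc t) ^ Suc i * (p * sg t + (1 - p) * (1 + 1 / real t))"
    unfolding s' by algebra
  also have "p * sg t + (1 - p) * (1 + 1 / real t) = 1 + (1 - 2 * p) / real t"
    by (simp add: sg_def diff_divide_distrib algebra_simps)
  finally show ?case by (simp add: cof_def j mult.commute mult.left_commute)
qed

text \<open>The weights for which the sum of \<open>wt ps t * sg t ^ j\<close> telescopes under one
  step of the chain. The product starts at 2 because \<open>cof ps 1\<close> vanishes as soon as
  some cookie has strength 1.\<close>

definition wt :: "real list \<Rightarrow> nat \<Rightarrow> real" where
  "wt ps t = (\<Prod>i=2..<t. cof ps i)"

lemma wt_Suc: "2 \<le> t \<Longrightarrow> wt ps (Suc t) = wt ps t * cof ps t"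
  by (simp add: wt_def prod.atLeastLessThan_Suc)

lemma wt_2 [simp]: "wt ps 2 = 1"
  by (simp add: wt_def)

lemma cof_factor_pos: "p \<in> {0..1} \<Longrightarrow> 2 \<le> t \<Longrightarrow> 0 < 1 + (1 - 2 * p) / real t"
  by (auto simp: field_simps)

lemma cof_pos: "set ps \<subseteq> {0..1} \<Longrightarrow> 2 \<le> t \<Longrightarrow> 0 < cof ps t"
  unfolding cof_def by (induction ps) (auto intro!: mult_pos_pos cof_factor_pos)

lemma wt_pos: "set ps \<subseteq> {0..1} \<Longrightarrow> 0 < wt ps t"
  unfolding wt_def by (intro prod_pos) (auto intro: cof_pos)

definition drift :: "real list \<Rightarrow> real" where
  "drift ps = (\<Sum>p\<leftarrow>ps. 1 - 2 * p)"

lemma ln_cof: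
  assumes "set ps \<subseteq> {0..1}" "2 \<le> t"
  shows "\<bar>ln (cof ps t) - drift ps / real t\<bar> \<le> 2 * real (length ps) / (real t)\<^sup>2"
  using assms(1)
proof (induction ps)
  case Nil
  then show ?case by (simp add: cof_def drift_def)
next
  case (Cons p ps)
  let ?x = "(1 - 2 * p) / real t"
  have x: "\<bar>?x\<bar> \<le> 1 / real t" "\<bar>?x\<bar> \<le> 1 / 2"
  proof -
    have "\<bar>1 - 2 * p\<bar> \<le> 1" using Cons.prems by auto
    then show 1: "\<bar>?x\<bar> \<le> 1 / real t"
      using assms(2) by (simp add: abs_divide divide_right_mono)
    have "1 / real t \<le> 1 / 2" using assms(2) by (intro divide_left_mono) auto
    with 1 show "\<bar>?x\<bar> \<le> 1 / 2" by linarith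
  qed
  have "\<bar>ln (1 + ?x) - ?x\<bar> \<le> 2 * ?x\<^sup>2"
    using abs_ln_one_plus_x_minus_x_bound[OF x(2)] .
  also have "?x\<^sup>2 \<le> (1 / real t)\<^sup>2"
    using x(1) by (simp add: abs_le_square_iff[symmetric])
  finally have 1: "\<bar>ln (1 + ?x) - ?x\<bar> \<le> 2 * (1 / real t)\<^sup>2" by simp
  have "ln (cof (p # ps) t) = ln (1 + ?x) + ln (cof ps t)"
    using cof_factor_pos[of p t] cof_pos[of ps t] Cons.prems assms(2) by (simp add: cof_def ln_mult)
  moreover have "drift (p # ps) / real t = ?x + drift ps / real t"
    by (simp add: drift_def add_divide_distrib)
  moreover have "\<bar>ln (cof ps t) - drift ps / real t\<bar> \<le> 2 * real (length ps) / (real t)\<^sup>2"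
    using Cons by simp
  ultimately have "\<bar>ln (cof (p # ps) t) - drift (p # ps) / real t\<bar>
      \<le> 2 * (1 / real t)\<^sup>2 + 2 * real (length ps) / (real t)\<^sup>2"
    using 1 by linarith
  then show ?case by (simp add: add_divide_distrib power_divide algebra_simps)
qed

text \<open>By \<open>ln_cof\<close> the increments of \<open>ln (wt ps t) - drift ps * ln t\<close>
  are of order 1/t^2, hence summable, and the difference stays bounded.\<close>

lemma wt_asymp:
  assumes ps: "set ps \<subseteq> {0..1}"
  obtains c A where "0 < c" "0 < A" "\<And>t. 2 \<le> t \<Longrightarrow> c * real t powr drift ps \<le> wt ps t"
    "\<And>t. 2 \<le> t \<Longrightarrow> wt ps t \<le> A * real t powr drift ps"
proof -
  let ?\<gamma> = "drift ps"
  define C where "C = 2 * real (length ps) + 2 * \<bar>?\<gamma>\<bar>"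
  define a where "a = (\<lambda>t. ln (wt ps t) - ?\<gamma> * ln (real t))"
  have C: "0 \<le> C" by (simp add: C_def)
  have incr: "\<bar>a (Suc t) - a t\<bar> \<le> C / (real t)\<^sup>2" if t: "2 \<le> t" for t
  proof -
    have "ln (wt ps (Suc t)) = ln (wt ps t) + ln (cof ps t)"
      using wt_pos[OF ps, of t] cof_pos[OF ps t] by (simp add: wt_Suc[OF t] ln_mult)
    moreover have "ln (real (Suc t)) = ln (real t) + ln (1 + 1 / real t)"
    proof -
      have "real (Suc t) = real t * (1 + 1 / real t)" using t by (simp add: field_simps)
      moreover have "0 < 1 + 1 / real t" using t by (simp add: field_simps)
      ultimately show ?thesis using t by (simp add: ln_mult_pos)
    qed
    moreover have "\<bar>?\<gamma> * (ln (1 + 1 / real t) - 1 / real t)\<bar> \<le> \<bar>?\<gamma>\<bar> * (2 * (1 / real t)\<^sup>2)"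
    proof -
      have "\<bar>1 / real t\<bar> \<le> 1 / 2" using t by (auto intro!: divide_left_mono)
      from abs_ln_one_plus_x_minus_x_bound[OF this] show ?thesis
        unfolding abs_mult by (rule mult_left_mono) simp
    qed
    moreover note ln_cof[OF ps t]
    ultimately have "\<bar>a (Suc t) - a t\<bar> \<le> 2 * real (length ps) / (real t)\<^sup>2 + \<bar>?\<gamma>\<bar> * (2 * (1 / real t)\<^sup>2)"
      unfolding a_def by (simp add: algebra_simps)
    also have "\<dots> = C / (real t)\<^sup>2"
      by (simp add: C_def add_divide_distrib power_divide algebra_simps)
    finally show ?thesis .
  qed
  have sm: "summable (\<lambda>t. C / (real t)\<^sup>2)"
    using summable_mult[OF inverse_power_summable[of 2], of C] by (simp add: divide_inverse)
  define K where "K = (\<Sum>t. C / (real t)\<^sup>2)"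
  have bound: "\<bar>a t - a 2\<bar> \<le> K" if "2 \<le> t" for t
  proof -
    have "\<bar>a t - a 2\<bar> \<le> (\<Sum>i=2..<t. C / (real i)\<^sup>2)"
      using that
    proof (induction t rule: dec_induct)
      case (step t)
      then show ?case using incr[of t] by (simp add: sum.atLeastLessThan_Suc)
    qed simp
    also have "\<dots> \<le> K"
      unfolding K_def using C by (intro sum_le_suminf sm) auto
    finally show ?thesis .
  qed
  have eq: "wt ps t = exp (a t) * real t powr ?\<gamma>" if "2 \<le> t" for t
    using that wt_pos[OF ps, of t] by (simp add: a_def powr_def flip: exp_add)
  show thesis
  proof (rule that[of "exp (a 2 - K)" "exp (a 2 + K)"])
    fix t :: nat assume t: "2 \<le> t"
    have "a 2 - K \<le> a t" "a t \<le> a 2 + K" using bound[OF t] by linarith+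
    then show "exp (a 2 - K) * real t powr ?\<gamma> \<le> wt ps t" "wt ps t \<le> exp (a 2 + K) * real t powr ?\<gamma>"
      unfolding eq[OF t] by (auto intro!: mult_right_mono)
  qed auto
qed

section \<open>Survival of the branching process\<close>

text \<open>No cookie forces \<open>True\<close>, so with positive probability the first
  \<open>j\<close> arrows are all \<open>False\<close> and the count is 0.\<close>

lemma stopped_nonzero_less_1:
  assumes "set ps \<subseteq> {0..<1}"
  shows "stopped ps (\<lambda>z. of_bool (z \<noteq> 0)) j < 1"
  using assms
proof (induction ps arbitrary: j)
  case Nil
  show ?case
  proof (induction j)
    case (Suc j)
    have b: "bounded (range (\<lambda>z::nat. of_bool (z \<noteq> 0) :: real))"
      by (rule bounded_unit) simp
    show ?case using nb_Suc[OF b, of j] Suc by simp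
  qed simp
next
  case (Cons p ps)
  show ?case
  proof (cases j)
    case (Suc i)
    have p: "0 \<le> p" "p < 1" using Cons.prems by auto
    have "(1 - p) * stopped ps (\<lambda>z. of_bool (z \<noteq> 0)) i < (1 - p) * 1"
      by (rule mult_strict_left_mono) (use Cons p in auto)
    then show ?thesis using Suc by simp
  qed simp
qed

lemma stopped_sum_gen:
  assumes "length ps \<le> j" "\<And>t. t \<in> A \<Longrightarrow> 1 \<le> t" "finite A"
  shows "stopped ps (\<lambda>z. \<Sum>t\<in>A. y t * sg t ^ z) j = (\<Sum>t\<in>A. y t * cof ps t * sg (Suc t) ^ j)"
proof -
  have "stopped ps (\<lambda>z. \<Sum>t\<in>A. y t * sg t ^ z) j = (\<Sum>t\<in>A. stopped ps (\<lambda>z. y t * sg t ^ z) j)"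
    by (rule stopped_sum[OF assms(3)]) (intro bounded_scale bounded_sg_pow assms(2))
  also have "\<dots> = (\<Sum>t\<in>A. y t * cof ps t * sg (Suc t) ^ j)"
    by (rule sum.cong) (simp_all add: stopped_scale stopped_gen[OF assms(2,1)])
  finally show ?thesis .
qed

lemma bounded_sum_sg:
  assumes "\<And>t. t \<in> A \<Longrightarrow> 1 \<le> t"
  shows "bounded (range (\<lambda>z. \<Sum>t\<in>A. y t * sg t ^ z))"
proof (rule boundedI)
  fix x assume "x \<in> range (\<lambda>z. \<Sum>t\<in>A. y t * sg t ^ z)"
  then obtain z where x: "x = (\<Sum>t\<in>A. y t * sg t ^ z)" by blast
  have "norm x \<le> (\<Sum>t\<in>A. norm (y t * sg t ^ z))" unfolding x by (rule norm_sum)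
  also have "\<dots> \<le> (\<Sum>t\<in>A. \<bar>y t\<bar>)"
    using sg_pow_unit[OF assms] by (intro sum_mono) (simp add: abs_mult mult_left_le)
  finally show "norm x \<le> (\<Sum>t\<in>A. \<bar>y t\<bar>)" .
qed

lemma bernoulli_sg: "1 \<le> t \<Longrightarrow> 1 - sg t ^ j \<le> real j / real t"
  using Bernoulli_inequality[of "- 1 / real t" j] by (simp add: sg_def)

text \<open>The sums \<open>\<Sum>t\<le>T. w t * (1 - (1 - 1 / t) ^ j)\<close> are superharmonic at every state \<open>j\<close> that
  uses up all cookies, and they grow to \<open>\<Sum>t\<le>T. w t\<close>, which diverges with \<open>T\<close> because \<open>w t\<close> is
  of order \<open>1 / t\<close>.  Comparing with them gives a maximum principle for the survival probability.\<close>

lemma survival_zero_if_critical: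
  assumes ps: "set ps \<subseteq> {0..<1}" and drift: "drift ps = - 1"
    and Q: "\<And>j. Q j \<in> {0..1}" "Q 0 = 0" "\<And>j. stopped ps Q j = Q j"
  shows "Q j = 0"
proof -
  have ps': "set ps \<subseteq> {0..1}" using ps by auto
  have Qb: "bounded (range Q)" by (rule bounded_unit) (rule Q)
  \<comment> \<open>The weights are extended down to t = 1, where \<open>sg 1 ^ j\<close> is 0 for
    positive \<open>j\<close>; this removes the lower boundary term of the telescoping sum, whose
    sign is unfavourable. The extension keeps the weights positive since no cookie has strength
    1.\<close>
  define W where "W = (\<lambda>t. if t = 1 then 1 else cof ps 1 * wt ps t)"
  have cof1: "0 < cof ps 1"
    unfolding cof_def using ps by (induction ps) (auto intro!: mult_pos_pos)
  have W_pos: "0 < W t" for t using wt_pos[OF ps'] cof1 by (simp add: W_def)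
  have W_Suc: "W (Suc t) = W t * cof ps t" if "1 \<le> t" for t
    using that wt_Suc[of t ps] wt_2[of ps] by (cases "t = 1") (auto simp: W_def numeral_2_eq_2)
  obtain c A where cA: "0 < c" "0 < A" "\<And>t. 2 \<le> t \<Longrightarrow> c * real t powr -1 \<le> wt ps t"
    "\<And>t. 2 \<le> t \<Longrightarrow> wt ps t \<le> A * real t powr -1"
    using wt_asymp[OF ps'] unfolding drift by blast
  define A' where "A' = max 1 (cof ps 1 * A)"
  have W_le: "W t \<le> A' / real t" if "1 \<le> t" for t
  proof (cases "t = 1")
    case False
    have "cof ps 1 * wt ps t \<le> cof ps 1 * (A * real t powr -1)"
      by (rule mult_left_mono) (use cA(4)[of t] that cof1 False in auto)
    also have "\<dots> = (cof ps 1 * A) / real t" using that by (simp add: powr_minus divide_inverse)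
    also have "\<dots> \<le> A' / real t" by (intro divide_right_mono) (auto simp: A'_def)
    finally show ?thesis using False by (simp add: W_def)
  qed (simp add: W_def A'_def)
  have W_ge: "cof ps 1 * c * (1 / real t) \<le> W t" if "2 \<le> t" for t
    using mult_left_mono[OF cA(3)[OF that], of "cof ps 1"] cof1 that
    by (simp add: W_def powr_minus divide_inverse)
  define f where "f = (\<lambda>T z. \<Sum>t=1..T. W t * (1 - sg t ^ z))"
  have f_eq: "f T z = (\<Sum>t=1..T. W t) - (\<Sum>t=1..T. W t * sg t ^ z)" for T z
    by (simp add: f_def algebra_simps sum_subtractf)
  have fb: "bounded (range (f T))" for T
  proof -
    have "bounded (range (\<lambda>z. (\<Sum>t=1..T. W t) - (\<Sum>t=1..T. W t * sg t ^ z)))"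
      by (rule bounded_minus_comp[OF _ bounded_sum_sg]) simp_all
    then show ?thesis by (simp add: f_eq[abs_def])
  qed
  have f_mono: "f T z \<le> f T z'" if "z \<le> z'" for T z z'
    unfolding f_def using sg_unit that W_pos
    by (intro sum_mono mult_left_mono) (auto intro!: power_decreasing intro: less_imp_le)
  have f_0: "f T 0 = 0" for T by (simp add: f_def)
  have f_nonneg: "0 \<le> f T z" for T z using f_mono[of 0 z T] f_0 by simp
  have f_super: "stopped ps (f T) j \<le> f T j" if j: "length ps \<le> j" "1 \<le> j" for T j
  proof -
    have "stopped ps (f T) j = (\<Sum>t=1..T. W t) - (\<Sum>t=1..T. W t * cof ps t * sg (Suc t) ^ j)"
      unfolding f_eq[abs_def]
      by (subst stopped_diff[OF _ bounded_sum_sg], simp, simp, subst stopped_sum_gen[OF j(1)]) simp_all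
    also have "(\<Sum>t=1..T. W t * cof ps t * sg (Suc t) ^ j) = (\<Sum>t=1..T. W (Suc t) * sg (Suc t) ^ j)"
      by (rule sum.cong) (simp_all add: W_Suc)
    also have "\<dots> = (\<Sum>t=1..T. W t * sg t ^ j) + W (Suc T) * sg (Suc T) ^ j - W 1 * sg 1 ^ j"
      by (induction T) simp_all
    finally have "stopped ps (f T) j = f T j - W (Suc T) * sg (Suc T) ^ j + W 1 * sg 1 ^ j"
      using f_eq[of T j] by linarith
    moreover have "W 1 * sg 1 ^ j = 0" using j(2) by (simp add: power_0_left)
    moreover have "0 \<le> W (Suc T) * sg (Suc T) ^ j"
      using W_pos[of "Suc T"] sg_unit[of "Suc T"] by (intro mult_nonneg_nonneg) auto
    ultimately show ?thesis by linarith
  qed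
  define S where "S = (\<Sum>t. 1 / (real t)\<^sup>2)"
  have f_le: "f T z \<le> real z * A' * S" for T z
  proof -
    have "f T z \<le> (\<Sum>t=1..T. A' / real t * (real z / real t))"
      unfolding f_def using sg_pow_unit W_le bernoulli_sg W_pos
      by (intro sum_mono mult_mono) (auto simp: A'_def)
    also have "\<dots> = real z * A' * (\<Sum>t=1..T. 1 / (real t)\<^sup>2)"
      by (simp add: sum_distrib_left power2_eq_square mult.commute)
    also have "\<dots> \<le> real z * A' * S"
      unfolding S_def using inverse_power_summable[of 2, where ?'a = real]
      by (intro mult_left_mono sum_le_suminf) (auto simp: A'_def divide_inverse)
    finally show ?thesis .
  qed
  \<comment> \<open>From \<open>m0\<close> on, \<open>f T\<close> is superharmonic. At states up to
    \<open>m0\<close> the chain dies in one step with probability at least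
    \<open>1 - \<beta>\<close>, which has to replace it.\<close>
  define m0 where "m0 = max (length ps) 1"
  define \<beta> where "\<beta> = Max ((\<lambda>i. stopped ps (\<lambda>z. of_bool (z \<noteq> 0)) i) ` {..m0})"
  have \<beta>: "\<beta> < 1" "\<And>i. i \<le> m0 \<Longrightarrow> stopped ps (\<lambda>z. of_bool (z \<noteq> 0)) i \<le> \<beta>"
    unfolding \<beta>_def using stopped_nonzero_less_1[OF ps] by auto
  define C where "C = real m0 * A' * S / (1 - \<beta>)"
  have key: "Q j \<le> 4 / (\<Sum>t=1..T. W t) * (real j * A' * S + C)" if T: "1 \<le> T" for T j
  proof -
    let ?V = "\<Sum>t=1..T. W t"
    have V: "0 < ?V" using T W_pos by (intro sum_pos) auto
    \<comment> \<open>Where \<open>f T\<close> exceeds half its limit \<open>?V\<close>, the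
      multiple \<open>\<epsilon> * f T\<close> is at least 2 and beats \<open>Q\<close>. Thus
      \<open>g\<close> is nonpositive outside a finite set and attains its maximum.\<close>
    define \<epsilon> where "\<epsilon> = 4 / ?V"
    have \<epsilon>: "0 < \<epsilon>" using V by (simp add: \<epsilon>_def)
    have "(\<lambda>z. \<Sum>t=1..T. W t * (1 - sg t ^ z)) \<longlonglongrightarrow> (\<Sum>t=1..T. W t * (1 - 0))"
      by (intro tendsto_intros LIMSEQ_power_zero) (auto simp: sg_def)
    then have "f T \<longlonglongrightarrow> ?V" by (simp add: f_def)
    then have "eventually (\<lambda>z. ?V / 2 < f T z) sequentially"
      by (rule order_tendstoD(1)) (use V in simp)
    then obtain J where J: "\<And>z. J \<le> z \<Longrightarrow> ?V / 2 < f T z"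
      by (auto simp: eventually_sequentially)
    define g where "g = (\<lambda>z. Q z - \<epsilon> * f T z)"
    have gb: "bounded (range g)"
      unfolding g_def by (rule bounded_minus_comp[OF Qb bounded_scale[OF fb]])
    have g_large: "g z \<le> 0" if "J \<le> z" for z
    proof -
      have "\<epsilon> * (?V / 2) \<le> \<epsilon> * f T z" using J[OF that] \<epsilon> by simp
      then show ?thesis using Q(1)[of z] V by (simp add: g_def \<epsilon>_def)
    qed
    define m where "m = Max (g ` {..J})"
    have "m \<in> g ` {..J}" unfolding m_def by (rule Max_in) auto
    then obtain i where i: "m = g i" by blast
    have g0: "g 0 = 0" by (simp add: g_def Q f_0)
    have m_ge: "g z \<le> m" if "z \<le> J" for z unfolding m_def using that by (intro Max_ge) auto
    then have m0': "0 \<le> m" using g0 by (metis zero_le)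
    have g_le: "g z \<le> m * of_bool (z \<noteq> 0)" for z
      using m_ge[of z] g_large[of z] m0' g0 by (cases "z \<le> J") auto
    have sg: "stopped ps g z \<le> m * stopped ps (\<lambda>z. of_bool (z \<noteq> 0)) z" for z
    proof -
      have "stopped ps g z \<le> stopped ps (\<lambda>z. m * of_bool (z \<noteq> 0)) z"
        by (rule stopped_mono[OF ps' gb bounded_scale[OF bounded_unit] g_le]) simp
      then show ?thesis by (simp add: stopped_scale)
    qed
    have Qs: "Q z = stopped ps g z + \<epsilon> * stopped ps (f T) z" for z
    proof -
      have "stopped ps g z = stopped ps Q z - stopped ps (\<lambda>z. \<epsilon> * f T z) z"
        unfolding g_def by (rule stopped_diff[OF Qb bounded_scale[OF fb]])
      then show ?thesis by (simp add: stopped_scale Q)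
    qed
    \<comment> \<open>Let \<open>i\<close> be a maximum point of \<open>g\<close>. If
      \<open>i\<close> is at least \<open>m0\<close>, superharmonicity gives
      \<open>m \<le> m * s\<close> with a survival probability \<open>s < 1\<close>, so
      \<open>m \<le> 0\<close>. If \<open>i\<close> is smaller, monotonicity moves
      \<open>f T\<close> up to \<open>m0\<close>, and the chance of dying at once leaves the bound
      \<open>\<epsilon> * C\<close>.\<close>
    have m_le: "m \<le> \<epsilon> * C"
    proof (cases "m0 \<le> i")
      case True
      then have "stopped ps (f T) i \<le> f T i" by (intro f_super) (auto simp: m0_def)
      then have "m \<le> stopped ps g i"
        using Qs[of i] \<epsilon> unfolding i g_def by simp
      also note sg[of i]
      finally have "m * (1 - stopped ps (\<lambda>z. of_bool (z \<noteq> 0)) i) \<le> 0" by (simp add: algebra_simps)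
      then have "m \<le> 0" using stopped_nonzero_less_1[OF ps, of i] by (simp add: mult_le_0_iff)
      moreover have "0 \<le> C"
      proof -
        have "0 \<le> f T m0" by (rule f_nonneg)
        also have "\<dots> \<le> real m0 * A' * S" by (rule f_le)
        finally show ?thesis using \<beta> by (simp add: C_def)
      qed
      ultimately show ?thesis using \<epsilon> by (simp add: order_trans)
    next
      case False
      have "stopped ps (f T) i \<le> stopped ps (f T) m0"
      proof -
        have "antimono (\<lambda>z. - 1 * f T z)" by (rule antimonoI) (simp add: f_mono)
        from antimonoD[OF stopped_antimono[OF ps' bounded_scale[OF fb] this], of i m0] False
        show ?thesis by (simp only: stopped_scale) simp
      qed
      also have "\<dots> \<le> f T m0" by (rule f_super) (auto simp: m0_def)
      also have "\<dots> \<le> real m0 * A' * S" by (rule f_le)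
      finally have 1: "\<epsilon> * stopped ps (f T) i \<le> \<epsilon> * (real m0 * A' * S)" using \<epsilon> by simp
      have "m \<le> Q i" using \<epsilon> f_nonneg[of T i] by (simp add: i g_def)
      also have "\<dots> \<le> m * stopped ps (\<lambda>z. of_bool (z \<noteq> 0)) i + \<epsilon> * (real m0 * A' * S)"
        using Qs[of i] sg[of i] 1 by linarith
      also have "m * stopped ps (\<lambda>z. of_bool (z \<noteq> 0)) i \<le> m * \<beta>"
        using \<beta>(2)[of i] False m0' by (intro mult_left_mono) auto
      finally have "m * (1 - \<beta>) \<le> \<epsilon> * (real m0 * A' * S)" by (simp add: algebra_simps)
      then show ?thesis using \<beta>(1) by (simp add: C_def field_simps)
    qed
    have "g j \<le> m" using g_le[of j] m0' by (cases "j = 0") auto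
    then have "Q j \<le> \<epsilon> * f T j + \<epsilon> * C" using m_le by (simp add: g_def)
    also have "\<dots> \<le> \<epsilon> * (real j * A' * S) + \<epsilon> * C" using f_le[of T j] \<epsilon> by simp
    finally show ?thesis by (simp add: \<epsilon>_def add_divide_distrib algebra_simps)
  qed
  \<comment> \<open>\<open>W\<close> is of order 1/t, so its sums diverge, whereas the bound on
    \<open>f T j\<close> is independent of \<open>T\<close>.\<close>
  have "filterlim (\<lambda>T. \<Sum>t=1..T. W t) at_top sequentially"
  proof (rule filterlim_at_top_mono)
    have "filterlim (\<lambda>T. - 1 + harm T :: real) at_top sequentially"
      by (rule filterlim_tendsto_add_at_top[OF tendsto_const harm_at_top])
    from filterlim_tendsto_pos_mult_at_top[OF tendsto_const _ this, of "cof ps 1 * c"]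
    show "filterlim (\<lambda>T. cof ps 1 * c * (harm T - 1 :: real)) at_top sequentially"
      using cof1 cA(1) by simp
    show "eventually (\<lambda>T. cof ps 1 * c * (harm T - 1) \<le> (\<Sum>t=1..T. W t)) sequentially"
      using eventually_ge_at_top[of 1]
    proof eventually_elim
      case (elim T)
      have "harm T - 1 = (\<Sum>t=2..T. 1 / real t)"
        unfolding harm_def using elim by (subst sum.atLeast_Suc_atMost) (simp_all add: divide_inverse numeral_2_eq_2)
      then have "cof ps 1 * c * (harm T - 1) = (\<Sum>t=2..T. cof ps 1 * c * (1 / real t))"
        by (simp only: sum_distrib_left)
      also have "\<dots> \<le> (\<Sum>t=2..T. W t)" by (rule sum_mono) (use W_ge in auto)
      also have "\<dots> \<le> (\<Sum>t=1..T. W t)" by (rule sum_mono2) (use W_pos in \<open>auto intro: less_imp_le\<close>)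
      finally show ?case .
    qed
  qed
  then have "(\<lambda>T. 4 / (\<Sum>t=1..T. W t) * (real j * A' * S + C)) \<longlonglongrightarrow> 0 * (real j * A' * S + C)"
    by (intro tendsto_mult tendsto_const tendsto_divide_0[OF tendsto_const]) (rule filterlim_at_top_imp_at_infinity)
  then have "Q j \<le> 0"
    by (intro LIMSEQ_le_const[of _ 0]) (use key in auto)
  then show ?thesis using Q(1)[of j] by simp
qed

lemma count_list_map_Not: "count_list (map Not a) b = count_list a (\<not> b)"
  by (induction a) auto

lemma extinction_weights: "set ps \<subseteq> {0..1} \<Longrightarrow> chain_weights ps (\<lambda>_. 1) (\<lambda>z. of_bool (z = 0))"
  by unfold_locales (auto simp: antimono_def)

abbreviation extinct :: "real list \<Rightarrow> nat \<Rightarrow> (int \<Rightarrow> bool list) \<Rightarrow> int \<Rightarrow> nat \<Rightarrow> real" where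
  "extinct ps \<equiv> chain ps (\<lambda>_. 1) 0 (\<lambda>z. of_bool (z = 0))"

text \<open>State 0 is absorbing, so extinction probabilities increase with the number of sites.
  Their limit is harmonic with value 1 at 0; its complement is the kind of function that critical
  drift forces to vanish.\<close>

lemma extinct_tendsto_1:
  assumes ps: "set ps \<subseteq> {0..<1}" and drift: "drift ps = - 1"
  shows "(\<lambda>N. extinct ps N (\<lambda>_. []) y j) \<longlonglongrightarrow> 1"
proof -
  have ps': "set ps \<subseteq> {0..1}" using ps by auto
  interpret chain_weights ps "\<lambda>_. 1" 0 "\<lambda>z. of_bool (z = 0)"
    by (rule extinction_weights[OF ps'])
  define d where "d = (\<lambda>N j. G N (\<lambda>_. []) y j)"
  have d_Suc: "d (Suc N) j = stopped ps (d N) j" for N j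
    unfolding d_def by (subst chain_empty_Suc) simp
  have d_unit: "d N j \<in> {0..1}" for N j unfolding d_def by (rule chain_unit)
  have db: "bounded (range (d N))" for N by (rule bounded_unit) (rule d_unit)
  have d_0: "d N 0 = 1" for N by (induction N) (simp_all add: d_Suc, simp add: d_def)
  have inc: "d N j \<le> d (Suc N) j" for N j
  proof (induction N arbitrary: j)
    case 0
    show ?case
    proof (cases "j = 0")
      case True
      then show ?thesis by (simp add: d_0)
    next
      case False
      then have "d 0 j = 0" by (simp add: d_def)
      then show ?thesis using d_unit[of 1 j] by simp
    qed
  next
    case (Suc N)
    have "stopped ps (d N) j \<le> stopped ps (d (Suc N)) j"
      by (rule stopped_mono[OF ps' db db]) (rule Suc.IH)
    then show ?case using d_Suc[of N j] d_Suc[of "Suc N" j] by linarith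
  qed
  have "\<exists>L. (\<lambda>N. d N j) \<longlonglongrightarrow> L" for j
  proof -
    have "incseq (\<lambda>N. d N j)" by (rule incseq_SucI) (rule inc)
    moreover have "\<forall>N. d N j \<le> 1" using d_unit by simp
    ultimately show ?thesis using incseq_convergent by metis
  qed
  then obtain D where D: "\<And>j. (\<lambda>N. d N j) \<longlonglongrightarrow> D j" by metis
  have D_unit: "D j \<in> {0..1}" for j
    using LIMSEQ_le_const[OF D, of 0 j] LIMSEQ_le_const2[OF D, of j 1] d_unit by auto
  have D_0: "D 0 = 1" using LIMSEQ_unique[OF D[of 0]] by (simp add: d_0)
  have fixpt: "stopped ps D j = D j" for j
  proof (rule LIMSEQ_unique)
    have "(\<lambda>N. d (Suc N) j) \<longlonglongrightarrow> stopped ps D j"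
      unfolding d_Suc by (rule stopped_tendsto[where B = 1]) (use d_unit D in \<open>auto simp: abs_le_iff intro: order_trans[of _ 0]\<close>)
    then show "(\<lambda>N. d N j) \<longlonglongrightarrow> stopped ps D j" by (rule LIMSEQ_imp_Suc)
  qed (rule D)
  have "1 - D j = 0" for j
  proof (rule survival_zero_if_critical[OF assms, of "\<lambda>j. 1 - D j"])
    show "1 - D j \<in> {0..1}" for j using D_unit[of j] by auto
    show "stopped ps (\<lambda>j. 1 - D j) j = 1 - D j" for j
      by (subst stopped_diff) (simp_all add: fixpt bounded_unit[OF D_unit])
  qed (simp add: D_0)
  then show ?thesis using D[of j] by (simp add: d_def)
qed

text \<open>For \<open>drift < -1\<close> the weights are summable, and \<open>f\<close> is a
  decreasing function with limit 0 that is superharmonic at states using all cookies. Dividing by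
  its value at \<open>length ps\<close> makes it at least 1 at the smaller states, so it dominates
  the extinction probability everywhere.\<close>

lemma extinct_small:
  assumes ps: "set ps \<subseteq> {0..1}" and drift: "drift ps < - 1" and \<epsilon>: "0 < \<epsilon>"
  obtains K where "\<And>N. extinct ps N (\<lambda>_. []) y K \<le> \<epsilon>"
proof -
  interpret chain_weights ps "\<lambda>_. 1" 0 "\<lambda>z. of_bool (z = 0)"
    by (rule extinction_weights[OF ps])
  let ?w = "\<lambda>n. wt ps (n + 2)" and ?s = "\<lambda>n. sg (n + 2)"
  obtain c A where cA: "0 < A" "\<And>t. 2 \<le> t \<Longrightarrow> wt ps t \<le> A * real t powr drift ps"
    using wt_asymp[OF ps] by metis
  have w_pos: "0 < ?w n" for n by (rule wt_pos[OF ps])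
  have w_sum: "summable ?w"
  proof (rule summable_comparison_test')
    have "summable (\<lambda>t. A * real t powr drift ps)"
      by (intro summable_mult) (use drift in \<open>simp add: summable_real_powr_iff\<close>)
    then show "summable (\<lambda>n. A * real (n + 2) powr drift ps)"
      by (subst summable_iff_shift[of "\<lambda>t. A * real t powr drift ps"])
    show "norm (?w n) \<le> A * real (n + 2) powr drift ps" for n
      using cA(2)[of "n + 2"] w_pos[of n] by simp
  qed
  have s: "?s n ^ z \<in> {0..1}" for n z by (rule sg_pow_unit) simp
  have ws: "0 \<le> ?w n * ?s n ^ z" "?w n * ?s n ^ z \<le> ?w n" for n z
    using w_pos[of n] s[of n z] by (auto intro: mult_left_le)
  have fsum: "summable (\<lambda>n. ?w n * ?s n ^ z)" for z
    by (rule summable_comparison_test'[OF w_sum]) (use ws in auto)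
  define f where "f = (\<lambda>z. \<Sum>n. ?w n * ?s n ^ z)"
  define f' where "f' = (\<lambda>T z. \<Sum>n<T. ?w n * ?s n ^ z)"
  have f_le: "f z \<le> (\<Sum>n. ?w n)" for z
    unfolding f_def by (intro suminf_le fsum w_sum ws)
  have f'_le: "f' T z \<le> f z" for T z
    unfolding f_def f'_def by (intro sum_le_suminf fsum) (use ws in auto)
  have f'_nonneg: "0 \<le> f' T z" for T z unfolding f'_def by (intro sum_nonneg ws)
  have f_pos: "0 < f z" for z
  proof -
    have "0 < f' 1 z" using w_pos[of 0] by (simp add: f'_def sg_def)
    then show ?thesis using f'_le[of 1 z] by linarith
  qed
  have f_anti: "f z' \<le> f z" if "z \<le> z'" for z z'
    unfolding f_def
  proof (intro suminf_le fsum mult_left_mono power_decreasing that)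
    show "0 \<le> ?s n" "?s n \<le> 1" "0 \<le> ?w n" for n using w_pos[of n] sg_unit[of "n + 2"] by auto
  qed
  have f_lim: "(\<lambda>T. f' T z) \<longlonglongrightarrow> f z" for z
    unfolding f_def f'_def by (rule summable_LIMSEQ[OF fsum])
  have fb: "bounded (range f)"
    by (rule boundedI[where B = "\<Sum>n. ?w n"]) (use f_le f_pos in \<open>auto simp: abs_of_pos\<close>)
  have f_super: "stopped ps f j \<le> f j" if j: "length ps \<le> j" for j
  proof (rule LIMSEQ_le_const2)
    show "(\<lambda>T. stopped ps (f' T) j) \<longlonglongrightarrow> stopped ps f j"
      by (rule stopped_tendsto[where B = "\<Sum>n. ?w n", OF _ f_lim])
        (metis abs_of_nonneg f'_nonneg f'_le f_le order_trans)
    have "stopped ps (f' T) j \<le> f j" for T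
    proof -
      have sh: "(\<Sum>t=2..<T+2. H t) = (\<Sum>n<T. H (n + 2))" for H :: "nat \<Rightarrow> real"
        by (induction T) (simp_all add: sum.atLeastLessThan_Suc)
      have re: "f' T z = (\<Sum>t=2..<T+2. wt ps t * sg t ^ z)" for z
        unfolding f'_def sh ..
      have "stopped ps (f' T) j = (\<Sum>t=2..<T+2. wt ps t * cof ps t * sg (Suc t) ^ j)"
        unfolding re[abs_def] by (rule stopped_sum_gen[OF j]) auto
      also have "\<dots> = (\<Sum>t=2..<T+2. wt ps (Suc t) * sg (Suc t) ^ j)"
        by (rule sum.cong) (auto simp: wt_Suc)
      also have "\<dots> = (\<Sum>n<T. ?w (Suc n) * ?s (Suc n) ^ j)"
        unfolding sh by simp
      \<comment> \<open>Only an upper bound is wanted, so the nonnegative term at t = 2 that the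
        telescoping lacks may be added.\<close>
      also have "\<dots> \<le> ?w 0 * ?s 0 ^ j + (\<Sum>n<T. ?w (Suc n) * ?s (Suc n) ^ j)"
        using ws(1)[of 0 j] by simp
      also have "\<dots> = f' (Suc T) j" unfolding f'_def by (rule sum.lessThan_Suc_shift[symmetric])
      also note f'_le
      finally show ?thesis .
    qed
    then show "\<exists>N. \<forall>T\<ge>N. stopped ps (f' T) j \<le> f j" by blast
  qed
  let ?m = "length ps"
  have bound: "G N (\<lambda>_. []) y j \<le> f j / f ?m" for N j
  proof (induction N arbitrary: j)
    case 0
    show ?case
    proof (cases "j = 0")
      case True
      then show ?thesis using f_anti[of 0 ?m] f_pos[of ?m] by simp
    next
      case False
      then show ?thesis using f_pos by (simp add: less_imp_le)
    qed
  next
    case (Suc N)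
    show ?case
    proof (cases "?m \<le> j")
      case True
      have "G (Suc N) (\<lambda>_. []) y j = stopped ps (G N (\<lambda>_. []) y) j"
        by (subst chain_empty_Suc) simp
      also have "\<dots> \<le> stopped ps (\<lambda>z. 1 / f ?m * f z) j"
        by (rule stopped_mono[OF ps bounded_unit[OF chain_unit] bounded_scale[OF fb]]) (use Suc in simp)
      also have "\<dots> \<le> 1 / f ?m * f j"
        unfolding stopped_scale using f_super[OF True] f_pos[of ?m] by (intro mult_left_mono) auto
      finally show ?thesis by simp
    next
      case False
      have "G (Suc N) (\<lambda>_. []) y j \<le> 1" using chain_unit[of "Suc N" "\<lambda>_. []" y j] by simp
      also have "1 \<le> f j / f ?m" using f_anti[of j ?m] f_pos[of ?m] False by simp
      finally show ?thesis .
    qed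
  qed
  have "f \<longlonglongrightarrow> 0"
  proof (rule LIMSEQ_I)
    fix r :: real assume r: "0 < r"
    have "(\<lambda>T. \<Sum>n<T. ?w n) \<longlonglongrightarrow> (\<Sum>n. ?w n)" by (rule summable_LIMSEQ[OF w_sum])
    then have "eventually (\<lambda>T. (\<Sum>n. ?w n) - r / 2 < (\<Sum>n<T. ?w n)) sequentially"
      by (rule order_tendstoD(1)) (use r in simp)
    then obtain T where T: "(\<Sum>n. ?w n) - r / 2 < (\<Sum>n<T. ?w n)"
      by (auto simp: eventually_sequentially)
    have "f' T \<longlonglongrightarrow> (\<Sum>n<T. ?w n * 0)"
      unfolding f'_def by (intro tendsto_intros LIMSEQ_power_zero) (auto simp: sg_def field_simps)
    then have "eventually (\<lambda>z. f' T z < r / 2) sequentially"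
      by (intro order_tendstoD(2)) (use r in auto)
    then obtain z0 where z0: "\<And>z. z0 \<le> z \<Longrightarrow> f' T z < r / 2"
      by (auto simp: eventually_sequentially)
    have "norm (f z - 0) < r" if "z0 \<le> z" for z
    proof -
      have "f z - f' T z = (\<Sum>n. ?w (n + T) * ?s (n + T) ^ z)"
        unfolding f_def f'_def by (subst suminf_split_initial_segment[OF fsum, of _ T]) simp
      also have "\<dots> \<le> (\<Sum>n. ?w (n + T))"
        using ws by (intro suminf_le) (auto simp only: summable_iff_shift[of "\<lambda>n. ?w n * ?s n ^ z"] summable_iff_shift[of ?w] intro: fsum w_sum)
      also have "\<dots> = (\<Sum>n. ?w n) - (\<Sum>n<T. ?w n)"
        by (subst suminf_split_initial_segment[OF w_sum, of T]) simp
      finally show ?thesis using T z0[OF that] f_pos[of z] by simp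
    qed
    then show "\<exists>no. \<forall>n\<ge>no. norm (f n - 0) < r" by blast
  qed
  then have "eventually (\<lambda>K. f K < \<epsilon> * f ?m) sequentially"
    by (rule order_tendstoD(2)) (use \<epsilon> f_pos in simp)
  then obtain K where K: "f K < \<epsilon> * f ?m" by (auto simp: eventually_sequentially)
  have "G N (\<lambda>_. []) y K \<le> \<epsilon>" for N
  proof -
    have "f K / f ?m < \<epsilon>" using K f_pos[of ?m] by (simp add: divide_less_eq)
    then show ?thesis using bound[of N K] by linarith
  qed
  then show thesis by (rule that)
qed

section \<open>Escape to the right and returns from the left\<close>

locale cookie_walk = dominated_walk P X "arrow_prob hs" for P :: "'a measure" and X hs +
  assumes hs: "set hs \<subseteq> {0..<1}"
begin

lemma hs_unit: "set hs \<subseteq> {0..1}" using hs by auto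

definition left_probs :: "real list" where "left_probs = map (\<lambda>p. 1 - p) hs"

lemma left_probs: "set left_probs \<subseteq> {0<..1}" "arrow_prob hs = (\<lambda>n. 1 - arrow_prob left_probs n)"
  using hs by (auto simp: left_probs_def arrow_prob_def fun_eq_iff)

lemma drift_left_probs: "drift left_probs = - drift hs"
  unfolding left_probs_def drift_def by (induction hs) auto

text \<open>On this event the excursion chain started with \<open>K\<close> at \<open>x0 + 1\<close>
  is still alive after \<open>N\<close> sites, which drives \<open>1 - extinct\<close> up to 1. Its
  initial value is below \<open>\<epsilon>\<close> for large \<open>N\<close>, because the critical
  chain dies out.\<close>

lemma no_escape_right:
  assumes "drift hs = - 1"
  shows "AE \<omega> in P. \<not> (X 0 \<omega> = x0 \<and> (\<forall>n. rights (traj \<omega>) n x0 \<le> K) \<and> (\<forall>C. eventually (\<lambda>n. C < X n \<omega>) sequentially))"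
proof -
  interpret chain_weights hs "\<lambda>_. 1" 0 "\<lambda>z. of_bool (z = 0)"
    by (rule extinction_weights[OF hs_unit])
  show ?thesis
  proof (rule AE_not_if_excessive[where Q = "\<lambda>x. x 0 = x0 \<and> (\<forall>n. rights x n x0 \<le> K) \<and> (\<forall>C. eventually (\<lambda>n. C < x n) sequentially)"])
    fix \<epsilon> :: real assume "0 < \<epsilon>"
    have "eventually (\<lambda>N. 1 - \<epsilon> < extinct hs N (\<lambda>_. []) (x0 + 1) K) sequentially"
      by (rule order_tendstoD(1)[OF extinct_tendsto_1[OF hs assms]]) (use \<open>0 < \<epsilon>\<close> in simp)
    then obtain N0 where N0: "\<And>N. N0 \<le> N \<Longrightarrow> 1 - \<epsilon> < G N (\<lambda>_. []) (x0 + 1) K"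
      by (auto simp: eventually_sequentially)
    define N where "N = Suc N0"
    have N: "1 - \<epsilon> < G N (\<lambda>_. []) (x0 + 1) K" "0 < N" using N0[of N] by (auto simp: N_def)
    let ?h = "\<lambda>_::nat. \<lambda>c. 1 - G N c (x0 + 1) K"
    have "\<exists>n. 1 \<le> ?h N' (arrows x n)"
      if nn: "\<And>n. \<bar>x (Suc n) - x n\<bar> = 1" and x: "x 0 = x0" "\<And>n. rights x n x0 \<le> K"
        "\<And>C. eventually (\<lambda>n. C < x n) sequentially" for x N'
    proof -
      obtain n where n: "x0 + int N < x n"
        using x(3)[of "x0 + int N"] by (auto simp: eventually_sequentially)
      \<comment> \<open>The walk ends to the right of all these edges, so each is crossed upward
        once more than downward. This surplus makes \<open>passed\<close> hold with strict
        inequality and keeps the right steps nonzero.\<close>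
      have bal: "rights x n (x0 + int i) = lefts x n (x0 + int i + 1) + 1" if "i \<le> N" for i
        using crossing_balance[where x = x, OF nn, of n "x0 + int i"] n that x(1) by simp
      have "G N (arrows x n) (x0 + 1) K \<le> (\<Prod>i<N. 1) * of_bool (rights x n (x0 + 1 + int N - 1) = 0)"
        unfolding rights_def
      proof (rule chain_upper[OF _ _ N(2)])
        show "passed (arrows x n (x0 + 1)) (K + 0)"
          using bal[of 0] x(2)[of n] by (simp add: passed_def lefts_def)
        show "passed (arrows x n (x0 + 1 + int i + 1)) (count_list (arrows x n (x0 + 1 + int i)) True + 0)"
          if "Suc i < N" for i
          using bal[of "Suc i"] that by (simp add: passed_def lefts_def rights_def add.commute add.left_commute)
      qed
      also have "rights x n (x0 + 1 + int N - 1) \<noteq> 0" using bal[of N] by simp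
      then have "(\<Prod>i<N. 1) * of_bool (rights x n (x0 + 1 + int N - 1) = 0) = (0::real)" by simp
      finally show ?thesis by auto
    qed
    moreover have "excessive (arrow_prob hs) (?h N')" "0 \<le> ?h N' c" "?h N' c \<le> 1" for N' c
      using excessive_right_chain chain_unit[of N c "x0 + 1" K] by auto
    moreover have "?h N' (\<lambda>_. []) \<le> \<epsilon>" for N' using N(1) by simp
    ultimately show "\<exists>h B. (\<forall>N::nat. excessive (arrow_prob hs) (h N) \<and> (\<forall>c. 0 \<le> h N c \<and> h N c \<le> B N) \<and> h N (\<lambda>_. []) \<le> \<epsilon>)
      \<and> (\<forall>x. (\<forall>n. \<bar>x (Suc n) - x n\<bar> = 1) \<longrightarrow> (x 0 = x0 \<and> (\<forall>n. rights x n x0 \<le> K) \<and> (\<forall>C. eventually (\<lambda>n. C < x n) sequentially)) \<longrightarrow>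
          eventually (\<lambda>N. \<exists>n. 1 \<le> h N (arrows x n)) sequentially)"
      by (intro exI[of _ ?h] exI[of _ "\<lambda>_. 1"]) (auto simp del: chain.simps)
  qed
qed

text \<open>After reflection, \<open>K\<close> right steps from \<open>y\<close> mean that
  \<open>K\<close> excursions to the left of \<open>y\<close> are allowed for. A finite path reaches
  only finitely far to the left, so the chain started with \<open>K\<close> is seen to die out,
  which is unlikely for large \<open>K\<close>. The depth \<open>N\<close> has to exceed the extent
  of the path, hence a family indexed by \<open>N\<close>.\<close>

lemma no_return_from_left:
  assumes "1 < drift hs"
  shows "AE \<omega> in P. \<not> (\<forall>K. \<exists>n. y < X n \<omega> \<and> K \<le> rights (traj \<omega>) n y)"
proof -
  have lp: "set left_probs \<subseteq> {0..1}" using left_probs(1) by auto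
  have d: "drift left_probs < - 1" using assms drift_left_probs by simp
  interpret chain_weights left_probs "\<lambda>_. 1" 0 "\<lambda>z. of_bool (z = 0)"
    by (rule extinction_weights[OF lp])
  show ?thesis
  proof (rule AE_not_if_excessive[where Q = "\<lambda>x. \<forall>K. \<exists>n. y < x n \<and> K \<le> rights x n y"])
    fix \<epsilon> :: real assume "0 < \<epsilon>"
    obtain K where K: "\<And>N. G N (\<lambda>_. []) (- y) K \<le> \<epsilon>"
      using extinct_small[OF lp d \<open>0 < \<epsilon>\<close>] by blast
    let ?h = "\<lambda>N c. G N (flip c) (- y) K"
    have "eventually (\<lambda>N. \<exists>n. 1 \<le> ?h N (arrows x n)) sequentially"
      if nn: "\<And>n. \<bar>x (Suc n) - x n\<bar> = 1" and x: "\<And>K. \<exists>n. y < x n \<and> K \<le> rights x n y" for x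
    proof -
      obtain n where n: "y < x n" "K \<le> rights x n y" using x by blast
      let ?x = "\<lambda>m. - x m"
      have nn': "\<bar>?x (Suc m) - ?x m\<bar> = 1" for m using nn[of m] by linarith
      have fl: "flip (arrows x n) = arrows ?x n" by (rule flip_arrows[where x = x, OF nn])
      have "lefts ?x n (- y) = rights x n y"
        unfolding lefts_def fl[symmetric] rights_def flip_def by (simp add: count_list_map_Not)
      obtain M where M: "\<And>m. m < n \<Longrightarrow> ?x m < M"
      proof -
        have "?x m < Max (?x ` {..n}) + 1" if "m < n" for m
          using Max_ge[of "?x ` {..n}" "?x m"] that by auto
        then show thesis by (rule that)
      qed
      have "1 \<le> ?h N (arrows x n)" if N: "nat (M + y + 1) < N" for N
      proof -
        have "rights ?x n (- y + int N - 1) = 0"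
        proof (rule rights_eq_0)
          fix m assume "m < n"
          then show "?x m \<noteq> - y + int N - 1" using M[of m] N by linarith
        qed
        then have "1 = (\<Prod>i<N. 1) * (of_bool (rights ?x n (- y + int N - 1) = 0) :: real)" by simp
        also have "\<dots> \<le> G N (arrows ?x n) (- y) K"
          unfolding rights_def
        proof (rule chain_lower)
          show "K + 0 \<le> count_list (arrows ?x n (- y)) False"
            using \<open>lefts ?x n (- y) = rights x n y\<close> n(2) by (simp add: lefts_def)
          show "count_list (arrows ?x n (- y + int i)) True + 0 \<le> count_list (arrows ?x n (- y + int i + 1)) False" for i
            using crossing_balance[where x = ?x, OF nn', of n "- y + int i"] n(1)
            by (auto simp: rights_def lefts_def of_bool_def split: if_splits)
          show "0 < N" using N by simp
        qed
        finally show ?thesis unfolding fl .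
      qed
      then show ?thesis unfolding eventually_sequentially by (metis Suc_le_eq)
    qed
    moreover have "excessive (arrow_prob hs) (?h N)" "0 \<le> ?h N c" "?h N c \<le> 1" for N c
      using excessive_left_chain[of N "- y" K] chain_unit[of N "flip c" "- y" K] by (auto simp: left_probs(2))
    moreover have "?h N (\<lambda>_. []) \<le> \<epsilon>" for N using K[of N] by (simp add: flip_def[abs_def])
    ultimately show "\<exists>h B. (\<forall>N::nat. excessive (arrow_prob hs) (h N) \<and> (\<forall>c. 0 \<le> h N c \<and> h N c \<le> B N) \<and> h N (\<lambda>_. []) \<le> \<epsilon>)
      \<and> (\<forall>x. (\<forall>n. \<bar>x (Suc n) - x n\<bar> = 1) \<longrightarrow> (\<forall>K. \<exists>n. y < x n \<and> K \<le> rights x n y) \<longrightarrow>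
          eventually (\<lambda>N. \<exists>n. 1 \<le> h N (arrows x n)) sequentially)"
      by (intro exI[of _ ?h] exI[of _ "\<lambda>_. 1"]) (auto simp del: chain.simps)
  qed
qed

end

section \<open>Total progeny of the branching process\<close>

lemma nb_point_pos: "0 < nb (\<lambda>z. of_bool (z = J)) (Suc j)"
proof (induction J)
  case 0
  have b: "bounded (range (\<lambda>z::nat. of_bool (z = 0) :: real))" by (rule bounded_unit) simp
  have "0 < nb (\<lambda>z. of_bool (z = 0)) i" for i
  proof (induction i)
    case (Suc i)
    then show ?case using nb_Suc[OF b, of i] by simp
  qed simp
  then show ?case .
next
  case (Suc J)
  have b: "bounded (range (\<lambda>z::nat. of_bool (z = Suc J) :: real))" by (rule bounded_unit) simp
  have "0 \<le> nb (\<lambda>z. of_bool (z = Suc J)) j"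
    using nb_mono[of "\<lambda>_. 0", OF _ b, of j] by simp
  then show ?case using nb_Suc[OF b, of j] Suc by simp
qed

text \<open>All cookies show \<open>True\<close> with positive probability, which is compatible with
  a count of \<open>J\<close> once \<open>J\<close> is at least their number; fair arrows then
  produce the rest.\<close>

lemma stopped_point_pos:
  assumes "set ps \<subseteq> {0<..1}" "length ps \<le> J"
  shows "0 < stopped ps (\<lambda>z. of_bool (z = J)) (Suc j)"
  using assms
proof (induction ps arbitrary: J)
  case Nil
  then show ?case by (simp add: nb_point_pos)
next
  case (Cons p ps)
  then obtain J' where J: "J = Suc J'" by (cases J) auto
  have p: "0 < p" "p \<le> 1" and ps: "set ps \<subseteq> {0..1}" using Cons.prems by auto
  have "0 < p * stopped ps (\<lambda>z. of_bool (z = J')) (Suc j)"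
    using Cons J p by (intro mult_pos_pos Cons.IH) auto
  moreover have "0 \<le> stopped ps (\<lambda>z. of_bool (z = J)) j"
    by (rule stopped_bounds(1)[OF ps, of _ _ 1]) auto
  then have "0 \<le> (1 - p) * stopped ps (\<lambda>z. of_bool (z = J)) j"
    using p by simp
  ultimately show ?case by (simp add: J)
qed

lemma cof_expansion:
  assumes "set ps \<subseteq> {0..1}"
  obtains K where "0 \<le> K" "\<And>t. 1 \<le> t \<Longrightarrow> \<bar>cof ps t - 1 - drift ps / real t\<bar> \<le> K / (real t)\<^sup>2"
proof -
  have "\<exists>K\<ge>0. \<forall>t\<ge>1. \<bar>cof ps t - 1 - drift ps / real t\<bar> \<le> K / (real t)\<^sup>2"
    using assms
  proof (induction ps)
    case Nil
    show ?case by (rule exI[of _ 0]) (simp add: cof_def drift_def)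
  next
    case (Cons p ps)
    then obtain K where K: "0 \<le> K" "\<And>t. 1 \<le> t \<Longrightarrow> \<bar>cof ps t - 1 - drift ps / real t\<bar> \<le> K / (real t)\<^sup>2"
      by auto
    define a where "a = 1 - 2 * p"
    have a: "\<bar>a\<bar> \<le> 1" using Cons.prems by (auto simp: a_def)
    have "\<bar>cof (p # ps) t - 1 - drift (p # ps) / real t\<bar> \<le> (2 * K + \<bar>drift ps\<bar>) / (real t)\<^sup>2" if t: "1 \<le> t" for t
    proof -
      define u where "u = 1 / real t"
      have u: "0 < u" "u \<le> 1" using t by (auto simp: u_def)
      define r where "r = cof ps t - 1 - drift ps * u"
      have r: "\<bar>r\<bar> \<le> K * u\<^sup>2" using K(2)[OF t] by (simp add: r_def u_def power_divide)
      have "cof (p # ps) t = (1 + a * u) * cof ps t" by (simp add: cof_def a_def u_def)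
      moreover have "drift (p # ps) / real t = a * u + drift ps * u"
        by (simp add: drift_def a_def u_def add_divide_distrib)
      ultimately have eq: "cof (p # ps) t - 1 - drift (p # ps) / real t = r + a * u * r + a * drift ps * u\<^sup>2"
        by (simp add: r_def power2_eq_square algebra_simps)
      have au: "\<bar>a * u\<bar> \<le> 1"
        unfolding abs_mult using a u by (intro mult_le_one) auto
      have "\<bar>a * u * r\<bar> \<le> 1 * \<bar>r\<bar>"
        unfolding abs_mult[of "a * u"] by (rule mult_right_mono[OF au]) simp
      moreover have "\<bar>a * drift ps * u\<^sup>2\<bar> \<le> \<bar>drift ps\<bar> * u\<^sup>2"
      proof -
        have "\<bar>a * drift ps * u\<^sup>2\<bar> = \<bar>a\<bar> * (\<bar>drift ps\<bar> * u\<^sup>2)" by (simp add: abs_mult)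
        also have "\<dots> \<le> 1 * (\<bar>drift ps\<bar> * u\<^sup>2)" by (rule mult_right_mono[OF a]) simp
        finally show ?thesis by simp
      qed
      ultimately have "\<bar>cof (p # ps) t - 1 - drift (p # ps) / real t\<bar> \<le> 2 * (K * u\<^sup>2) + \<bar>drift ps\<bar> * u\<^sup>2"
        unfolding eq using r by linarith
      also have "\<dots> = (2 * K + \<bar>drift ps\<bar>) / (real t)\<^sup>2"
        by (simp add: u_def power_divide add_divide_distrib)
      finally show ?thesis .
    qed
    then show ?case using K(1) by (intro exI[of _ "2 * K + \<bar>drift ps\<bar>"]) auto
  qed
  then show thesis using that by blast
qed

text \<open>Both bounds come from one recursion: passing from \<open>j\<close> to
  \<open>Suc j\<close> adds \<open>x * (1 - (1 - x) ^ j)\<close>. Bernoulli's inequality bounds this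
  from above, and the first estimate bounds it from below.\<close>

lemma power_expansion:
  fixes x :: real
  assumes "0 \<le> x" "x \<le> 1"
  shows "(1 - x) ^ j - 1 + real j * x \<le> (real j)\<^sup>2 * x\<^sup>2"
    and "real j * (real j - 1) / 2 * x\<^sup>2 - real j ^ 3 * x ^ 3 \<le> (1 - x) ^ j - 1 + real j * x"
proof -
  have b: "1 - (1 - x) ^ j \<le> real j * x" for j
    using Bernoulli_inequality[of "- x" j] assms by simp
  show *: "(1 - x) ^ j - 1 + real j * x \<le> (real j)\<^sup>2 * x\<^sup>2" for j
  proof (induction j)
    case (Suc j)
    have "(1 - x) ^ Suc j - 1 + real (Suc j) * x = ((1 - x) ^ j - 1 + real j * x) + x * (1 - (1 - x) ^ j)"
      by (simp add: algebra_simps)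
    also have "\<dots> \<le> (real j)\<^sup>2 * x\<^sup>2 + x * (real j * x)"
      using Suc b[of j] assms by (intro add_mono mult_left_mono) auto
    also have "\<dots> \<le> (real (Suc j))\<^sup>2 * x\<^sup>2"
    proof -
      have "0 \<le> (real j + 1) * x\<^sup>2" by simp
      then show ?thesis by (simp add: power2_eq_square algebra_simps)
    qed
    finally show ?case .
  qed simp
  show "real j * (real j - 1) / 2 * x\<^sup>2 - real j ^ 3 * x ^ 3 \<le> (1 - x) ^ j - 1 + real j * x"
  proof (induction j)
    case (Suc j)
    have "real (Suc j) * (real (Suc j) - 1) / 2 * x\<^sup>2 - real (Suc j) ^ 3 * x ^ 3
        \<le> (real j * (real j - 1) / 2 * x\<^sup>2 - real j ^ 3 * x ^ 3) + x * (real j * x - (real j)\<^sup>2 * x\<^sup>2)"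
    proof -
      have "real (Suc j) * (real (Suc j) - 1) / 2 = real j * (real j - 1) / 2 + real j"
        by (simp add: field_simps)
      moreover have "0 \<le> (2 * (real j)\<^sup>2 + 3 * real j + 1) * x ^ 3" using assms by simp
      moreover have "real (Suc j) ^ 3 = real j ^ 3 + (real j)\<^sup>2 + (2 * (real j)\<^sup>2 + 3 * real j + 1)"
        by (simp add: power2_eq_square power3_eq_cube algebra_simps)
      moreover have "x * (real j * x - (real j)\<^sup>2 * x\<^sup>2) = real j * x\<^sup>2 - (real j)\<^sup>2 * x ^ 3"
        by (simp add: power2_eq_square power3_eq_cube algebra_simps)
      ultimately show ?thesis by (simp only: distrib_right)
    qed
    also have "\<dots> \<le> ((1 - x) ^ j - 1 + real j * x) + x * (1 - (1 - x) ^ j)"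
      using Suc *[of j] assms by (intro add_mono mult_left_mono) (auto simp: algebra_simps)
    also have "\<dots> = (1 - x) ^ Suc j - 1 + real (Suc j) * x"
      by (simp add: algebra_simps)
    finally show ?case .
  qed simp
qed

text \<open>In this critical case the mean total progeny of an excursion is only logarithmically infinite.
  Up to normalisation, \<open>k\<close> below is a bounded truncation of a harmonic quadratic polynomial; the truncation
  at level \<open>L\<close> costs a drift of order \<open>j / ln L\<close>.\<close>

lemma critical_test_function:
  assumes ps: "set ps \<subseteq> {0<..1}" and drift: "drift ps = 2"
  obtains B where "0 \<le> B" "\<And>J D. 0 < D \<Longrightarrow> \<exists>k::nat \<Rightarrow> real. bounded (range k)
    \<and> (\<forall>j\<ge>1. length ps \<le> j + 1 \<longrightarrow> k j - real j / D \<le> stopped ps k (j + 1))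
    \<and> (\<forall>j\<le>J. k j \<le> real j * (1 + B) + (real j)\<^sup>2 + 1)
    \<and> (\<forall>j\<le>J. real j * (real j - 1) / 2 - real j * B - 2 \<le> k j)"
proof -
  have ps': "set ps \<subseteq> {0..1}" using ps by auto
  obtain K where K: "0 \<le> K" "\<And>t. 1 \<le> t \<Longrightarrow> \<bar>cof ps t - 1 - 2 / real t\<bar> \<le> K / (real t)\<^sup>2"
    using cof_expansion[OF ps'] drift by metis
  obtain c A where cA: "0 < c" "0 < A" "\<And>t. 2 \<le> t \<Longrightarrow> c * real t powr 2 \<le> wt ps t"
    "\<And>t. 2 \<le> t \<Longrightarrow> wt ps t \<le> A * real t powr 2"
    using wt_asymp[OF ps'] unfolding drift by blast
  \<comment> \<open>The additional awaited \<open>False\<close> costs a factor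
    \<open>sg (Suc t)\<close>, so the telescoping weights are products of \<open>d\<close> instead
    of \<open>cof\<close>. They are of order t, and the factor 2 gives
    \<open>v 2 = 1\<close>.\<close>
  define v where "v = (\<lambda>t. 2 * wt ps t / real t)"
  define d where "d = (\<lambda>t. cof ps t * sg (Suc t))"
  have v_2: "v 2 = 1" by (simp add: v_def)
  have v_pos: "0 < v t" if "2 \<le> t" for t using wt_pos[OF ps', of t] that by (simp add: v_def)
  have v_Suc: "v (Suc t) = v t * d t" if "2 \<le> t" for t
  proof -
    have "sg (Suc t) = real t / real (Suc t)" by (simp add: sg_def field_simps)
    then show ?thesis using that by (simp add: v_def d_def wt_Suc)
  qed
  have v_ge: "2 * c * real t \<le> v t" and v_le: "v t \<le> 2 * A * real t" if "2 \<le> t" for t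
    using cA(3)[OF that] cA(4)[OF that] that by (auto simp: v_def field_simps power2_eq_square)
  define B where "B = K + 1"
  have B: "0 \<le> B" using K by (simp add: B_def)
  have d_exp: "\<bar>d t - 1 - 1 / real t\<bar> \<le> B / (real t)\<^sup>2" if t: "2 \<le> t" for t
  proof -
    define r where "r = cof ps t - 1 - 2 / real t"
    have r: "\<bar>r\<bar> \<le> K / (real t)\<^sup>2" using K(2)[of t] t by (simp add: r_def)
    have s: "sg (Suc t) = real t / real (Suc t)" by (simp add: sg_def field_simps)
    have "d t - 1 - 1 / real t = r * (real t / real (Suc t)) - 1 / (real t * real (Suc t))"
    proof -
      have "cof ps t = 1 + 2 / real t + r" by (simp add: r_def)
      moreover have "(1 + 2 / y + r) * (y / (1 + y)) - 1 - 1 / y = r * (y / (1 + y)) - 1 / (y * (1 + y))"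
        if "0 < y" for y :: real
      proof -
        have "(1 + 2 / y) * (y / (1 + y)) = (y + 2) / (1 + y)"
          using that by (simp add: distrib_right)
        moreover have "(y + 2) / (1 + y) - 1 - 1 / y = - (1 / (y * (1 + y)))"
          using that by (simp add: divide_simps)
        moreover have "(1 + 2 / y + r) * (y / (1 + y)) = (1 + 2 / y) * (y / (1 + y)) + r * (y / (1 + y))"
          by (rule distrib_right)
        ultimately show ?thesis by linarith
      qed
      from this[of "real t"] show ?thesis using t calculation by (simp add: d_def s)
    qed
    moreover have "\<bar>r * (real t / real (Suc t))\<bar> \<le> \<bar>r\<bar> * 1"
      unfolding abs_mult by (rule mult_left_mono) auto
    moreover have "\<bar>1 / (real t * real (Suc t))\<bar> \<le> 1 / (real t)\<^sup>2"
      using t by (auto simp: power2_eq_square intro!: divide_left_mono)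
    ultimately have "\<bar>d t - 1 - 1 / real t\<bar> \<le> K / (real t)\<^sup>2 + 1 / (real t)\<^sup>2"
      using r by linarith
    then show ?thesis by (simp add: B_def add_divide_distrib)
  qed
  \<comment> \<open>Expanding \<open>1 - sg t ^ j\<close> in 1/t, \<open>S1\<close> becomes the
    coefficient of \<open>j\<close> and \<open>S\<close> that of the quadratic term.
    \<open>S\<close> has logarithmic order, and \<open>S1 n\<close> is \<open>v n - 1\<close> up to
    \<open>B * S n\<close>.\<close>
  define S where "S = (\<lambda>n. \<Sum>t=2..<n. v t / (real t)\<^sup>2)"
  define S1 where "S1 = (\<lambda>n. \<Sum>t=2..<n. v t / real t)"
  define s where "s = 2 * A * (\<Sum>t. 1 / (real t)\<^sup>2)"
  have sm: "summable (\<lambda>t. 1 / (real t)\<^sup>2)"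
    using inverse_power_summable[of 2, where ?'a = real] by (simp add: divide_inverse)
  have s: "0 \<le> s" using cA(2) by (auto simp: s_def intro!: mult_nonneg_nonneg suminf_nonneg sm)
  have S3: "(\<Sum>t=2..<n. v t / real t ^ 3) \<le> s" for n
  proof -
    have "(\<Sum>t=2..<n. v t / real t ^ 3) \<le> (\<Sum>t=2..<n. 2 * A * (1 / (real t)\<^sup>2))"
    proof (rule sum_mono)
      fix t assume "t \<in> {2..<n}"
      then have t: "2 \<le> t" by simp
      have "v t / real t ^ 3 \<le> 2 * A * real t / real t ^ 3"
        by (rule divide_right_mono[OF v_le[OF t]]) simp
      also have "\<dots> = 2 * A * (1 / (real t)\<^sup>2)" using t by (simp add: power2_eq_square power3_eq_cube)
      finally show "v t / real t ^ 3 \<le> 2 * A * (1 / (real t)\<^sup>2)" .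
    qed
    also have "\<dots> = 2 * A * (\<Sum>t=2..<n. 1 / (real t)\<^sup>2)" by (rule sum_distrib_left[symmetric])
    also have "\<dots> \<le> s"
      unfolding s_def using cA(2) by (intro mult_left_mono sum_le_suminf sm) auto
    finally show ?thesis .
  qed
  have S_nonneg: "0 \<le> S n" for n unfolding S_def using v_pos by (intro sum_nonneg divide_nonneg_nonneg) (auto intro: less_imp_le)
  have vS1: "\<bar>v n - 1 - S1 n\<bar> \<le> B * S n" if "2 \<le> n" for n
    using that
  proof (induction n rule: dec_induct)
    case base
    then show ?case by (simp add: v_2 S1_def S_def)
  next
    case (step n)
    have "v (Suc n) - 1 - S1 (Suc n) = (v n - 1 - S1 n) + v n * (d n - 1 - 1 / real n)"
      using step.hyps by (simp add: v_Suc S1_def sum.atLeastLessThan_Suc algebra_simps)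
    moreover have "\<bar>v n * (d n - 1 - 1 / real n)\<bar> \<le> v n * (B / (real n)\<^sup>2)"
      unfolding abs_mult using v_pos[OF step.hyps(1)] d_exp[OF step.hyps(1)]
      by (intro mult_mono) auto
    moreover have "B * S (Suc n) = B * S n + v n * (B / (real n)\<^sup>2)"
      using step.hyps by (simp add: S_def sum.atLeastLessThan_Suc algebra_simps)
    ultimately show ?case using step.IH by linarith
  qed
  define h where "h = (\<lambda>n j. \<Sum>t=2..<n. v t * (1 - sg t ^ j))"
  have h_expand: "h n j = real j * S1 n - (\<Sum>t=2..<n. v t * (sg t ^ j - 1 + real j / real t))" for n j
    by (simp add: h_def S1_def sum_distrib_left sum_subtractf[symmetric] algebra_simps)
  have \<phi>: "0 \<le> sg t ^ j - 1 + real j / real t"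
    "sg t ^ j - 1 + real j / real t \<le> (real j)\<^sup>2 * (1 / (real t)\<^sup>2)"
    "real j * (real j - 1) / 2 * (1 / (real t)\<^sup>2) - real j ^ 3 * (1 / real t ^ 3) \<le> sg t ^ j - 1 + real j / real t"
    if "2 \<le> t" for t j
    using power_expansion[of "1 / real t" j] bernoulli_sg[of t j] that by (auto simp: sg_def power_divide)
  have h_le: "h n j \<le> real j * S1 n" for n j
  proof -
    have "0 \<le> (\<Sum>t=2..<n. v t * (sg t ^ j - 1 + real j / real t))"
      by (rule sum_nonneg, rule mult_nonneg_nonneg[OF less_imp_le[OF v_pos] \<phi>(1)]) auto
    then show ?thesis unfolding h_expand by simp
  qed
  have h_ge: "real j * S1 n - (real j)\<^sup>2 * S n \<le> h n j" for n j
  proof -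
    have "(\<Sum>t=2..<n. v t * (sg t ^ j - 1 + real j / real t)) \<le> (\<Sum>t=2..<n. v t * ((real j)\<^sup>2 * (1 / (real t)\<^sup>2)))"
      using \<phi>(2) v_pos by (intro sum_mono mult_left_mono) (auto intro: less_imp_le)
    also have "\<dots> = (real j)\<^sup>2 * S n" by (simp add: S_def sum_distrib_left mult.commute)
    finally show ?thesis unfolding h_expand by simp
  qed
  have h_le2: "h n j \<le> real j * S1 n - real j * (real j - 1) / 2 * S n + real j ^ 3 * s" for n j
  proof -
    have "real j * (real j - 1) / 2 * S n - real j ^ 3 * s
       \<le> real j * (real j - 1) / 2 * S n - real j ^ 3 * (\<Sum>t=2..<n. v t / real t ^ 3)"
      using S3[of n] by (simp add: mult_left_mono)
    also have "\<dots> = (\<Sum>t=2..<n. v t * (real j * (real j - 1) / 2 * (1 / (real t)\<^sup>2) - real j ^ 3 * (1 / real t ^ 3)))"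
      by (simp add: S_def sum_distrib_left sum_subtractf[symmetric] right_diff_distrib mult.commute mult.left_commute)
    also have "\<dots> \<le> (\<Sum>t=2..<n. v t * (sg t ^ j - 1 + real j / real t))"
      using \<phi>(3) v_pos by (intro sum_mono mult_left_mono) (auto intro: less_imp_le)
    finally show ?thesis unfolding h_expand by simp
  qed
  have S_top: "filterlim S at_top sequentially"
  proof (rule filterlim_at_top_mono)
    have "filterlim (\<lambda>n. - 2 + harm n :: real) at_top sequentially"
      by (rule filterlim_tendsto_add_at_top[OF tendsto_const harm_at_top])
    from filterlim_tendsto_pos_mult_at_top[OF tendsto_const _ this, of "2 * c"]
    show "filterlim (\<lambda>n. 2 * c * (harm n - 2 :: real)) at_top sequentially"
      using cA(1) by simp
    show "eventually (\<lambda>n. 2 * c * (harm n - 2) \<le> S n) sequentially"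
      using eventually_ge_at_top[of 2]
    proof eventually_elim
      case (elim n)
      then show ?case
      proof (induction n rule: dec_induct)
        case base
        then show ?case using cA(1) by (simp add: S_def harm_expand)
      next
        case (step n)
        have "2 * c * (1 / real n) \<le> v n / (real n)\<^sup>2"
          using v_ge[OF step.hyps(1)] step.hyps by (simp add: field_simps power2_eq_square)
        moreover have "2 * c * (1 / real (Suc n)) \<le> 2 * c * (1 / real n)"
          using cA(1) step.hyps by (intro mult_left_mono divide_left_mono) auto
        moreover have "S (Suc n) = S n + v n / (real n)\<^sup>2"
          using step.hyps by (simp add: S_def sum.atLeastLessThan_Suc)
        moreover have "harm (Suc n) = harm n + 1 / real (Suc n)"
          by (simp add: harm_Suc divide_inverse)
        ultimately show ?case using step.IH by (simp add: algebra_simps)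
      qed
    qed
  qed
  have v_top: "filterlim v at_top sequentially"
  proof (rule filterlim_at_top_mono)
    show "filterlim (\<lambda>n. 2 * c * real n) at_top sequentially"
      by (rule filterlim_tendsto_pos_mult_at_top[OF tendsto_const _ filterlim_real_sequentially]) (use cA(1) in simp)
    show "eventually (\<lambda>n. 2 * c * real n \<le> v n) sequentially"
      using eventually_ge_at_top[of 2] by eventually_elim (rule v_ge)
  qed
  have Sv: "(\<lambda>n. S n / v n) \<longlonglongrightarrow> 0"
  proof (rule tendsto_sandwich[OF _ _ tendsto_const])
    show "eventually (\<lambda>n. 0 \<le> S n / v n) sequentially"
      using eventually_ge_at_top[of 2] by eventually_elim (intro divide_nonneg_pos S_nonneg v_pos)
    show "eventually (\<lambda>n. S n / v n \<le> (2 * A / c) * (1 / sqrt (real n))) sequentially"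
      using eventually_ge_at_top[of 2]
    proof eventually_elim
      case (elim n)
      \<comment> \<open>Any bound of lower order than \<open>v n\<close>, which grows linearly,
        suffices; the square root makes the induction short.\<close>
      have "S n \<le> 4 * A * sqrt (real n)"
        using elim
      proof (induction n rule: dec_induct)
        case base
        then show ?case using cA(2) by (simp add: S_def)
      next
        case (step n)
        have "v n / (real n)\<^sup>2 \<le> 2 * A / real n"
          using v_le[OF step.hyps(1)] step.hyps by (simp add: field_simps power2_eq_square)
        also have "\<dots> \<le> 4 * A * (sqrt (real (Suc n)) - sqrt (real n))"
        proof -
          let ?a = "sqrt (real (Suc n))" and ?b = "sqrt (real n)"
          have n: "2 \<le> n" using step.hyps by simp
          have sq: "?a * ?a = real n + 1" "?b * ?b = real n" by simp_all
          have "?a \<le> real n"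
            by (rule real_le_lsqrt) (use n in \<open>auto simp: power2_eq_square intro: order_trans[of _ "2 * real n"]\<close>)
          moreover have "?b \<le> ?a" by simp
          ultimately have "?a + ?b \<le> 2 * real n" by linarith
          moreover have "(?a - ?b) * (?a + ?b) = 1" using sq by (simp add: algebra_simps)
          moreover have "0 \<le> ?a - ?b" by simp
          ultimately have "1 \<le> (?a - ?b) * (2 * real n)" by (metis mult_left_mono)
          then have "2 * A / real n * 1 \<le> 2 * A / real n * ((?a - ?b) * (2 * real n))"
            using cA(2) by (intro mult_left_mono) auto
          also have "\<dots> = 4 * A * (?a - ?b)" using n by simp
          finally show ?thesis by simp
        qed
        finally show ?case using step.IH step.hyps by (simp add: S_def sum.atLeastLessThan_Suc algebra_simps)
      qed
      then have "S n / v n \<le> 4 * A * sqrt (real n) / (2 * c * real n)"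
        using v_ge[OF elim] cA elim v_pos[OF elim] by (intro frac_le) auto
      also have "\<dots> = (2 * A / c) * (1 / sqrt (real n))"
        using elim cA(1) by (simp add: field_simps)
      finally show ?case .
    qed
    show "(\<lambda>n. (2 * A / c) * (1 / sqrt (real n))) \<longlonglongrightarrow> 0"
      by (intro tendsto_mult_right_zero tendsto_divide_0[OF tendsto_const] filterlim_at_top_imp_at_infinity
        filterlim_compose[OF sqrt_at_top filterlim_real_sequentially])
  qed
  have hv: "(\<lambda>n. h n j / v n) \<longlonglongrightarrow> real j" for j
  proof (rule tendsto_sandwich[where h = "\<lambda>n. real j * (1 - 1 / v n + B * (S n / v n))"
        and f = "\<lambda>n. real j * (1 - 1 / v n - B * (S n / v n)) - (real j)\<^sup>2 * (S n / v n)"])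
    have v1: "(\<lambda>n. 1 / v n) \<longlonglongrightarrow> 0"
      by (intro tendsto_divide_0[OF tendsto_const] filterlim_at_top_imp_at_infinity v_top)
    have "(\<lambda>n. real j * (1 - 1 / v n + B * (S n / v n))) \<longlonglongrightarrow> real j * (1 - 0 + B * 0)"
      by (intro tendsto_intros v1 Sv)
    then show "(\<lambda>n. real j * (1 - 1 / v n + B * (S n / v n))) \<longlonglongrightarrow> real j" by simp
    have "(\<lambda>n. real j * (1 - 1 / v n - B * (S n / v n)) - (real j)\<^sup>2 * (S n / v n)) \<longlonglongrightarrow> real j * (1 - 0 - B * 0) - (real j)\<^sup>2 * 0"
      by (intro tendsto_intros v1 Sv)
    then show "(\<lambda>n. real j * (1 - 1 / v n - B * (S n / v n)) - (real j)\<^sup>2 * (S n / v n)) \<longlonglongrightarrow> real j" by simp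
    show "eventually (\<lambda>n. h n j / v n \<le> real j * (1 - 1 / v n + B * (S n / v n))) sequentially"
      using eventually_ge_at_top[of 2]
    proof eventually_elim
      case (elim n)
      have "h n j \<le> real j * (v n - 1 + B * S n)"
        using vS1[OF elim] h_le[of n j] by (intro order_trans[OF h_le] mult_left_mono) auto
      then have "h n j / v n \<le> real j * (v n - 1 + B * S n) / v n"
        using v_pos[OF elim] by (intro divide_right_mono) auto
      also have "\<dots> = real j * (1 - 1 / v n + B * (S n / v n))"
        using v_pos[OF elim] by (simp add: field_simps)
      finally show ?case .
    qed
    show "eventually (\<lambda>n. real j * (1 - 1 / v n - B * (S n / v n)) - (real j)\<^sup>2 * (S n / v n) \<le> h n j / v n) sequentially"
      using eventually_ge_at_top[of 2]
    proof eventually_elim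
      case (elim n)
      have "real j * (1 - 1 / v n - B * (S n / v n)) - (real j)\<^sup>2 * (S n / v n)
          = (real j * (v n - 1 - B * S n) - (real j)\<^sup>2 * S n) / v n"
        using v_pos[OF elim] by (simp add: field_simps)
      also have "\<dots> \<le> h n j / v n"
      proof (rule divide_right_mono)
        have "real j * (v n - 1 - B * S n) \<le> real j * S1 n"
          using vS1[OF elim] by (intro mult_left_mono) auto
        then show "real j * (v n - 1 - B * S n) - (real j)\<^sup>2 * S n \<le> h n j"
          using h_ge[of j n] by linarith
      qed (use v_pos[OF elim] in simp)
      finally show ?case .
    qed
  qed
  have stopped_h: "stopped ps (h n) (j + 1) = h n j + sg 2 ^ j - v n * sg n ^ j"
    if j: "length ps \<le> j + 1" and n: "2 \<le> n" for n j
  proof -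
    have h_eq: "h n z = (\<Sum>t=2..<n. v t) - (\<Sum>t=2..<n. v t * sg t ^ z)" for z
      by (simp add: h_def algebra_simps sum_subtractf)
    have tele: "(\<Sum>t=2..<n. v (Suc t) * sg (Suc t) ^ j) = (\<Sum>t=2..<n. v t * sg t ^ j) - v 2 * sg 2 ^ j + v n * sg n ^ j"
      using n by (induction n rule: dec_induct) (simp_all add: sum.atLeastLessThan_Suc)
    have "stopped ps (h n) (j + 1) = (\<Sum>t=2..<n. v t) - stopped ps (\<lambda>z. \<Sum>t=2..<n. v t * sg t ^ z) (j + 1)"
      unfolding h_eq[abs_def] by (subst stopped_diff[OF _ bounded_sum_sg]) auto
    also have "stopped ps (\<lambda>z. \<Sum>t=2..<n. v t * sg t ^ z) (j + 1) = (\<Sum>t=2..<n. v t * cof ps t * sg (Suc t) ^ (j + 1))"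
      by (rule stopped_sum_gen[OF j]) auto
    also have "\<dots> = (\<Sum>t=2..<n. v (Suc t) * sg (Suc t) ^ j)"
      by (rule sum.cong) (auto simp: v_Suc d_def)
    finally show ?thesis unfolding tele v_2 mult_1_left using h_eq[of j] by linarith
  qed
  have hb: "bounded (range (h n))" for n
  proof (rule boundedI)
    fix x assume "x \<in> range (h n)"
    then obtain z where x: "x = h n z" by blast
    have "norm x \<le> (\<Sum>t=2..<n. norm (v t * (1 - sg t ^ z)))" unfolding x h_def by (rule norm_sum)
    also have "\<dots> \<le> (\<Sum>t=2..<n. \<bar>v t\<bar>)"
      using sg_pow_unit[of _ z] by (intro sum_mono) (auto simp: abs_mult intro!: mult_left_le)
    finally show "norm x \<le> (\<Sum>t=2..<n. \<bar>v t\<bar>)" .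
  qed
  show thesis
  proof (rule that[OF B])
    fix J :: nat and D :: real assume D: "0 < D"
    \<comment> \<open>Three demands on \<open>L\<close>: a normalisation of at least 1, a cubic
      error of at most 1 after division by \<open>S L\<close> for states up to \<open>J\<close>, and
      a drift loss \<open>(2 * A + 1) * j / S L\<close> of at most \<open>j / D\<close>.\<close>
    have "eventually (\<lambda>L. max 1 (max (real J ^ 3 * s) ((2 * A + 1) * D)) \<le> S L) sequentially"
      using S_top unfolding filterlim_at_top by blast
    moreover have "eventually (\<lambda>L. 2 \<le> L) sequentially" by (rule eventually_ge_at_top)
    ultimately have "eventually (\<lambda>L. max 1 (max (real J ^ 3 * s) ((2 * A + 1) * D)) \<le> S L \<and> 2 \<le> L) sequentially"
      by eventually_elim simp
    then obtain L where L: "1 \<le> S L" "real J ^ 3 * s \<le> S L" "(2 * A + 1) * D \<le> S L" "2 \<le> L"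
      by (auto simp: eventually_sequentially)
    define q where "q = v L / S L"
    have q: "0 < q" using v_pos[OF L(4)] L(1) by (simp add: q_def)
    have "eventually (\<lambda>T. \<forall>j\<in>{..J}. \<bar>h T j / v T - real j\<bar> < 1 / q) sequentially"
    proof (rule eventually_ball_finite)
      show "\<forall>j\<in>{..J}. eventually (\<lambda>T. \<bar>h T j / v T - real j\<bar> < 1 / q) sequentially"
        using tendstoD[OF hv, of "1 / q"] q by (auto simp: dist_real_def)
    qed simp
    then obtain n0 where n0: "\<And>T. n0 \<le> T \<Longrightarrow> \<forall>j\<in>{..J}. \<bar>h T j / v T - real j\<bar> < 1 / q"
      unfolding eventually_sequentially by blast
    define T where "T = max n0 L"
    have T: "\<bar>h T j / v T - real j\<bar> < 1 / q" if "j \<le> J" for j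
      using n0[of T] that by (auto simp: T_def)
    have "L \<le> T" by (simp add: T_def)
    then have T2: "2 \<le> T" using L(4) by simp
    \<comment> \<open>Each \<open>h n / v n\<close> is a bounded approximation of the identity and
      changes by about -1 per step of the chain. In the difference these changes cancel, and the
      scale \<open>v L / S L\<close> turns what is left into a quadratic of order 1.\<close>
    define k where "k = (\<lambda>j. q * (1 / v T * h T j - 1 / v L * h L j))"
    have kb: "bounded (range k)"
      unfolding k_def by (intro bounded_scale bounded_minus_comp hb)
    have k_eq: "k j = q * (h T j / v T - real j) + (real j * v L - h L j) / S L" for j
      using v_pos[OF L(4)] L(1) by (simp add: k_def q_def field_simps)
    have near: "\<bar>q * (h T j / v T - real j)\<bar> \<le> 1" if "j \<le> J" for j
    proof -
      have "q * \<bar>h T j / v T - real j\<bar> \<le> q * (1 / q)"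
        using T[OF that] q by (intro mult_left_mono) auto
      then show ?thesis unfolding abs_mult using q by simp
    qed
    have drift_k: "k j - real j / D \<le> stopped ps k (j + 1)" if j: "1 \<le> j" "length ps \<le> j + 1" for j
    proof -
      have "stopped ps k (j + 1) = q * (1 / v T * stopped ps (h T) (j + 1) - 1 / v L * stopped ps (h L) (j + 1))"
        unfolding k_def stopped_scale
        by (subst stopped_diff[OF bounded_scale[OF hb] bounded_scale[OF hb]]) (simp only: stopped_scale)
      also have "\<dots> = k j + q * (sg L ^ j - sg T ^ j + sg 2 ^ j / v T - sg 2 ^ j / v L)"
        unfolding stopped_h[OF j(2) T2] stopped_h[OF j(2) L(4)] k_def
        using v_pos[OF T2] v_pos[OF L(4)] by (simp add: field_simps)
      finally have eq: "stopped ps k (j + 1) = k j + q * (sg L ^ j - sg T ^ j + sg 2 ^ j / v T - sg 2 ^ j / v L)" .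
      have "- (real j / real L) - real j / v L \<le> sg L ^ j - sg T ^ j + sg 2 ^ j / v T - sg 2 ^ j / v L"
      proof -
        have "1 - sg L ^ j \<le> real j / real L" using bernoulli_sg[of L j] L(4) by simp
        moreover have "sg T ^ j \<le> 1" using sg_pow_unit[of T j] T2 by simp
        moreover have "0 \<le> sg 2 ^ j / v T" using v_pos[OF T2] sg_unit[of 2] by (simp add: less_imp_le)
        moreover have "sg 2 ^ j / v L \<le> real j / v L"
          using sg_pow_unit[of 2 j] j(1) v_pos[OF L(4)] by (intro divide_right_mono) auto
        ultimately show ?thesis by linarith
      qed
      from mult_left_mono[OF this less_imp_le[OF q]]
      have "q * (- (real j / real L) - real j / v L) \<le> stopped ps k (j + 1) - k j"
        using eq by linarith
      moreover have "q * (real j / real L + real j / v L) \<le> real j / D"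
      proof -
        have "q * (real j / real L + real j / v L) = real j * (v L / real L + 1) / S L"
          using v_pos[OF L(4)] L(1,4) by (simp add: q_def field_simps)
        also have "\<dots> \<le> real j * (2 * A + 1) / S L"
          using v_le[OF L(4)] L(1,4) by (intro divide_right_mono mult_left_mono) (auto simp: field_simps)
        also have "\<dots> \<le> real j / D"
        proof -
          have "(2 * A + 1) / S L \<le> 1 / D" using L(1,3) D by (simp add: field_simps)
          from mult_left_mono[OF this, of "real j"] show ?thesis by simp
        qed
        finally show ?thesis .
      qed
      ultimately show ?thesis by (simp add: algebra_simps)
    qed
    have upper: "k j \<le> real j * (1 + B) + (real j)\<^sup>2 + 1" if "j \<le> J" for j
    proof -
      have "real j * v L - h L j \<le> real j * (1 + B * S L) + (real j)\<^sup>2 * S L"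
      proof -
        have "real j * (v L - S1 L) \<le> real j * (1 + B * S L)"
          using vS1[OF L(4)] by (intro mult_left_mono) auto
        then show ?thesis using h_ge[of j L] by (simp add: algebra_simps)
      qed
      also have "\<dots> \<le> (real j * (1 + B) + (real j)\<^sup>2) * S L"
        using L(1) mult_left_mono[OF L(1), of "real j"] by (simp add: algebra_simps)
      finally have "(real j * v L - h L j) / S L \<le> real j * (1 + B) + (real j)\<^sup>2"
        using L(1) by (simp add: divide_le_eq)
      then show ?thesis using near[OF that] unfolding k_eq by linarith
    qed
    have lower: "real j * (real j - 1) / 2 - real j * B - 2 \<le> k j" if "j \<le> J" for j
    proof -
      have "real j * (real j - 1) / 2 * S L - real j * (B * S L) - real j ^ 3 * s \<le> real j * v L - h L j"
      proof -
        have "real j * (- (B * S L)) \<le> real j * (v L - S1 L)"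
          using vS1[OF L(4)] by (intro mult_left_mono) auto
        then show ?thesis using h_le2[of L j] by (simp add: algebra_simps)
      qed
      moreover have "real j ^ 3 * s \<le> S L"
        using mult_right_mono[OF power_mono[of "real j" "real J" 3] s] that L(2) by simp
      ultimately have "(real j * (real j - 1) / 2 - real j * B - 1) * S L \<le> real j * v L - h L j"
        by (simp add: algebra_simps)
      then have "real j * (real j - 1) / 2 - real j * B - 1 \<le> (real j * v L - h L j) / S L"
        using L(1) by (simp add: le_divide_eq)
      then show ?thesis using near[OF that] unfolding k_eq by linarith
    qed
    show "\<exists>k::nat \<Rightarrow> real. bounded (range k)
      \<and> (\<forall>j\<ge>1. length ps \<le> j + 1 \<longrightarrow> k j - real j / D \<le> stopped ps k (j + 1))
      \<and> (\<forall>j\<le>J. k j \<le> real j * (1 + B) + (real j)\<^sup>2 + 1)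
      \<and> (\<forall>j\<le>J. real j * (real j - 1) / 2 - real j * B - 2 \<le> k j)"
      using kb drift_k upper lower by blast
  qed
qed

text \<open>Truncating the test function from below makes it constant near \<open>0\<close>; there it gains drift because the
  process jumps to a high level with positive probability.\<close>

lemma critical_lyapunov:
  assumes ps: "set ps \<subseteq> {0<..1}" and drift: "drift ps = 2" and C: "0 < C"
  obtains \<Psi> :: "nat \<Rightarrow> real" where "bounded (range \<Psi>)"
    "\<And>j. \<Psi> j + C - real j \<le> stopped ps \<Psi> (j + 1)"
proof -
  have ps': "set ps \<subseteq> {0..1}" using ps by auto
  obtain B where B: "0 \<le> B" and test: "\<And>J D. 0 < D \<Longrightarrow> \<exists>k::nat \<Rightarrow> real. bounded (range k)
    \<and> (\<forall>j\<ge>1. length ps \<le> j + 1 \<longrightarrow> k j - real j / D \<le> stopped ps k (j + 1))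
    \<and> (\<forall>j\<le>J. k j \<le> real j * (1 + B) + (real j)\<^sup>2 + 1)
    \<and> (\<forall>j\<le>J. real j * (real j - 1) / 2 - real j * B - 2 \<le> k j)"
    using critical_test_function[OF ps drift] by metis
  \<comment> \<open>Order of the choices: \<open>m\<close> depends on \<open>C\<close>;
    \<open>\<kappa>\<close> bounds the test function at states up to \<open>m\<close>;
    \<open>J\<close> is a level where it exceeds \<open>\<kappa>\<close> by 1;
    \<open>\<epsilon>\<close> is the least chance of a jump to \<open>J\<close> from below
    \<open>m\<close>; only then is \<open>D = m / \<epsilon>\<close> chosen. This works because the
    constant \<open>B\<close> is independent of \<open>J\<close> and \<open>D\<close>.\<close>
  define m where "m = max (max (length ps) 1) (nat \<lceil>2 * C\<rceil>)"
  have m: "length ps \<le> m" "1 \<le> m" "2 * C \<le> real m"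
    unfolding m_def by (auto simp: max_def) linarith+
  define \<kappa> where "\<kappa> = real m * (1 + B) + (real m)\<^sup>2 + 1"
  define J where "J = max m (max (nat \<lceil>\<kappa> + 3\<rceil>) (nat \<lceil>2 * B + 3\<rceil>))"
  have J: "m \<le> J" "\<kappa> + 3 \<le> real J" "2 * B + 3 \<le> real J"
    unfolding J_def by linarith+
  have J_quad: "\<kappa> + 1 \<le> real J * (real J - 1) / 2 - real J * B - 2"
  proof -
    have "(2 * B + 2) / 2 \<le> (real J - 1) / 2"
      by (rule divide_right_mono) (use J(3) in simp_all)
    moreover have "(2 * B + 2) / 2 = B + 1" by simp
    ultimately have "1 \<le> (real J - 1) / 2 - B" by linarith
    then have "real J * 1 \<le> real J * ((real J - 1) / 2 - B)"
      by (rule mult_left_mono) simp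
    then show ?thesis using J(2) by (simp add: algebra_simps)
  qed
  define \<epsilon> where "\<epsilon> = Min ((\<lambda>j. stopped ps (\<lambda>z. of_bool (z = J)) (Suc j)) ` {..<m})"
  have ne: "(\<lambda>j. stopped ps (\<lambda>z. of_bool (z = J)) (Suc j)) ` {..<m} \<noteq> {}" using m(2) by (simp add: lessThan_empty_iff)
  have \<epsilon>: "0 < \<epsilon>"
    unfolding \<epsilon>_def using stopped_point_pos[OF ps, of J] m(1) J(1) ne by (subst Min_gr_iff) auto
  have \<epsilon>_le: "\<epsilon> \<le> stopped ps (\<lambda>z. of_bool (z = J)) (Suc j)" if "j < m" for j
    unfolding \<epsilon>_def using that by (intro Min_le) auto
  have "0 < real m / \<epsilon>" using m(2) \<epsilon> by simp
  then obtain k :: "nat \<Rightarrow> real" where k: "bounded (range k)"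
    "\<And>j. 1 \<le> j \<Longrightarrow> length ps \<le> j + 1 \<Longrightarrow> k j - real j / (real m / \<epsilon>) \<le> stopped ps k (j + 1)"
    "\<And>j. j \<le> J \<Longrightarrow> k j \<le> real j * (1 + B) + (real j)\<^sup>2 + 1"
    "real J * (real J - 1) / 2 - real J * B - 2 \<le> k J"
    using test[of "real m / \<epsilon>" J] by blast
  define k' where "k' = (\<lambda>j. max (k j) \<kappa>)"
  have k'b: "bounded (range k')"
  proof -
    obtain b where b: "\<And>j. \<bar>k j\<bar> \<le> b" using k(1) by (auto simp: bounded_iff)
    show ?thesis
    proof (rule boundedI)
      fix x assume "x \<in> range k'"
      then obtain j where "x = max (k j) \<kappa>" by (auto simp: k'_def)
      then show "norm x \<le> max b \<bar>\<kappa>\<bar>" using b[of j] by (auto simp: max_def)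
    qed
  qed
  have k'_drift: "k' j + \<epsilon> * of_bool (j < m) - \<epsilon> / real m * real j \<le> stopped ps k' (j + 1)" for j
  proof (cases "k j \<le> \<kappa>")
    case True
    have "stopped ps (\<lambda>z. \<kappa> + of_bool (z = J)) (Suc j) \<le> stopped ps k' (Suc j)"
    proof (rule stopped_mono[OF ps' _ k'b])
      show "bounded (range (\<lambda>z. \<kappa> + of_bool (z = J)))"
        by (rule boundedI[where B = "\<bar>\<kappa>\<bar> + 1"]) auto
      show "\<kappa> + of_bool (z = J) \<le> k' z" for z
        using k(4) J_quad by (auto simp: k'_def)
    qed
    moreover have "stopped ps (\<lambda>z. \<kappa> + of_bool (z = J)) (Suc j)
        = \<kappa> + stopped ps (\<lambda>z. of_bool (z = J)) (Suc j)"
      by (subst stopped_add) (auto intro: bounded_unit)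
    moreover have "\<epsilon> * of_bool (j < m) \<le> stopped ps (\<lambda>z. of_bool (z = J)) (Suc j)"
      using \<epsilon>_le[of j] stopped_bounds(1)[OF ps', of 0 "\<lambda>z. of_bool (z = J)" 1 "Suc j"] by auto
    moreover have "0 \<le> \<epsilon> / real m * real j" using \<epsilon> by simp
    ultimately show ?thesis using True by (simp add: k'_def)
  next
    case False
    have jm: "m \<le> j"
    proof (rule ccontr)
      assume "\<not> m \<le> j"
      then have j: "j \<le> m" "j \<le> J" using J(1) by auto
      have "k j \<le> real j * (1 + B) + (real j)\<^sup>2 + 1" by (rule k(3)[OF j(2)])
      also have "\<dots> \<le> \<kappa>"
        unfolding \<kappa>_def using j(1) B by (intro add_mono mult_right_mono power_mono) auto
      finally show False using False by simp
    qed
    have "stopped ps k (j + 1) \<le> stopped ps k' (j + 1)"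
      by (rule stopped_mono[OF ps' k(1) k'b]) (simp add: k'_def)
    moreover have "k j - \<epsilon> / real m * real j \<le> stopped ps k (j + 1)"
    proof -
      have e: "real j / (real m / \<epsilon>) = \<epsilon> / real m * real j" by simp
      have "1 \<le> j" "length ps \<le> j + 1" using jm m(1,2) by auto
      from k(2)[OF this, unfolded e] show ?thesis .
    qed
    moreover have "k' j = k j" "\<epsilon> * of_bool (j < m) = 0" using False jm by (auto simp: k'_def)
    ultimately show ?thesis by linarith
  qed
  \<comment> \<open>The loss \<open>2 * \<epsilon> / m\<close> per unit of \<open>j\<close> becomes
    1, and the gain \<open>\<epsilon>\<close> becomes \<open>m / 2\<close>, which is at least
    \<open>C\<close>.\<close>
  define \<mu> where "\<mu> = real m / (2 * \<epsilon>)"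
  have \<mu>: "0 < \<mu>" using m(2) \<epsilon> by (simp add: \<mu>_def)
  show thesis
  proof (rule that)
    show "bounded (range (\<lambda>z. \<mu> * k' z))" by (rule bounded_scale[OF k'b])
    show "\<mu> * k' j + C - real j \<le> stopped ps (\<lambda>z. \<mu> * k' z) (j + 1)" for j
    proof -
      have "\<epsilon> - \<epsilon> / real m * real j \<le> \<epsilon> * of_bool (j < m)"
        using \<epsilon> m(2) by (cases "j < m") (auto simp: field_simps)
      then have "k' j + \<epsilon> - 2 * (\<epsilon> / real m * real j) \<le> stopped ps k' (j + 1)"
        using k'_drift[of j] by linarith
      from mult_left_mono[OF this less_imp_le[OF \<mu>]]
      have "\<mu> * k' j + \<mu> * \<epsilon> - \<mu> * (2 * (\<epsilon> / real m * real j)) \<le> stopped ps (\<lambda>z. \<mu> * k' z) (j + 1)"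
        by (simp only: stopped_scale) (simp add: algebra_simps)
      moreover have "\<mu> * \<epsilon> = real m / 2" "\<mu> * (2 * (\<epsilon> / real m * real j)) = real j"
        using \<epsilon> m(2) by (simp_all add: \<mu>_def)
      ultimately show ?thesis using m(3) by linarith
    qed
  qed
qed

section \<open>Laplace transform of the total progeny\<close>

lemma discount_weights:
  assumes "set ps \<subseteq> {0..1}" "0 \<le> \<theta>"
  shows "chain_weights ps (\<lambda>z. exp (- \<theta> * real z)) (\<lambda>_. 1)"
proof
  show "antimono (\<lambda>z. exp (- \<theta> * real z))"
    by (rule antimonoI) (use assms(2) in \<open>simp add: mult_left_mono\<close>)
qed (use assms in \<open>auto simp: antimono_def\<close>)

abbreviation discounted :: "real list \<Rightarrow> real \<Rightarrow> nat \<Rightarrow> (int \<Rightarrow> bool list) \<Rightarrow> int \<Rightarrow> nat \<Rightarrow> real" where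
  "discounted ps \<theta> \<equiv> chain ps (\<lambda>z. exp (- \<theta> * real z)) 1 (\<lambda>_. 1)"

text \<open>Exponentiating the Lyapunov function makes its drift multiplicative. In the induction
  the discount \<open>exp (- \<theta> * z)\<close> cancels the factor
  \<open>exp (\<theta> * z)\<close>, and \<open>exp (- \<theta> * C)\<close> remains per site. As
  \<open>C\<close> is arbitrary, the total progeny exceeds every multiple of \<open>N\<close> up to
  exponentially small probability.\<close>

lemma discounted_decay:
  assumes ps: "set ps \<subseteq> {0<..1}" and drift: "drift ps = 2" and C: "0 < C"
  obtains \<theta> a where "0 < \<theta>" "0 < a" "\<And>N. discounted ps \<theta> N (\<lambda>_. []) y 0 \<le> a * exp (- \<theta> * C * real N)"
proof -
  have ps': "set ps \<subseteq> {0..1}" using ps by auto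
  \<comment> \<open>The extra unit of drift pays for the quadratic term in
    \<open>exp u \<le> 1 + u + u\<^sup>2\<close>.\<close>
  have "0 < C + 1" using C by simp
  from critical_lyapunov[OF ps drift this]
  obtain \<Psi> :: "nat \<Rightarrow> real" where \<Psi>: "bounded (range \<Psi>)"
    "\<And>j. \<Psi> j + (C + 1) - real j \<le> stopped ps \<Psi> (j + 1)" by blast
  obtain b where b: "\<And>j. \<bar>\<Psi> j\<bar> \<le> b" using \<Psi>(1) by (auto simp: bounded_iff)
  have b0: "0 \<le> b" using b[of 0] by simp
  \<comment> \<open>Small enough that \<open>u = - \<theta> * (\<Psi> z - \<Psi> j)\<close>
    satisfies both \<open>\<bar>u\<bar> \<le> 1\<close> and
    \<open>u\<^sup>2 \<le> \<theta>\<close>.\<close>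
  define \<theta> where "\<theta> = 1 / (4 * (b + 1)\<^sup>2)"
  have \<theta>: "0 < \<theta>" using b0 by (simp add: \<theta>_def)
  have \<theta>b: "2 * \<theta> * b \<le> 1" "4 * \<theta>\<^sup>2 * b\<^sup>2 \<le> \<theta>"
  proof -
    have "\<theta> * (4 * (b + 1)\<^sup>2) = 1" using b0 by (simp add: \<theta>_def)
    moreover have "2 * b \<le> 4 * (b + 1)\<^sup>2" "4 * b\<^sup>2 \<le> 4 * (b + 1)\<^sup>2"
      using b0 by (auto simp: power2_eq_square algebra_simps)
    ultimately have 1: "\<theta> * (2 * b) \<le> 1" "\<theta> * (4 * b\<^sup>2) \<le> 1"
      using \<theta> by (metis mult_left_mono less_imp_le)+
    show "2 * \<theta> * b \<le> 1" using 1(1) by (simp add: algebra_simps)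
    have "\<theta> * (\<theta> * (4 * b\<^sup>2)) \<le> \<theta> * 1" using 1(2) \<theta> by (intro mult_left_mono) auto
    then show "4 * \<theta>\<^sup>2 * b\<^sup>2 \<le> \<theta>" by (simp add: power2_eq_square algebra_simps)
  qed
  interpret chain_weights ps "\<lambda>z. exp (- \<theta> * real z)" 1 "\<lambda>_. 1"
    by (rule discount_weights[OF ps' less_imp_le[OF \<theta>]])
  define \<Phi> where "\<Phi> = (\<lambda>j. exp (- \<theta> * \<Psi> j))"
  have \<Phi>_bounds: "exp (- \<theta> * b) \<le> \<Phi> j" "\<Phi> j \<le> exp (\<theta> * b)" for j
    using b[of j] \<theta> by (auto simp: \<Phi>_def abs_le_iff) (metis mult_left_mono less_imp_le minus_le_iff mult_minus_right)
  have \<Phi>b: "bounded (range \<Phi>)"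
    by (rule boundedI[where B = "exp (\<theta> * b)"]) (use \<Phi>_bounds(2) in \<open>auto simp: \<Phi>_def\<close>)
  have step: "stopped ps \<Phi> (j + 1) \<le> exp (- \<theta> * C) * (exp (\<theta> * real j) * \<Phi> j)" for j
  proof -
    have pt: "\<Phi> z \<le> \<Phi> j * (1 + \<theta> + \<theta> * \<Psi> j) + - (\<Phi> j * \<theta>) * \<Psi> z" for z
    proof -
      define u where "u = - \<theta> * (\<Psi> z - \<Psi> j)"
      have "\<bar>\<Psi> z - \<Psi> j\<bar> \<le> 2 * b" using b[of z] b[of j] by linarith
      then have "\<bar>u\<bar> \<le> \<theta> * (2 * b)" using \<theta> by (simp add: u_def abs_mult mult_left_mono)
      then have u: "\<bar>u\<bar> \<le> 1" "u\<^sup>2 \<le> \<theta>"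
      proof -
        assume *: "\<bar>u\<bar> \<le> \<theta> * (2 * b)"
        then show "\<bar>u\<bar> \<le> 1" using \<theta>b(1) by (simp add: algebra_simps)
        have "u\<^sup>2 \<le> (\<theta> * (2 * b))\<^sup>2" using * by (simp add: abs_le_square_iff[symmetric])
        then show "u\<^sup>2 \<le> \<theta>" using \<theta>b(2) by (simp add: power2_eq_square algebra_simps)
      qed
      have "exp u \<le> 1 + u + u\<^sup>2"
      proof (cases "0 \<le> u")
        case True
        then show ?thesis using u(1) by (intro exp_bound) auto
      next
        case False
        have "exp u * (1 - u) \<le> exp u * exp (- u)"
          using exp_ge_add_one_self[of "- u"] by (intro mult_left_mono) auto
        then have "exp u * (1 - u) \<le> 1" by (simp flip: exp_add)
        moreover have "1 \<le> (1 + u + u\<^sup>2) * (1 - u)"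
        proof -
          have "(1 + u + u\<^sup>2) * (1 - u) = 1 - u ^ 3" by (simp add: power2_eq_square power3_eq_cube algebra_simps)
          moreover have "u ^ 3 \<le> 0" using False by simp
          ultimately show ?thesis by simp
        qed
        ultimately have "exp u * (1 - u) \<le> (1 + u + u\<^sup>2) * (1 - u)" by linarith
        then show ?thesis using False by (simp add: mult_le_cancel_right)
      qed
      then have "exp u \<le> 1 + u + \<theta>" using u(2) by linarith
      then have "\<Phi> j * exp u \<le> \<Phi> j * (1 + u + \<theta>)" by (simp add: \<Phi>_def)
      moreover have "\<Phi> j * exp u = \<Phi> z" by (simp add: \<Phi>_def u_def algebra_simps flip: exp_add)
      ultimately show ?thesis by (simp add: u_def algebra_simps)
    qed
    have cb: "bounded (range (\<lambda>z::nat. c::real))" for c by simp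
    have "stopped ps \<Phi> (j + 1) \<le> stopped ps (\<lambda>z. \<Phi> j * (1 + \<theta> + \<theta> * \<Psi> j) + - (\<Phi> j * \<theta>) * \<Psi> z) (j + 1)"
      by (rule stopped_mono[OF ps' \<Phi>b bounded_plus_comp[OF cb bounded_scale[OF \<Psi>(1)]] pt])
    also have "\<dots> = \<Phi> j * (1 + \<theta> + \<theta> * \<Psi> j) + - (\<Phi> j * \<theta>) * stopped ps \<Psi> (j + 1)"
      by (subst stopped_add[OF cb bounded_scale[OF \<Psi>(1)]]) (simp only: stopped_scale stopped_const)
    also have "\<dots> \<le> \<Phi> j * (1 + \<theta> + \<theta> * \<Psi> j) + - (\<Phi> j * \<theta>) * (\<Psi> j + (C + 1) - real j)"
      using \<Psi>(2)[of j] \<theta> by (simp add: \<Phi>_def mult_left_mono)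
    also have "\<dots> = \<Phi> j * (1 + \<theta> * (real j - C))" by (simp add: algebra_simps)
    also have "\<dots> \<le> \<Phi> j * exp (\<theta> * (real j - C))"
      by (rule mult_left_mono[OF exp_ge_add_one_self]) (simp add: \<Phi>_def)
    also have "\<dots> = exp (- \<theta> * C) * (exp (\<theta> * real j) * \<Phi> j)"
      by (simp add: algebra_simps flip: exp_add)
    finally show ?thesis .
  qed
  define a where "a = exp (\<theta> * b)"
  have bound: "G N (\<lambda>_. []) y j \<le> a * exp (- \<theta> * C) ^ N * (exp (\<theta> * real j) * \<Phi> j)" for N j
  proof (induction N arbitrary: j)
    case 0
    have "1 = exp (\<theta> * b) * exp (- \<theta> * b)" by (simp flip: exp_add)
    also have "\<dots> \<le> exp (\<theta> * b) * (exp (\<theta> * real j) * \<Phi> j)"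
    proof (rule mult_left_mono)
      have "1 * exp (- \<theta> * b) \<le> exp (\<theta> * real j) * \<Phi> j"
        using \<Phi>_bounds(1)[of j] \<theta> by (intro mult_mono) auto
      then show "exp (- \<theta> * b) \<le> exp (\<theta> * real j) * \<Phi> j" by simp
    qed simp
    finally show ?case by (simp add: a_def)
  next
    case (Suc N)
    let ?c = "a * exp (- \<theta> * C) ^ N"
    have "G (Suc N) (\<lambda>_. []) y j = stopped ps (\<lambda>z. exp (- \<theta> * real z) * G N (\<lambda>_. []) y z) (j + 1)"
      by (rule chain_empty_Suc)
    also have "\<dots> \<le> stopped ps (\<lambda>z. ?c * \<Phi> z) (j + 1)"
    proof (rule stopped_mono[OF ps' weighted_chain(3) bounded_scale[OF \<Phi>b]])
      fix z
      have "exp (- \<theta> * real z) * G N (\<lambda>_. []) y z \<le> exp (- \<theta> * real z) * (?c * (exp (\<theta> * real z) * \<Phi> z))"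
        by (rule mult_left_mono[OF Suc.IH]) simp
      also have "\<dots> = (exp (- \<theta> * real z) * exp (\<theta> * real z)) * (?c * \<Phi> z)" by (simp only: mult_ac)
      also have "exp (- \<theta> * real z) * exp (\<theta> * real z) = 1" by (simp flip: exp_add)
      finally show "exp (- \<theta> * real z) * G N (\<lambda>_. []) y z \<le> ?c * \<Phi> z" by simp
    qed
    also have "\<dots> = ?c * stopped ps \<Phi> (j + 1)" by (rule stopped_scale)
    also have "\<dots> \<le> ?c * (exp (- \<theta> * C) * (exp (\<theta> * real j) * \<Phi> j))"
      by (rule mult_left_mono[OF step]) (simp add: a_def)
    finally show ?case by (simp add: algebra_simps)
  qed
  show thesis
  proof (rule that[OF \<theta>])
    show "0 < a * a" by (simp add: a_def)
    show "discounted ps \<theta> N (\<lambda>_. []) y 0 \<le> a * a * exp (- \<theta> * C * real N)" for N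
    proof -
      have "a * exp (- \<theta> * C) ^ N * (exp (\<theta> * real 0) * \<Phi> 0) \<le> a * exp (- \<theta> * C) ^ N * a"
        using \<Phi>_bounds(2)[of 0] by (intro mult_left_mono) (auto simp: a_def)
      moreover have "exp (- \<theta> * C) ^ N = exp (- \<theta> * C * real N)"
        by (simp add: exp_of_nat_mult[symmetric] mult_ac)
      ultimately show ?thesis using bound[of N 0] by (simp add: mult_ac)
    qed
  qed
qed

section \<open>Second moments when the drift exceeds 2\<close>

text \<open>Second moments are only used through quadratic minorants of bounded functions, so that no
  integrability is needed.\<close>

lemma nb_quadratic:
  assumes a: "0 \<le> a1" "0 \<le> a2" and H: "\<And>z. \<bar>H z\<bar> \<le> B"
    and q: "\<And>z. a0 - a1 * real (z + n) - a2 * (real (z + n))\<^sup>2 \<le> H z"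
  shows "a0 - a1 * real (n + j) - a2 * ((real (n + j))\<^sup>2 + 2 * real j) \<le> nb H j"
  using H q
proof (induction j arbitrary: n H)
  case 0
  then show ?case using "0.prems"(2)[of 0] by simp
next
  case (Suc j)
  let ?P = "\<lambda>n j. a0 - a1 * real (n + j) - a2 * ((real (n + j))\<^sup>2 + 2 * real j)"
  note outer_IH = Suc.IH
  have B: "0 \<le> B" using Suc.prems(1)[of 0] by simp
  have P: "?P n (Suc j) = (?P (Suc n) (Suc j) + ?P n j) / 2" for n
    by (simp add: power2_eq_square field_simps)
  \<comment> \<open>\<open>?P\<close> obeys the same averaging identity as \<open>nb\<close>, and
    the term with one \<open>False\<close> less is covered by the outer induction. So each unfolding
    halves the gap, whose first bound is trivial because \<open>H\<close> is bounded.\<close>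
  have gap: "?P n (Suc j) - nb H (Suc j) \<le> (\<bar>a0\<bar> + B) / 2 ^ k"
    if "\<And>z. \<bar>H z\<bar> \<le> B" "\<And>z. a0 - a1 * real (z + n) - a2 * (real (z + n))\<^sup>2 \<le> H z" for k n H
    using that
  proof (induction k arbitrary: n H)
    case 0
    have "- B \<le> nb H (Suc j)"
    proof -
      have "nb (\<lambda>_. - B) (Suc j) \<le> nb H (Suc j)"
      proof (rule nb_mono)
        show "bounded (range H)" by (rule boundedI[where B = B]) (use 0(1) in auto)
        show "- B \<le> H z" for z using 0(1)[of z] by linarith
      qed simp
      then show ?thesis by simp
    qed
    moreover have "?P n (Suc j) \<le> a0"
    proof -
      have "0 \<le> a1 * real (n + Suc j)" "0 \<le> a2 * ((real (n + Suc j))\<^sup>2 + 2 * real (Suc j))"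
        using a by auto
      then show ?thesis by linarith
    qed
    ultimately show ?case by simp
  next
    case (Suc k)
    have Hb: "bounded (range H)" by (rule boundedI[where B = B]) (use Suc.prems(1) in auto)
    have 1: "?P (Suc n) (Suc j) - nb (\<lambda>z. H (Suc z)) (Suc j) \<le> (\<bar>a0\<bar> + B) / 2 ^ k"
    proof (rule Suc.IH)
      show "\<bar>H (Suc z)\<bar> \<le> B" for z by (rule Suc.prems(1))
      show "a0 - a1 * real (z + Suc n) - a2 * (real (z + Suc n))\<^sup>2 \<le> H (Suc z)" for z
        using Suc.prems(2)[of "Suc z"] by simp
    qed
    have 2: "?P n j \<le> nb H j"
      by (rule outer_IH) (use Suc.prems in auto)
    have eq: "(\<bar>a0\<bar> + B) / 2 ^ Suc k = (\<bar>a0\<bar> + B) / 2 ^ k / 2" by simp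
    have "x - (u + w) / 2 \<le> c / 2" if "x = (y + z) / 2" "y - u \<le> c" "z \<le> w" for x y z u w c :: real
      using that by (simp add: field_simps)
    from this[OF P 1 2] show ?case unfolding nb_Suc[OF Hb] eq .
  qed
  have "(\<lambda>k. (\<bar>a0\<bar> + B) / 2 ^ k) \<longlonglongrightarrow> 0"
    using LIMSEQ_divide_realpow_zero[of 2 "\<bar>a0\<bar> + B"] by simp
  then have "?P n (Suc j) - nb H (Suc j) \<le> 0"
    by (rule LIMSEQ_le_const) (use gap[OF Suc.prems] in blast)
  then show ?case by simp
qed

lemma abs_drift_le: "set ps \<subseteq> {0..1} \<Longrightarrow> \<bar>drift ps\<bar> \<le> real (length ps)"
  unfolding drift_def by (induction ps) (auto simp: abs_le_iff)

text \<open>The shift \<open>n\<close> counts the \<open>True\<close> arrows already seen, which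
  lets the induction pass from \<open>H\<close> to \<open>\<lambda>z. H (Suc z)\<close>. The bracket
  after \<open>a1\<close> is the mean of \<open>n + z\<close>, and the one after \<open>a2\<close>
  bounds its second moment, with the constant contribution of the cookies absorbed into the squared
  length.\<close>

lemma stopped_quadratic:
  assumes ps: "set ps \<subseteq> {0..1}" "length ps \<le> j"
    and a: "0 \<le> a1" "0 \<le> a2" and H: "\<And>z. \<bar>H z\<bar> \<le> B"
    and q: "\<And>z. a0 - a1 * real (z + n) - a2 * (real (z + n))\<^sup>2 \<le> H z"
  shows "a0 - a1 * (real (n + j) - drift ps)
      - a2 * ((real (n + j))\<^sup>2 - 2 * real (n + j) * drift ps + (real (length ps))\<^sup>2 + 2 * real j) \<le> stopped ps H j"
  using ps H q
proof (induction ps arbitrary: n j H)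
  case Nil
  then show ?case using nb_quadratic[OF a Nil.prems(3,4)] by (simp add: drift_def)
next
  case (Cons p ps)
  then obtain i where j: "j = Suc i" by (cases j) auto
  have p: "0 \<le> p" "p \<le> 1" and ps: "set ps \<subseteq> {0..1}" and i: "length ps \<le> i"
    using Cons.prems j by auto
  define D where "D = drift ps"
  define l where "l = real (length ps)"
  define s where "s = real (n + j)"
  have Dl: "\<bar>D\<bar> \<le> l" unfolding D_def l_def by (rule abs_drift_le[OF ps])
  have D': "drift (p # ps) = 1 - 2 * p + D" by (simp add: drift_def D_def)
  have 1: "a0 - a1 * (s + 1 - D) - a2 * ((s + 1)\<^sup>2 - 2 * (s + 1) * D + l\<^sup>2 + 2 * real j)
      \<le> stopped ps (\<lambda>z. H (Suc z)) (Suc i)" (is "?A \<le> ?a")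
  proof -
    have "a0 - a1 * (real (Suc n + Suc i) - D) - a2 * ((real (Suc n + Suc i))\<^sup>2 - 2 * real (Suc n + Suc i) * D + l\<^sup>2 + 2 * real (Suc i))
      \<le> stopped ps (\<lambda>z. H (Suc z)) (Suc i)"
      unfolding D_def l_def
    proof (rule Cons.IH[OF ps])
      show "\<bar>H (Suc z)\<bar> \<le> B" for z by (rule Cons.prems(3))
      show "a0 - a1 * real (z + Suc n) - a2 * (real (z + Suc n))\<^sup>2 \<le> H (Suc z)" for z
        using Cons.prems(4)[of "Suc z"] by simp
    qed (use i in simp)
    moreover have "real (Suc n + Suc i) = s + 1" by (simp add: s_def j)
    ultimately show ?thesis by (simp only: j)
  qed
  have 2: "a0 - a1 * (s - 1 - D) - a2 * ((s - 1)\<^sup>2 - 2 * (s - 1) * D + l\<^sup>2 + 2 * (real j - 1)) \<le> stopped ps H i" (is "?C \<le> ?c")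
  proof -
    have "a0 - a1 * (real (n + i) - D) - a2 * ((real (n + i))\<^sup>2 - 2 * real (n + i) * D + l\<^sup>2 + 2 * real i) \<le> stopped ps H i"
      unfolding D_def l_def by (rule Cons.IH[OF ps i Cons.prems(3,4)])
    moreover have "real (n + i) = s - 1" "real i = real j - 1" by (simp_all add: s_def j)
    ultimately show ?thesis by (simp only:)
  qed
  have "p * ?A + (1 - p) * ?C \<le> p * ?a + (1 - p) * ?c"
    using 1 2 p by (intro add_mono mult_left_mono) auto
  also have "\<dots> = stopped (p # ps) H j" by (simp add: j)
  finally have lower: "p * ?A + (1 - p) * ?C \<le> stopped (p # ps) H j" .
  have eq: "p * ?A + (1 - p) * ?C = a0 - a1 * (s - (1 - 2 * p + D))
      - a2 * (s\<^sup>2 - 2 * s * (1 - 2 * p + D) + 1 + 2 * (1 - 2 * p) * D + l\<^sup>2 + 2 * real j - 2 * (1 - p))"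
    by (simp add: power2_eq_square algebra_simps)
  have "(1 - 2 * p) * D \<le> l"
  proof -
    have "\<bar>(1 - 2 * p) * D\<bar> \<le> 1 * l" unfolding abs_mult using p Dl by (intro mult_mono) auto
    then show ?thesis by simp
  qed
  then have "1 + 2 * (1 - 2 * p) * D + l\<^sup>2 - 2 * (1 - p) \<le> (l + 1)\<^sup>2"
    using p by (simp add: power2_eq_square algebra_simps)
  then have "a2 * (s\<^sup>2 - 2 * s * (1 - 2 * p + D) + 1 + 2 * (1 - 2 * p) * D + l\<^sup>2 + 2 * real j - 2 * (1 - p))
    \<le> a2 * (s\<^sup>2 - 2 * s * (1 - 2 * p + D) + (l + 1)\<^sup>2 + 2 * real j)"
    using a(2) by (intro mult_left_mono) auto
  then show ?case using lower unfolding eq D' s_def[symmetric] by (simp add: l_def add.commute)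
qed

text \<open>The expected sum of the states over \<open>N\<close> sites is at most
  \<open>c * j\<^sup>2 + C * N\<close>; the rest is \<open>exp (- x) \<ge> 1 - x\<close>.\<close>

lemma discounted_lower:
  assumes ps: "set ps \<subseteq> {0..1}" and drift: "2 < drift ps"
  obtains C where "0 \<le> C" "\<And>\<theta> N. 0 \<le> \<theta> \<Longrightarrow> 1 - \<theta> * C * real N \<le> discounted ps \<theta> N (\<lambda>_. []) y 0"
proof -
  \<comment> \<open>One step changes the mean of the square by at most
    \<open>- (2 * drift ps - 4) * j\<close> plus a constant. With this \<open>c\<close> the decrease
    of \<open>c * j\<^sup>2\<close> is exactly \<open>j\<close>, which pays for the new state in the
    sum.\<close>
  define c where "c = 1 / (2 * drift ps - 4)"
  have c: "0 < c" "c * (2 * drift ps - 4) = 1" using drift by (auto simp: c_def)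
  define l where "l = real (length ps)"
  define C where "C = 1 + c * (l\<^sup>2 + 3) + c * l\<^sup>2"
  have C: "0 \<le> C" using c by (simp add: C_def)
  have lower: "1 - \<theta> * (c * (real j)\<^sup>2 + C * real N) \<le> discounted ps \<theta> N (\<lambda>_. []) y j" if \<theta>: "0 \<le> \<theta>" for \<theta> N j
  proof -
    interpret chain_weights ps "\<lambda>z. exp (- \<theta> * real z)" 1 "\<lambda>_. 1"
      by (rule discount_weights[OF assms(1) \<theta>])
    show ?thesis
    proof (induction N arbitrary: j)
      case 0
      then show ?case using \<theta> c by simp
    next
      case (Suc N)
      let ?H = "\<lambda>z. exp (- \<theta> * real z) * G N (\<lambda>_. []) y z"
      let ?a0 = "1 - \<theta> * C * real N"
      have H: "?H z \<in> {0..1}" for z by (rule weighted_chain(2))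
      have q: "?a0 - \<theta> * real (z + 0) - \<theta> * c * (real (z + 0))\<^sup>2 \<le> ?H z" for z
      proof -
        have e: "1 - \<theta> * real z \<le> exp (- \<theta> * real z)" "exp (- \<theta> * real z) \<le> 1"
          using exp_ge_add_one_self[of "- \<theta> * real z"] \<theta> by auto
        have g: "G N (\<lambda>_. []) y z \<le> 1" using chain_unit[of N "\<lambda>_. []" y z] by simp
        have "exp (- \<theta> * real z) * (1 - G N (\<lambda>_. []) y z) \<le> 1 * (1 - G N (\<lambda>_. []) y z)"
          using e g by (intro mult_right_mono) auto
        then have "exp (- \<theta> * real z) - (1 - G N (\<lambda>_. []) y z) \<le> ?H z" by (simp add: algebra_simps)
        then show ?thesis using e(1) Suc.IH[of z] by (simp add: algebra_simps)
      qed
      have eq: "G (Suc N) (\<lambda>_. []) y j = stopped ps ?H (j + 1)"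
        by (rule chain_empty_Suc)
      have main: "1 - \<theta> * (c * (real i)\<^sup>2 + (1 + c * (l\<^sup>2 + 3)) + C * real N) \<le> stopped ps ?H (i + 1)"
        if i: "length ps \<le> i + 1" for i
      proof -
        let ?s = "real i + 1" and ?D = "drift ps"
        have "?a0 - \<theta> * (real (0 + (i + 1)) - ?D) - \<theta> * c * ((real (0 + (i + 1)))\<^sup>2 - 2 * real (0 + (i + 1)) * ?D + (real (length ps))\<^sup>2 + 2 * real (i + 1)) \<le> stopped ps ?H (i + 1)"
        proof (rule stopped_quadratic[OF assms(1) i \<theta> _ _ q])
          show "0 \<le> \<theta> * c" using \<theta> c by simp
          show "\<bar>?H z\<bar> \<le> 1" for z using H[of z] by simp
        qed
        moreover have "\<theta> * (?s - ?D) + \<theta> * c * (?s\<^sup>2 - 2 * ?s * ?D + l\<^sup>2 + 2 * ?s)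
          \<le> \<theta> * (c * (real i)\<^sup>2 + (1 + c * (l\<^sup>2 + 3)))"
        proof -
          have "c * (?s\<^sup>2 - 2 * ?s * ?D + l\<^sup>2 + 2 * ?s)
            = c * (real i)\<^sup>2 - c * (2 * ?D - 4) * real i + c * (l\<^sup>2 + 3) - 2 * c * ?D"
            by (simp add: power2_eq_square algebra_simps)
          also have "\<dots> = c * (real i)\<^sup>2 - real i + c * (l\<^sup>2 + 3) - 2 * c * ?D" by (simp add: c(2))
          finally have "(?s - ?D) + c * (?s\<^sup>2 - 2 * ?s * ?D + l\<^sup>2 + 2 * ?s)
              = c * (real i)\<^sup>2 + (1 + c * (l\<^sup>2 + 3)) - ?D - 2 * c * ?D" by simp
          also have "\<dots> \<le> c * (real i)\<^sup>2 + (1 + c * (l\<^sup>2 + 3))"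
          proof -
            have "0 \<le> 2 * c * ?D" using c(1) drift by simp
            then show ?thesis using drift by linarith
          qed
          finally have "\<theta> * ((?s - ?D) + c * (?s\<^sup>2 - 2 * ?s * ?D + l\<^sup>2 + 2 * ?s)) \<le> \<theta> * (c * (real i)\<^sup>2 + (1 + c * (l\<^sup>2 + 3)))"
            using \<theta> by (rule mult_left_mono)
          then show ?thesis by (simp only: distrib_left mult.assoc)
        qed
        ultimately show ?thesis by (simp add: l_def algebra_simps)
      qed
      show ?case
      proof (cases "length ps \<le> j + 1")
        case True
        have "\<theta> * (c * (real j)\<^sup>2 + (1 + c * (l\<^sup>2 + 3)) + C * real N) \<le> \<theta> * (c * (real j)\<^sup>2 + C * real (Suc N))"
          using \<theta> c by (intro mult_left_mono) (auto simp: C_def algebra_simps)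
        then show ?thesis unfolding eq using main[OF True] by linarith
      next
        case False
        \<comment> \<open>At states too small to use all cookies, the value is compared with that at
          \<open>length ps\<close>; the term \<open>c * l\<^sup>2\<close> in \<open>C\<close> covers
          the difference.\<close>
        let ?i = "length ps"
        have "stopped ps ?H (?i + 1) \<le> stopped ps ?H (j + 1)"
          by (rule antimonoD[OF stopped_antimono[OF assms(1) weighted_chain(3,1)]]) (use False in simp)
        moreover have "\<theta> * (c * (real ?i)\<^sup>2 + (1 + c * (l\<^sup>2 + 3)) + C * real N) \<le> \<theta> * (c * (real j)\<^sup>2 + C * real (Suc N))"
          using \<theta> c by (intro mult_left_mono) (auto simp: C_def l_def algebra_simps)
        ultimately show ?thesis unfolding eq using main[of ?i] by linarith
      qed
    qed
  qed
  have "1 - \<theta> * C * real N \<le> discounted ps \<theta> N (\<lambda>_. []) y 0" if "0 \<le> \<theta>" for \<theta> N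
    using lower[OF that, of 0 N]
    by (simp add: mult.assoc)
  with C show thesis by (rule that)
qed

section \<open>The walk\<close>

lemma excessive_scale:
  assumes "excessive \<rho> h" "0 \<le> a"
  shows "excessive \<rho> (\<lambda>c. a * h c)"
  unfolding excessive_def
proof (intro allI impI)
  fix c :: "int \<Rightarrow> bool list" and y and p :: real assume p: "0 \<le> p" "p \<le> \<rho> (length (c y))"
  let ?T = "c(y := c y @ [True])" and ?F = "c(y := c y @ [False])"
  have "p * h ?T + (1 - p) * h ?F \<le> h c"
    using assms(1) p unfolding excessive_def by blast
  from mult_left_mono[OF this assms(2)] show "p * (a * h ?T) + (1 - p) * (a * h ?F) \<le> a * h c"
    by (simp add: algebra_simps)
qed

lemma sum_visits_eq:
  "(\<Sum>i<N. rights x n (y + int i) + lefts x n (y + int i)) = card {m. m < n \<and> y \<le> x m \<and> x m < y + int N}"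
proof -
  have "card {m. m < n \<and> y \<le> x m \<and> x m < y + int N} = card (\<Union>i<N. {m. m < n \<and> x m = y + int i})"
  proof (rule arg_cong[where f = card], intro set_eqI iffI)
    fix m assume "m \<in> {m. m < n \<and> y \<le> x m \<and> x m < y + int N}"
    then have "nat (x m - y) < N" "m < n" "x m = y + int (nat (x m - y))" by auto
    then show "m \<in> (\<Union>i<N. {m. m < n \<and> x m = y + int i})" by blast
  qed auto
  also have "\<dots> = (\<Sum>i<N. card {m. m < n \<and> x m = y + int i})"
    by (rule card_UN_disjoint) auto
  finally show ?thesis by (simp add: rights_plus_lefts)
qed

lemma prod_exp_neg:
  fixes r :: "nat \<Rightarrow> nat"
  shows "(\<Prod>i<N. exp (- \<theta> * real (r i))) = exp (- \<theta> * real (\<Sum>i<N. r i))"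
proof -
  have "(\<Prod>i<N. exp (- \<theta> * real (r i))) = exp (\<Sum>i<N. - \<theta> * real (r i))"
    by (rule exp_sum[symmetric]) simp
  also have "(\<Sum>i<N. - \<theta> * real (r i)) = - \<theta> * (\<Sum>i<N. real (r i))"
    by (rule sum_distrib_left[symmetric])
  finally show ?thesis by simp
qed

section \<open>Hitting times to the right and to the left\<close>

context cookie_walk
begin

text \<open>At a time \<open>n\<close> with the walk at \<open>x0 + N + 1\<close>, the left steps
  taken from the \<open>N\<close> sites below that position and above \<open>x0\<close> number at
  most \<open>n\<close>. Read downward they dominate the chain with \<open>e = 1\<close>, so a time
  linear in \<open>N\<close> has exponentially small probability, and Borel-Cantelli
  applies.\<close>

lemma no_linear_growth:
  assumes "drift hs = - 2" "1 \<le> m"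
  shows "AE \<omega> in P. \<not> (X 0 \<omega> = x0 \<and> (\<forall>k. \<exists>n\<ge>k. int n \<le> int m * X n \<omega>))"
proof -
  have lp: "set left_probs \<subseteq> {0<..1}" "drift left_probs = 2"
    using left_probs(1) drift_left_probs assms(1) by auto
  have lp': "set left_probs \<subseteq> {0..1}" using lp(1) by auto
  \<comment> \<open>A rate one above the slope \<open>m\<close> leaves the summable factor
    \<open>exp (- \<theta>) ^ N\<close>.\<close>
  have "0 < real m + 1" by simp
  from discounted_decay[OF lp this, of 0]
  obtain \<theta> a where \<theta>: "0 < \<theta>" and a: "0 < a"
    and decay: "\<And>N. discounted left_probs \<theta> N (\<lambda>_. []) 0 0 \<le> a * exp (- \<theta> * (real m + 1) * real N)"
    by metis
  interpret chain_weights left_probs "\<lambda>z. exp (- \<theta> * real z)" 1 "\<lambda>_. 1"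
    by (rule discount_weights[OF lp' less_imp_le[OF \<theta>]])
  \<comment> \<open>An upper bound for \<open>exp (\<theta> * n)\<close> at every time
    \<open>n \<le> m * X n\<close> with \<open>X n = x0 + N + 1\<close>.\<close>
  define u where "u = (\<lambda>N. exp (\<theta> * (real m * (real N + 1 + \<bar>real_of_int x0\<bar>))))"
  define h where "h = (\<lambda>N c. u N * G N (flip c) (- (x0 + int N)) 0)"
  define E where "E = (\<lambda>N. {\<omega> \<in> space P. \<exists>n. 1 \<le> h N (arrows (traj \<omega>) n)})"
  have ex: "excessive (arrow_prob hs) (h N)" "\<And>c. 0 \<le> h N c" "\<And>c. h N c \<le> u N" for N
  proof -
    show "excessive (arrow_prob hs) (h N)"
      unfolding h_def left_probs(2) by (rule excessive_scale[OF excessive_left_chain]) (simp add: u_def)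
    show "0 \<le> h N c" "h N c \<le> u N" for c
      using chain_unit[of N "flip c" "- (x0 + int N)" 0] by (auto simp: h_def u_def mult_left_le)
  qed
  have E: "E N \<in> events" "prob (E N) \<le> h N (\<lambda>_. [])" for N
    unfolding E_def by (rule excessive_maximal[OF ex])+
  define K where "K = exp (\<theta> * (real m * (1 + \<bar>real_of_int x0\<bar>))) * a"
  have E_le: "prob (E N) \<le> K * exp (- \<theta>) ^ N" for N
  proof -
    have "prob (E N) \<le> h N (\<lambda>_. [])" by (rule E(2))
    also have "\<dots> = u N * G N (\<lambda>_. []) 0 0"
      unfolding h_def using chain_empty_shift[of N "- (x0 + int N)" 0 0] by (simp add: flip_def[abs_def])
    also have "\<dots> \<le> u N * (a * exp (- \<theta> * (real m + 1) * real N))"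
      by (rule mult_left_mono[OF decay]) (simp add: u_def)
    also have "\<dots> = K * exp (- \<theta> * real N)"
      by (simp add: u_def K_def algebra_simps flip: exp_add)
    also have "exp (- \<theta> * real N) = exp (- \<theta>) ^ N"
      by (simp add: exp_of_nat_mult[symmetric] mult.commute)
    finally show ?thesis .
  qed
  have "summable (\<lambda>N. prob (E N))"
  proof (rule summable_comparison_test')
    show "summable (\<lambda>N. K * exp (- \<theta>) ^ N)" using \<theta> by (intro summable_mult summable_geometric) simp
    show "norm (prob (E N)) \<le> K * exp (- \<theta>) ^ N" for N using E_le[of N] by simp
  qed
  then have "AE \<omega> in P. eventually (\<lambda>N. \<omega> \<in> space P - E N) sequentially"
    using E(1) by (intro borel_cantelli_AE1) (auto simp: emeasure_eq_measure)
  with AE_nn show ?thesis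
  proof eventually_elim
    case (elim \<omega>)
    let ?x = "traj \<omega>" and ?x' = "\<lambda>m. - X m \<omega>"
    obtain N0 where N0: "\<And>N. N0 \<le> N \<Longrightarrow> \<omega> \<in> space P - E N"
      using elim(2) by (auto simp: eventually_sequentially)
    show ?case
    proof
      assume bad: "X 0 \<omega> = x0 \<and> (\<forall>k. \<exists>n\<ge>k. int n \<le> int m * X n \<omega>)"
      obtain n where n: "m * (N0 + nat \<bar>x0\<bar> + 2) \<le> n" "int n \<le> int m * X n \<omega>" using bad by blast
      have "int m * int (N0 + nat \<bar>x0\<bar> + 2) \<le> int m * X n \<omega>"
        using n by (metis of_nat_le_iff of_nat_mult order_trans)
      then have big: "int (N0 + nat \<bar>x0\<bar> + 2) \<le> X n \<omega>" using assms(2) by simp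
      define N where "N = nat (X n \<omega> - x0 - 1)"
      have N: "X n \<omega> = x0 + int N + 1" "N0 \<le> N" "0 < N" using big unfolding N_def by linarith+
      have nn: "\<bar>?x (Suc k) - ?x k\<bar> = 1" for k using elim(1) by blast
      have nn': "\<bar>?x' (Suc k) - ?x' k\<bar> = 1" for k using nn[of k] by linarith
      have fl: "flip (arrows ?x n) = arrows ?x' n" by (rule flip_arrows) (rule nn)
      let ?y = "- (x0 + int N)"
      have "exp (- \<theta> * real n) \<le> exp (- \<theta> * real (\<Sum>i<N. rights ?x' n (?y + int i)))"
      proof -
        have "(\<Sum>i<N. rights ?x' n (?y + int i)) \<le> (\<Sum>i<N. rights ?x' n (?y + int i) + lefts ?x' n (?y + int i))"
          by (rule sum_mono) simp
        also have "\<dots> \<le> card {..<n}" unfolding sum_visits_eq by (rule card_mono) auto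
        finally show ?thesis using \<theta> by (simp del: of_nat_sum)
      qed
      also have "\<dots> = (\<Prod>i<N. exp (- \<theta> * real (rights ?x' n (?y + int i)))) * 1"
        by (simp only: prod_exp_neg mult_1_right)
      also have "\<dots> \<le> G N (arrows ?x' n) ?y 0"
        unfolding rights_def
      proof (rule chain_lower[OF _ _ N(3)])
        have "int (rights ?x' n (?y - 1)) - int (lefts ?x' n (?y - 1 + 1)) = of_bool (?x' n > ?y - 1) - of_bool (?x' 0 > ?y - 1)"
          by (rule crossing_balance) (rule nn')
        then show "0 + 1 \<le> count_list (arrows ?x' n ?y) False"
          using bad N by (simp add: lefts_def)
        show "count_list (arrows ?x' n (?y + int i)) True + 1 \<le> count_list (arrows ?x' n (?y + int i + 1)) False"
          if "Suc i < N" for i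
        proof -
          have "int (rights ?x' n (?y + int i)) - int (lefts ?x' n (?y + int i + 1)) = of_bool (?x' n > ?y + int i) - of_bool (?x' 0 > ?y + int i)"
            by (rule crossing_balance) (rule nn')
          then show ?thesis using bad N that by (simp add: lefts_def rights_def)
        qed
      qed
      finally have lower: "exp (- \<theta> * real n) \<le> G N (arrows ?x' n) ?y 0" .
      have "real n \<le> real m * (real N + 1 + \<bar>real_of_int x0\<bar>)"
      proof -
        have "real n \<le> real m * real_of_int (X n \<omega>)"
          using n(2) by (metis of_int_le_iff of_int_mult of_int_of_nat_eq)
        also have "\<dots> \<le> real m * (real N + 1 + \<bar>real_of_int x0\<bar>)"
          by (rule mult_left_mono) (use N(1) in auto)
        finally show ?thesis .
      qed
      then have "exp (\<theta> * real n) \<le> u N" using \<theta> by (simp add: u_def)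
      then have "exp (\<theta> * real n) * exp (- \<theta> * real n) \<le> u N * G N (arrows ?x' n) ?y 0"
        using lower by (intro mult_mono) (auto simp: u_def)
      then have "1 \<le> h N (arrows ?x n)" unfolding h_def fl by (simp flip: exp_add)
      then have "\<omega> \<in> E N" using N0[OF N(2)] unfolding E_def by blast
      then show False using N0[OF N(2)] by blast
    qed
  qed
qed

text \<open>If the walk has not reached \<open>x0 - N\<close> by time
  \<open>(2 * A + 2) * N\<close>, it has spent nearly all this time on the \<open>N\<close> sites
  from \<open>x0 - N + 1\<close> to \<open>x0\<close>, and the right steps there number at least
  \<open>A * N\<close>. Their mean in the cookie environment is at most \<open>C * N\<close>, so a
  Markov-type bound of order \<open>C / A\<close> results.\<close>

lemma linear_descent:
  assumes "2 < drift hs"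
  shows "AE \<omega> in P. \<not> (X 0 \<omega> = x0 \<and> (\<exists>S. \<forall>n. card {m. m < n \<and> x0 < X m \<omega>} \<le> S)
     \<and> (\<forall>A::nat. eventually (\<lambda>N. \<forall>n\<le>(2 * A + 2) * N. x0 - int N < X n \<omega>) sequentially))"
proof -
  obtain C where C: "0 \<le> C" "\<And>\<theta> N. 0 \<le> \<theta> \<Longrightarrow> 1 - \<theta> * C * real N \<le> discounted hs \<theta> N (\<lambda>_. []) 0 0"
    using discounted_lower[OF hs_unit assms] by metis
  show ?thesis
  proof (rule AE_not_if_excessive[where Q = "\<lambda>x. x 0 = x0 \<and> (\<exists>S. \<forall>n. card {m. m < n \<and> x0 < x m} \<le> S)
     \<and> (\<forall>A::nat. eventually (\<lambda>N. \<forall>n\<le>(2 * A + 2) * N. x0 - int N < x n) sequentially)"])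
    fix \<epsilon> :: real assume \<epsilon>: "0 < \<epsilon>"
    define A where "A = Suc (nat \<lceil>2 * C / \<epsilon>\<rceil>)"
    have A: "0 < A" "2 * C \<le> \<epsilon> * real A"
    proof -
      have "2 * C / \<epsilon> \<le> real A" unfolding A_def by linarith
      then show "2 * C \<le> \<epsilon> * real A" using \<epsilon> by (simp add: field_simps)
    qed (simp add: A_def)
    \<comment> \<open>A total of \<open>A * N\<close> is then discounted by
      \<open>exp (- 1) \<le> 1 / 2\<close>, which explains the factor 2 in \<open>h\<close>.\<close>
    define \<theta> where "\<theta> = (\<lambda>N. 1 / (real A * real N))"
    have \<theta>: "0 \<le> \<theta> N" for N by (simp add: \<theta>_def)
    define h where "h = (\<lambda>N c. 2 * (1 - discounted hs (\<theta> N) N c (x0 - int N + 1) 0))"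
    have h: "excessive (arrow_prob hs) (h N)" "0 \<le> h N c" "h N c \<le> 2" "h N (\<lambda>_. []) \<le> \<epsilon>" for N c
    proof -
      interpret chain_weights hs "\<lambda>z. exp (- \<theta> N * real z)" 1 "\<lambda>_. 1"
        by (rule discount_weights[OF hs_unit \<theta>])
      show "excessive (arrow_prob hs) (h N)"
        unfolding h_def by (rule excessive_scale[OF excessive_right_chain]) simp
      show "0 \<le> h N c" "h N c \<le> 2"
        using chain_unit[of N c "x0 - int N + 1" 0] by (auto simp: h_def)
      have "h N (\<lambda>_. []) \<le> 2 * (\<theta> N * C * real N)"
        using C(2)[OF \<theta>, of N N] chain_empty_shift[of N "x0 - int N + 1" 0 0] by (simp add: h_def)
      also have "\<dots> \<le> \<epsilon>"
        using A \<epsilon> by (cases "N = 0") (auto simp: \<theta>_def field_simps)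
      finally show "h N (\<lambda>_. []) \<le> \<epsilon>" .
    qed
    have main: "eventually (\<lambda>N. \<exists>n. 1 \<le> h N (arrows x n)) sequentially"
      if nn: "\<And>n. \<bar>x (Suc n) - x n\<bar> = 1" and x0: "x 0 = x0"
        and S: "\<And>n. card {m. m < n \<and> x0 < x m} \<le> S"
        and slow: "eventually (\<lambda>N. \<forall>n\<le>(2 * A + 2) * N. x0 - int N < x n) sequentially" for x S
      using slow eventually_ge_at_top[of "Suc S"]
    proof eventually_elim
      case (elim N)
      interpret chain_weights hs "\<lambda>z. exp (- \<theta> N * real z)" 1 "\<lambda>_. 1"
        by (rule discount_weights[OF hs_unit \<theta>])
      define n where "n = (2 * A + 2) * N"
      let ?y = "x0 - int N + 1"
      have N: "0 < N" "S \<le> N" using elim(2) by auto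
      have above: "x0 - int N < x m" if "m \<le> n" for m using elim(1) that by (simp add: n_def)
      have bal: "int (rights x n y) - int (lefts x n (y + 1)) = of_bool (x n > y) - of_bool (x 0 > y)" for y
        by (rule crossing_balance) (rule nn)
      have first: "lefts x n ?y = 0"
      proof -
        have "rights x n (x0 - int N) = 0" by (rule rights_eq_0) (metis above less_imp_le_nat less_irrefl)
        then show ?thesis using bal[of "x0 - int N"] above[of n] x0 N(1) by simp
      qed
      have step: "lefts x n (?y + int i + 1) \<le> rights x n (?y + int i) + 1" for i
        using bal[of "?y + int i"] by (simp add: of_bool_def split: if_splits)
      let ?R = "\<Sum>i<N. rights x n (?y + int i)"
      have "G N (arrows x n) ?y 0 \<le> (\<Prod>i<N. exp (- \<theta> N * real (count_list (arrows x n (?y + int i)) True))) * 1"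
      proof (rule chain_upper[OF _ _ N(1)])
        show "passed (arrows x n ?y) (0 + 1)" using first by (simp add: passed_def lefts_def)
        show "passed (arrows x n (?y + int i + 1)) (count_list (arrows x n (?y + int i)) True + 1)"
          if i: "Suc i < N" for i
        proof (cases "lefts x n (?y + int i + 1) = rights x n (?y + int i) + 1")
          \<comment> \<open>Equality means that the walk now stands below this site. Its last
            departure from there was to the left, so no \<open>True\<close> follows the awaited
            \<open>False\<close>.\<close>
          case True
          have "?y + int i < x0" using i by simp
          then have "x n < ?y + int i + 1" using bal[of "?y + int i"] True x0 by (simp add: of_bool_def split: if_splits)
          moreover have "arrows x n (?y + int i + 1) \<noteq> []" using True by (auto simp: lefts_def)
          ultimately have "\<not> last (arrows x n (?y + int i + 1))"
            by (intro last_arrow_False[where x = x, OF nn])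
          then show ?thesis using True \<open>arrows x n (?y + int i + 1) \<noteq> []\<close>
            by (simp add: passed_def lefts_def rights_def)
        next
          case False
          then have "lefts x n (?y + int i + 1) < rights x n (?y + int i) + 1" using step[of i] by linarith
          then show ?thesis by (simp add: passed_def lefts_def rights_def)
        qed
      qed
      also have "\<dots> = exp (- \<theta> N * real ?R)"
        unfolding rights_def[symmetric] by (simp only: prod_exp_neg mult_1_right)
      finally have upper: "G N (arrows x n) ?y 0 \<le> exp (- \<theta> N * real ?R)" .
      \<comment> \<open>Left steps exceed right steps by at most one per site, so
        \<open>n \<le> 2 * ?R + N + S\<close>. The summand 2 in the horizon absorbs
        \<open>N + S \<le> 2 * N\<close>.\<close>
      have "(\<Sum>i<N. lefts x n (?y + int i)) \<le> ?R + N"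
      proof -
        obtain N' where N': "N = Suc N'" using N(1) by (cases N) auto
        have "(\<Sum>i<N. lefts x n (?y + int i)) = (\<Sum>i<N'. lefts x n (?y + int i + 1))"
          unfolding N' sum.lessThan_Suc_shift using first by (simp add: N' algebra_simps)
        also have "\<dots> \<le> (\<Sum>i<N'. rights x n (?y + int i) + 1)" by (rule sum_mono) (rule step)
        also have "\<dots> = (\<Sum>i<N'. rights x n (?y + int i)) + (\<Sum>i<N'. 1)" by (rule sum.distrib)
        also have "\<dots> \<le> ?R + N" unfolding N' by simp
        finally show ?thesis .
      qed
      moreover have "n \<le> (?R + (\<Sum>i<N. lefts x n (?y + int i))) + S"
      proof -
        have "{m. m < n} \<subseteq> {m. m < n \<and> ?y \<le> x m \<and> x m < ?y + int N} \<union> {m. m < n \<and> x0 < x m}"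
        proof
          fix m assume "m \<in> {m. m < n}"
          then show "m \<in> {m. m < n \<and> ?y \<le> x m \<and> x m < ?y + int N} \<union> {m. m < n \<and> x0 < x m}"
            using above[of m] by auto
        qed
        then have "card {m. m < n} \<le> card ({m. m < n \<and> ?y \<le> x m \<and> x m < ?y + int N} \<union> {m. m < n \<and> x0 < x m})"
          by (rule card_mono[rotated]) auto
        also have "\<dots> \<le> card {m. m < n \<and> ?y \<le> x m \<and> x m < ?y + int N} + card {m. m < n \<and> x0 < x m}"
          by (rule card_Un_le)
        finally show ?thesis
          using S[of n] unfolding sum_visits_eq[symmetric] by (simp add: sum.distrib)
      qed
      ultimately have "A * N \<le> ?R" using N(2) by (simp add: n_def algebra_simps)
      then have "real A * real N \<le> real ?R" by (metis of_nat_le_iff of_nat_mult)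
      then have "1 \<le> \<theta> N * real ?R" using A(1) N(1) by (simp add: \<theta>_def field_simps)
      then have "exp (- \<theta> N * real ?R) \<le> exp (- 1)" by simp
      also have "exp (- 1 :: real) \<le> 1 / 2" using exp_ge_add_one_self[of 1] by (simp add: exp_minus field_simps)
      finally have "1 \<le> h N (arrows x n)" using upper by (simp add: h_def)
      then show ?case ..
    qed
    have Q: "eventually (\<lambda>N. \<exists>n. 1 \<le> h N (arrows x n)) sequentially"
      if "\<forall>n. \<bar>x (Suc n) - x n\<bar> = 1" "x 0 = x0 \<and> (\<exists>S. \<forall>n. card {m. m < n \<and> x0 < x m} \<le> S)
     \<and> (\<forall>A::nat. eventually (\<lambda>N. \<forall>n\<le>(2 * A + 2) * N. x0 - int N < x n) sequentially)" for x
      using main[of x] that by blast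
    show "\<exists>h B. (\<forall>N::nat. excessive (arrow_prob hs) (h N) \<and> (\<forall>c. 0 \<le> h N c \<and> h N c \<le> B N) \<and> h N (\<lambda>_. []) \<le> \<epsilon>)
      \<and> (\<forall>x. (\<forall>n. \<bar>x (Suc n) - x n\<bar> = 1) \<longrightarrow> (x 0 = x0 \<and> (\<exists>S. \<forall>n. card {m. m < n \<and> x0 < x m} \<le> S)
     \<and> (\<forall>A::nat. eventually (\<lambda>N. \<forall>n\<le>(2 * A + 2) * N. x0 - int N < x n) sequentially)) \<longrightarrow>
          eventually (\<lambda>N. \<exists>n. 1 \<le> h N (arrows x n)) sequentially)"
      by (intro exI[of _ h] exI[of _ "\<lambda>_. 2"] conjI allI impI) (use h Q in \<open>blast+\<close>)
  qed
qed

end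

section \<open>Transience and oscillation of a single path\<close>

lemma transient_right_iff: "transient_right x \<longleftrightarrow> (\<forall>C. eventually (\<lambda>n. C < x n) sequentially)"
proof
  assume "transient_right x"
  then have "\<infinity> \<le> liminf (\<lambda>n. ereal (real_of_int (x n)))" by (simp add: transient_right_def)
  then have *: "eventually (\<lambda>n. y < ereal (real_of_int (x n))) sequentially" if "y < \<infinity>" for y
    using that unfolding le_Liminf_iff by blast
  show "\<forall>C. eventually (\<lambda>n. C < x n) sequentially"
  proof
    fix C
    show "eventually (\<lambda>n. C < x n) sequentially"
      using *[of "ereal (real_of_int C)"] by simp
  qed
next
  assume *: "\<forall>C. eventually (\<lambda>n. C < x n) sequentially"
  have "\<infinity> \<le> liminf (\<lambda>n. ereal (real_of_int (x n)))"
    unfolding le_Liminf_iff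
  proof (intro allI impI)
    fix y :: ereal assume "y < \<infinity>"
    then obtain C :: real where C: "y \<le> ereal C" by (cases y) auto
    from * have "eventually (\<lambda>n. \<lceil>C\<rceil> < x n) sequentially" by blast
    then show "eventually (\<lambda>n. y < ereal (real_of_int (x n))) sequentially"
    proof eventually_elim
      case (elim n)
      then have "C < real_of_int (x n)" by linarith
      then show ?case by (intro le_less_trans[OF C]) simp
    qed
  qed
  then show "transient_right x" by (simp add: transient_right_def)
qed

lemma transient_left_iff: "transient_left x \<longleftrightarrow> transient_right (\<lambda>n. - x n)"
proof -
  have "liminf (\<lambda>n. ereal (real_of_int (- x n))) = - limsup (\<lambda>n. ereal (real_of_int (x n)))"
    using ereal_Liminf_uminus[of sequentially "\<lambda>n. ereal (real_of_int (x n))"] by simp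
  then show ?thesis by (simp add: transient_left_def transient_right_def ereal_uminus_eq_reorder)
qed

lemma rights_bounded_if_transient_right:
  assumes "transient_right x"
  obtains K where "\<And>n. rights x n y \<le> K"
proof -
  obtain n0 where n0: "\<And>n. n0 \<le> n \<Longrightarrow> y < x n"
    using assms unfolding transient_right_iff eventually_sequentially by blast
  have "rights x n y \<le> rights x n0 y" for n
  proof (cases "n0 \<le> n")
    case True
    then show ?thesis
    proof (induction n rule: dec_induct)
      case (step n)
      then show ?case using n0[of n] by (simp add: rights_Suc)
    qed simp
  next
    case False
    then show ?thesis by (intro rights_mono) simp
  qed
  then show thesis by (rule that)
qed

text \<open>A path transient to neither side is above some level \<open>y\<close> at arbitrarily
  late times and also not above it at arbitrarily late times; every passage between the two crosses
  the edge from \<open>y\<close> upward.\<close>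

lemma oscillation_crossings:
  assumes nn: "\<And>n. \<bar>x (Suc n) - x n\<bar> = 1" and "\<not> transient_right x" "\<not> transient_left x"
  obtains y where "\<And>K. \<exists>n. y < x n \<and> K \<le> rights x n y"
proof -
  obtain c where c: "\<And>n0. \<exists>n\<ge>n0. x n \<le> c"
    using assms(2) unfolding transient_right_iff eventually_sequentially by (auto simp: not_less)
  obtain C where C: "\<And>n0. \<exists>n\<ge>n0. - x n \<le> C"
    using assms(3) unfolding transient_left_iff transient_right_iff eventually_sequentially by (auto simp: not_less)
  define c' where "c' = - C"
  have c': "\<exists>n\<ge>n0. c' \<le> x n" for n0 using C[of n0] by (auto simp: c'_def minus_le_iff)
  have "\<exists>y. (\<forall>n0. \<exists>n\<ge>n0. y < x n) \<and> (\<forall>n0. \<exists>n\<ge>n0. x n \<le> y)"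
  proof (rule ccontr)
    assume none: "\<nexists>y. (\<forall>n0. \<exists>n\<ge>n0. y < x n) \<and> (\<forall>n0. \<exists>n\<ge>n0. x n \<le> y)"
    define U where "U = (\<lambda>y. \<forall>n0. \<exists>n\<ge>n0. y < x n)"
    \<comment> \<open>Without such a level, a path above \<open>y\<close> at arbitrarily late times
      stays above \<open>y\<close> from some time on. Consecutive positions differ, so one of any
      two exceeds \<open>y + 1\<close>; iterating this contradicts the level
      \<open>c\<close>.\<close>
    have up: "U (y + 1)" if "U y" for y
    proof -
      have "\<not> (\<forall>n0. \<exists>n\<ge>n0. x n \<le> y)" using none that unfolding U_def by blast
      then obtain n0 where "\<And>n. n0 \<le> n \<Longrightarrow> \<not> x n \<le> y" by blast
      then have n0: "y < x n" if "n0 \<le> n" for n using that by (simp add: not_le)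
      show ?thesis unfolding U_def
      proof
        fix k
        let ?m = "max n0 k"
        have "y < x ?m" "y < x (Suc ?m)" using n0 by auto
        moreover have "x (Suc ?m) \<noteq> x ?m" using nn[of ?m] by auto
        ultimately have "y + 1 < x ?m \<or> y + 1 < x (Suc ?m)" by linarith
        then show "\<exists>n\<ge>k. y + 1 < x n"
        proof
          assume "y + 1 < x ?m" then show ?thesis by (intro exI[of _ ?m]) simp
        next
          assume "y + 1 < x (Suc ?m)" then show ?thesis by (intro exI[of _ "Suc ?m"]) simp
        qed
      qed
    qed
    have U: "U (c' - 1 + int i)" for i
    proof (induction i)
      case 0
      show ?case unfolding U_def
      proof
        fix n0
        obtain n where "n0 \<le> n" "c' \<le> x n" using c' by blast
        then show "\<exists>n\<ge>n0. c' - 1 + int 0 < x n" by (intro exI[of _ n]) simp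
      qed
    next
      case (Suc i)
      then show ?case using up[OF Suc] by (simp add: algebra_simps)
    qed
    have "c' - 1 + int (nat (max c (c' - 1) - (c' - 1))) = max c (c' - 1)" by simp
    with U[of "nat (max c (c' - 1) - (c' - 1))"] have "U (max c (c' - 1))" by simp
    moreover have "\<forall>n0. \<exists>n\<ge>n0. x n \<le> max c (c' - 1)" using c by (auto intro: max.coboundedI1)
    ultimately show False using none unfolding U_def by blast
  qed
  then obtain y where y: "\<And>n0. \<exists>n\<ge>n0. y < x n" "\<And>n0. \<exists>n\<ge>n0. x n \<le> y" by blast
  have bal: "int (rights x n y) - int (lefts x n (y + 1)) = of_bool (x n > y) - of_bool (x 0 > y)" for n
    by (rule crossing_balance) (rule nn)
  have "\<exists>n. y < x n \<and> K \<le> rights x n y" for K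
  proof (induction K)
    case 0
    then show ?case using y(1)[of 0] by auto
  next
    case (Suc K)
    then obtain n where n: "K \<le> rights x n y" by blast
    obtain n1 where n1: "n \<le> n1" "x n1 \<le> y" using y(2) by blast
    obtain n2 where n2: "n1 \<le> n2" "y < x n2" using y(1) by blast
    have "rights x n1 y < rights x n2 y"
      using bal[of n1] bal[of n2] lefts_mono[OF n2(1), of x "y + 1"] n1 n2 by simp
    then show ?case using n2(2) n rights_mono[OF n1(1), of x y] by (intro exI[of _ n2]) simp
  qed
  then show thesis by (rule that)
qed

section \<open>Almost sure behaviour for a given drift\<close>

context cookie_walk
begin

lemma not_transient_right:
  assumes "drift hs = - 1"
  shows "AE \<omega> in P. \<not> transient_right (traj \<omega>)"
proof -
  have "AE \<omega> in P. \<forall>x0 K. \<not> (X 0 \<omega> = x0 \<and> (\<forall>n. rights (traj \<omega>) n x0 \<le> K) \<and> (\<forall>C. eventually (\<lambda>n. C < X n \<omega>) sequentially))"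
    unfolding AE_all_countable using no_escape_right[OF assms] by blast
  then show ?thesis
  proof eventually_elim
    case (elim \<omega>)
    show ?case
    proof
      assume t: "transient_right (traj \<omega>)"
      obtain K where "\<And>n. rights (traj \<omega>) n (X 0 \<omega>) \<le> K"
        using rights_bounded_if_transient_right[OF t] by blast
      then show False using elim t unfolding transient_right_iff by blast
    qed
  qed
qed

lemma speed_nonpos:
  assumes "drift hs = - 2"
  shows "AE \<omega> in P. limsup (\<lambda>n. ereal (real_of_int (X n \<omega>) / real n)) \<le> 0"
proof -
  have "AE \<omega> in P. \<forall>i x0. \<not> (X 0 \<omega> = x0 \<and> (\<forall>k. \<exists>n\<ge>k. int n \<le> int (Suc i) * X n \<omega>))"
    unfolding AE_all_countable by (intro allI no_linear_growth[OF assms]) simp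
  then show ?thesis
  proof eventually_elim
    case (elim \<omega>)
    show ?case
      unfolding Limsup_le_iff
    proof (intro allI impI)
      fix y :: ereal assume "0 < y"
      then obtain r :: real where r: "0 < r" "ereal r \<le> y"
      proof (cases y)
        case (real s)
        then show thesis using \<open>0 < y\<close> that[of s] by simp
      next
        case PInf
        then show thesis using that[of 1] by simp
      qed (use \<open>0 < y\<close> in auto)
      obtain i where i: "inverse (real (Suc i)) < r" using reals_Archimedean[OF r(1)] by blast
      have "\<not> (\<forall>k. \<exists>n\<ge>k. int n \<le> int (Suc i) * X n \<omega>)" using elim by blast
      then obtain k where "\<And>n. k \<le> n \<Longrightarrow> \<not> int n \<le> int (Suc i) * X n \<omega>" by blast
      then have k: "int (Suc i) * X n \<omega> < int n" if "k \<le> n" for n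
        using that by (simp only: not_le)
      have "ereal (real_of_int (X n \<omega>) / real n) < y" if n: "max k 1 \<le> n" for n
      proof -
        have "real_of_int (int (Suc i) * X n \<omega>) < real_of_int (int n)"
          using k[of n] n by (simp only: of_int_less_iff)
        then have "real (Suc i) * real_of_int (X n \<omega>) < real n" by simp
        then have "real_of_int (X n \<omega>) / real n < inverse (real (Suc i))"
          using n by (simp add: field_simps del: of_nat_Suc)
        then have "real_of_int (X n \<omega>) / real n < r" using i by linarith
        then show ?thesis using r(2) by (metis less_ereal.simps(1) order_less_le_trans)
      qed
      then show "eventually (\<lambda>n. ereal (real_of_int (X n \<omega>) / real n) < y) sequentially"
        unfolding eventually_sequentially by blast
    qed
  qed
qed

lemma transient_left:
  assumes "1 < drift hs" and "AE \<omega> in P. \<not> transient_right (traj \<omega>)"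
  shows "AE \<omega> in P. transient_left (traj \<omega>)"
proof -
  have "AE \<omega> in P. \<forall>y. \<not> (\<forall>K. \<exists>n. y < X n \<omega> \<and> K \<le> rights (traj \<omega>) n y)"
    unfolding AE_all_countable using no_return_from_left[OF assms(1)] by blast
  with assms(2) AE_nn show ?thesis
  proof eventually_elim
    case (elim \<omega>)
    show ?case
    proof (rule ccontr)
      assume "\<not> transient_left (traj \<omega>)"
      then obtain y where "\<And>K. \<exists>n. y < X n \<omega> \<and> K \<le> rights (traj \<omega>) n y"
        using oscillation_crossings[of "traj \<omega>"] elim(1,2) by metis
      then show False using elim(3) by blast
    qed
  qed
qed

text \<open>If the lower speed were nonnegative, the descent would be slower than any linear rate.
  As a path transient to the left spends a bounded time above its start, this is the event excluded
  by \<open>linear_descent\<close>.\<close>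

lemma speed_negative:
  assumes "2 < drift hs" and "AE \<omega> in P. transient_left (traj \<omega>)"
  shows "AE \<omega> in P. liminf (\<lambda>n. ereal (real_of_int (X n \<omega>) / real n)) < 0"
proof -
  have "AE \<omega> in P. \<forall>x0. \<not> (X 0 \<omega> = x0 \<and> (\<exists>S. \<forall>n. card {m. m < n \<and> x0 < X m \<omega>} \<le> S)
     \<and> (\<forall>A::nat. eventually (\<lambda>N. \<forall>n\<le>(2 * A + 2) * N. x0 - int N < X n \<omega>) sequentially))"
    unfolding AE_all_countable using linear_descent[OF assms(1)] by blast
  with assms(2) AE_nn show ?thesis
  proof eventually_elim
    case (elim \<omega>)
    show ?case
    proof (rule ccontr)
      assume "\<not> liminf (\<lambda>n. ereal (real_of_int (X n \<omega>) / real n)) < 0"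
      then have "0 \<le> liminf (\<lambda>n. ereal (real_of_int (X n \<omega>) / real n))" by simp
      then have slow: "eventually (\<lambda>n. y < ereal (real_of_int (X n \<omega>) / real n)) sequentially" if "y < 0" for y
        using that unfolding le_Liminf_iff by blast
      define x0 where "x0 = X 0 \<omega>"
      have "\<exists>S. \<forall>n. card {m. m < n \<and> x0 < X m \<omega>} \<le> S"
      proof -
        have "eventually (\<lambda>n. - x0 < - X n \<omega>) sequentially"
          using elim(1) unfolding transient_left_iff transient_right_iff by blast
        then obtain n0 where n0: "\<And>n. n0 \<le> n \<Longrightarrow> X n \<omega> < x0"
          unfolding eventually_sequentially by auto
        have "card {m. m < n \<and> x0 < X m \<omega>} \<le> card {..<n0}" for n
        proof (rule card_mono)
          show "{m. m < n \<and> x0 < X m \<omega>} \<subseteq> {..<n0}"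
          proof
            fix m assume "m \<in> {m. m < n \<and> x0 < X m \<omega>}"
            then have "\<not> n0 \<le> m" using n0[of m] by auto
            then show "m \<in> {..<n0}" by simp
          qed
        qed simp
        then show ?thesis by blast
      qed
      moreover have "eventually (\<lambda>N. \<forall>n\<le>(2 * A + 2) * N. x0 - int N < X n \<omega>) sequentially" for A :: nat
      proof -
        \<comment> \<open>Up to time \<open>(2 * A + 2) * N\<close> the line
          \<open>- \<delta> * n\<close> falls by at most \<open>N / 2\<close>; the other half of
          \<open>N\<close> absorbs the starting point.\<close>
        define \<delta> where "\<delta> = 1 / (2 * (2 * real A + 2))"
        have \<delta>: "0 < \<delta>" "\<delta> * (2 * real A + 2) = 1 / 2" by (simp_all add: \<delta>_def field_simps)
        have "ereal (- \<delta>) < 0" using \<delta> by simp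
        from slow[OF this] obtain n1 where n1: "\<And>n. n1 \<le> n \<Longrightarrow> - \<delta> < real_of_int (X n \<omega>) / real n"
          unfolding eventually_sequentially by auto
        have low: "x0 - int n \<le> X n \<omega>" for n
        proof (induction n)
          case (Suc n)
          have "\<bar>X (Suc n) \<omega> - X n \<omega>\<bar> = 1" using elim(2) by blast
          then show ?case using Suc by linarith
        qed (simp add: x0_def)
        have "x0 - int N < X n \<omega>" if N: "n1 + nat (2 * \<bar>x0\<bar>) + 2 \<le> N" and n: "n \<le> (2 * A + 2) * N" for N n
        proof (cases "n1 + 1 \<le> n")
          case False
          then show ?thesis using low[of n] N by linarith
        next
          case True
          then have "- \<delta> * real n < real_of_int (X n \<omega>)" using n1[of n] by (simp add: field_simps)
          moreover have "\<delta> * real n \<le> real N / 2"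
          proof -
            have "real n \<le> real ((2 * A + 2) * N)" using n by (simp only: of_nat_le_iff)
            then have "real n \<le> (2 * real A + 2) * real N" by (simp add: algebra_simps)
            then have "\<delta> * real n \<le> \<delta> * ((2 * real A + 2) * real N)" using \<delta>(1) by (intro mult_left_mono) auto
            also have "\<dots> = real N / 2" unfolding mult.assoc[symmetric] \<delta>(2) by simp
            finally show ?thesis .
          qed
          moreover have "real_of_int x0 < real N / 2" using N by linarith
          ultimately have "real_of_int x0 - real N < real_of_int (X n \<omega>)" by linarith
          then show ?thesis by linarith
        qed
        then show ?thesis unfolding eventually_sequentially by blast
      qed
      ultimately show False using elim(3) x0_def by blast
    qed
  qed
qed

end

text \<open>Additional cookies of strength \<open>q \<ge> 1/2\<close> only relax the bound 1/2 valid
  after \<open>M\<close> visits. They lower the drift, which allows an exact critical value to be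
  reached; \<open>r = 0\<close> keeps the original environment.\<close>

lemma cookie_walk_padded:
  fixes \<eta> :: "nat \<Rightarrow> real"
  assumes "prob_space P" "nn_walk P X"
    and \<eta>: "\<And>k. k \<in> {1..M} \<Longrightarrow> \<eta> k \<in> {0..<1}"
    and le: "AE \<omega> in P. \<forall>k\<in>{1..M}. \<forall>n. prob_up P X n \<omega> * of_bool (visits (\<lambda>m. X m \<omega>) n = k) \<le> \<eta> k"
    and half: "AE \<omega> in P. \<forall>k>M. \<forall>n. prob_up P X n \<omega> * of_bool (visits (\<lambda>m. X m \<omega>) n = k) \<le> 1 / 2"
    and q: "q \<in> {1/2..<1}"
  shows "cookie_walk P X (map \<eta> [1..<Suc M] @ replicate r q)"
proof -
  interpret prob_space P by fact
  let ?hs = "map \<eta> [1..<Suc M] @ replicate r q"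
  show ?thesis
  proof
    show "nn_walk P X" by fact
    show "AE \<omega> in P. \<forall>n. prob_up P X n \<omega> \<le> arrow_prob ?hs (length (arrows (\<lambda>m. X m \<omega>) n (X n \<omega>)))"
      using le half
    proof eventually_elim
      case (elim \<omega>)
      show ?case
      proof
        fix n
        define k where "k = length (arrows (\<lambda>m. X m \<omega>) n (X n \<omega>))"
        have v: "visits (\<lambda>m. X m \<omega>) n = Suc k" by (simp add: visits_eq_length k_def)
        show "prob_up P X n \<omega> \<le> arrow_prob ?hs (length (arrows (\<lambda>m. X m \<omega>) n (X n \<omega>)))"
          unfolding k_def[symmetric]
        proof (cases "k < M")
          case True
          have "prob_up P X n \<omega> * of_bool (visits (\<lambda>m. X m \<omega>) n = Suc k) \<le> \<eta> (Suc k)"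
            using elim(1) True by auto
          then show "prob_up P X n \<omega> \<le> arrow_prob ?hs k"
            using True v by (simp add: arrow_prob_def nth_append del: upt_Suc)
        next
          case False
          have "prob_up P X n \<omega> * of_bool (visits (\<lambda>m. X m \<omega>) n = Suc k) \<le> 1 / 2"
            using elim(2) False by auto
          then have "prob_up P X n \<omega> \<le> 1 / 2" using v by simp
          also have "1 / 2 \<le> arrow_prob ?hs k"
            using False q by (simp add: arrow_prob_def nth_append del: upt_Suc)
          finally show "prob_up P X n \<omega> \<le> arrow_prob ?hs k" .
        qed
      qed
    qed
    show "set ?hs \<subseteq> {0..<1}" using \<eta> q by (auto simp del: upt_Suc)
  qed
qed

lemma drift_padded:
  "drift (map \<eta> [1..<Suc M] @ replicate r q) = - (\<Sum>k=1..M. 2 * \<eta> k - 1) - real r * (2 * q - 1)"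
proof -
  have "drift (map \<eta> [1..<Suc M]) = - (\<Sum>k=1..M. 2 * \<eta> k - 1)"
    by (induction M) (simp_all add: drift_def)
  moreover have "drift (replicate r q) = - real r * (2 * q - 1)"
    by (induction r) (simp_all add: drift_def algebra_simps)
  moreover have "drift (xs @ ys) = drift xs + drift ys" for xs ys by (simp add: drift_def)
  ultimately show ?thesis by simp
qed

theorem theorem5p3:
  fixes P :: "'a measure" and X :: "nat \<Rightarrow> 'a \<Rightarrow> int"
    and M :: nat and \<eta> :: "nat \<Rightarrow> real" and \<alpha> :: real
  assumes "prob_space P"
    and "nn_walk P X"
    and "M \<ge> 1"
    and "\<And>k. k \<in> {1..M} \<Longrightarrow> \<eta> k \<in> {0..<1}"
    and "AE \<omega> in P. \<forall>k\<in>{1..M}. \<forall>n.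
           prob_up P X n \<omega> * of_bool (visits (\<lambda>m. X m \<omega>) n = k) \<le> \<eta> k"
    and "AE \<omega> in P. \<forall>k>M. \<forall>n.
           prob_up P X n \<omega> * of_bool (visits (\<lambda>m. X m \<omega>) n = k) \<le> 1 / 2"
    and "\<alpha> = (\<Sum>k=1..M. (2 * \<eta> k - 1))"
  shows "(\<alpha> \<le> 1 \<longrightarrow> (AE \<omega> in P. \<not> transient_right (\<lambda>n. X n \<omega>))) \<and>
    (\<alpha> \<le> 2 \<longrightarrow> (AE \<omega> in P. limsup (\<lambda>n. ereal (real_of_int (X n \<omega>) / real n)) \<le> 0)) \<and>
    (\<alpha> < -1 \<longrightarrow> (AE \<omega> in P. transient_left (\<lambda>n. X n \<omega>))) \<and>
    (\<alpha> < -2 \<longrightarrow> (AE \<omega> in P. liminf (\<lambda>n. ereal (real_of_int (X n \<omega>) / real n)) < 0))"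
proof -
  note padded = cookie_walk_padded[OF assms(1,2,4,5,6)]
  have pad: "\<exists>hs. cookie_walk P X hs \<and> drift hs = - \<beta>" if "\<alpha> \<le> \<beta>" for \<beta>
  proof -
    \<comment> \<open>The missing amount \<open>\<beta> - \<alpha>\<close> is shared equally among
      \<open>r\<close> cookies, enough of them to keep the strength \<open>q\<close> below
      1.\<close>
    define r where "r = Suc (nat \<lceil>\<beta> - \<alpha>\<rceil>)"
    define q where "q = 1 / 2 + (\<beta> - \<alpha>) / (2 * real r)"
    have r: "0 < real r" "\<beta> - \<alpha> < real r" unfolding r_def by linarith+
    have "q \<in> {1/2..<1}" using that r by (simp add: q_def field_simps)
    moreover have "real r * (2 * q - 1) = \<beta> - \<alpha>" using r by (simp add: q_def field_simps)
    ultimately show ?thesis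
      using padded[of q r] drift_padded[of \<eta> M r q] assms(7) by (intro exI conjI) auto
  qed
  have plain: "cookie_walk P X (map \<eta> [1..<Suc M])" "drift (map \<eta> [1..<Suc M]) = - \<alpha>"
    using padded[of "1/2" 0] drift_padded[of \<eta> M 0 "1/2"] assms(7) by (auto simp del: upt_Suc)
  have a: "AE \<omega> in P. \<not> transient_right (\<lambda>n. X n \<omega>)" if "\<alpha> \<le> 1"
  proof -
    obtain hs where "cookie_walk P X hs" "drift hs = - 1" using pad[OF \<open>\<alpha> \<le> 1\<close>] by blast
    then show ?thesis by (rule cookie_walk.not_transient_right)
  qed
  have b: "AE \<omega> in P. limsup (\<lambda>n. ereal (real_of_int (X n \<omega>) / real n)) \<le> 0" if "\<alpha> \<le> 2"
  proof -
    obtain hs where "cookie_walk P X hs" "drift hs = - 2" using pad[OF \<open>\<alpha> \<le> 2\<close>] by blast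
    then show ?thesis by (rule cookie_walk.speed_nonpos)
  qed
  have c: "AE \<omega> in P. transient_left (\<lambda>n. X n \<omega>)" if "\<alpha> < -1"
    using cookie_walk.transient_left[OF plain(1) _ a] that plain(2) by simp
  have d: "AE \<omega> in P. liminf (\<lambda>n. ereal (real_of_int (X n \<omega>) / real n)) < 0" if "\<alpha> < -2"
    using cookie_walk.speed_negative[OF plain(1) _ c] that plain(2) by simp
  show ?thesis using a b c d by blast
qed

end
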